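(* Fix $0<\delta\le1/2$. Let $n>2$, let $D=(d_1,\ldots,d_n)$ be a degree sequence with $\mathcal{P}(D)\ne\emptyset$ and maximum entropy matrix $z=(\zeta_{\{j,k\}})$, and suppose $\delta\le\zeta_{\{j,k\}}\le1-\delta$ for all $j\ne k$. Let $\mathcal{U}=\{(\tau_1,\ldots,\tau_n):|\tau_k|\le\frac{\ln n}{\sqrt n},\ k=1,\ldots,n\}$, let $\Xi=\int_{\mathbb{R}^n}e^{-q(t)}dt$, consider the Gaussian probability measure on $\mathbb{R}^n$ with density $\Xi^{-1}e^{-q}$, and let $\mu=\mathbf{E}f^2$, $\nu=\mathbf{E}h$. Then: (1) $\Xi\ge(4\pi/n)^{n/2}$; (2) $\mu,\ |\nu|,\ \mathbf{E}|h|\le\gamma(\delta)$ for some constant $\gamma(\delta)>0$; (3) for any $0<\epsilon\le1/2$, $\big|\int_{\mathcal{U}}|F(t)|\,dt-e^{\nu}\,\Xi\big|\le\epsilon\,\Xi$ provided $n\ge(1/\epsilon)^{\gamma(\delta)}$ for some constant $\gamma(\delta)>0$; (4) for any $0<\epsilon\le1/2$, $\big|\int_{\mathcal{U}}F(t)\,dt-\exp\{-\frac\mu2+\nu\}\,\Xi\big|\le\epsilon\,\Xi$ provided $n\ge(1/\epsilon)^{\gamma(\delta)}$ for some $\gamma(\delta)>0$.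
   Context: Coordinates of $\mathbb{R}^{\binom n2}$ are indexed by unordered pairs $\{j,k\}$, $1\le j\ne k\le n$; sums/products over $\{j,k\}$ range over all such pairs. $\mathcal{P}(D)$ is the polytope of $x=(\xi_{\{j,k\}})$ with $\sum_{j:\,j\ne k}\xi_{\{j,k\}}=d_k$ and $0\le\xi_{\{j,k\}}\le1$; $H(x)=\sum_{\{j,k\}}\big(\xi_{\{j,k\}}\ln\frac1{\xi_{\{j,k\}}}+(1-\xi_{\{j,k\}})\ln\frac1{1-\xi_{\{j,k\}}}\big)$, and its unique maximizer $z$ on $\mathcal{P}(D)$ is the maximum entropy matrix. For $t=(\tau_1,\ldots,\tau_n)$: $F(t)=\exp\{-i\sum_{m=1}^n d_m\tau_m\}\prod_{\{j,k\}}(1-\zeta_{\{j,k\}}+\zeta_{\{j,k\}}e^{i(\tau_j+\tau_k)})$ with $i=\sqrt{-1}$; $q(t)=\frac12\sum_{\{j,k\}}(\zeta_{\{j,k\}}-\zeta^2_{\{j,k\}})(\tau_j+\tau_k)^2$; $f(t)=\frac16\sum_{\{j,k\}}\zeta_{\{j,k\}}(1-\zeta_{\{j,k\}})(2\zeta_{\{j,k\}}-1)(\tau_j+\tau_k)^3$; $h(t)=\frac1{24}\sum_{\{j,k\}}\zeta_{\{j,k\}}(1-\zeta_{\{j,k\}})(6\zeta^2_{\{j,k\}}-6\zeta_{\{j,k\}}+1)(\tau_j+\tau_k)^4$. The constants $\gamma(\delta)$ depend only on $\delta$. *)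

theory Defs
  imports "HOL-Analysis.Analysis" "HOL-Library.Ramsey"
begin

text \<open>Vertices are \<open>1..n\<close>. A point of the space indexed by unordered pairs is a function
  \<open>x :: nat set \<Rightarrow> real\<close>, so the coordinate indexed by the pair \<open>{j, k}\<close> is literally \<open>x {j, k}\<close>.
  A point \<open>t\<close> of \<open>n\<close>-dimensional space is a function \<open>nat \<Rightarrow> real\<close> on \<open>{1..n}\<close>; for a pair
  \<open>e = {j, k}\<close> with \<open>j \<noteq> k\<close>, the expression \<open>\<Sum>v\<in>e. t v\<close> is \<open>t j + t k\<close>. The dimension is a
  natural number rather than a type because the constants must be chosen uniformly in \<open>n\<close>.\<close>

abbreviation edges :: "nat \<Rightarrow> nat set set" where
  "edges n \<equiv> nsets {1..n} 2"

text \<open>The members of the polytope are \<^emph>\<open>extensional\<close> on \<open>edges n\<close>, so that equal coordinates means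
  equal functions.\<close>

definition degree_polytope :: "nat \<Rightarrow> (nat \<Rightarrow> nat) \<Rightarrow> (nat set \<Rightarrow> real) set" where
  "degree_polytope n d =
     {x \<in> edges n \<rightarrow>\<^sub>E {0..1}. \<forall>k\<in>{1..n}. (\<Sum>j\<in>{1..n} - {k}. x {j, k}) = real (d k)}"

text \<open>At \<open>x e = 0\<close> and \<open>x e = 1\<close> the summand is \<open>0\<close>, the usual convention, because a factor \<open>0\<close> is present.\<close>

definition entropy :: "nat \<Rightarrow> (nat set \<Rightarrow> real) \<Rightarrow> real" where
  "entropy n x = (\<Sum>e\<in>edges n. x e * ln (1 / x e) + (1 - x e) * ln (1 / (1 - x e)))"

definition max_entropy_matrix :: "nat \<Rightarrow> (nat \<Rightarrow> nat) \<Rightarrow> (nat set \<Rightarrow> real) \<Rightarrow> bool" where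
  "max_entropy_matrix n d z \<longleftrightarrow> is_arg_max (entropy n) (\<lambda>x. x \<in> degree_polytope n d) z"

definition F :: "nat \<Rightarrow> (nat \<Rightarrow> nat) \<Rightarrow> (nat set \<Rightarrow> real) \<Rightarrow> (nat \<Rightarrow> real) \<Rightarrow> complex" where
  "F n d z t =
     exp (- \<i> * of_real (\<Sum>m\<in>{1..n}. real (d m) * t m)) *
     (\<Prod>e\<in>edges n. 1 - of_real (z e) + of_real (z e) * exp (\<i> * of_real (\<Sum>v\<in>e. t v)))"

definition q :: "nat \<Rightarrow> (nat set \<Rightarrow> real) \<Rightarrow> (nat \<Rightarrow> real) \<Rightarrow> real" where
  "q n z t = 1 / 2 * (\<Sum>e\<in>edges n. (z e - (z e)\<^sup>2) * (\<Sum>v\<in>e. t v)\<^sup>2)"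

definition f :: "nat \<Rightarrow> (nat set \<Rightarrow> real) \<Rightarrow> (nat \<Rightarrow> real) \<Rightarrow> real" where
  "f n z t = 1 / 6 * (\<Sum>e\<in>edges n. z e * (1 - z e) * (2 * z e - 1) * (\<Sum>v\<in>e. t v) ^ 3)"

definition h :: "nat \<Rightarrow> (nat set \<Rightarrow> real) \<Rightarrow> (nat \<Rightarrow> real) \<Rightarrow> real" where
  "h n z t =
     1 / 24 * (\<Sum>e\<in>edges n. z e * (1 - z e) * (6 * (z e)\<^sup>2 - 6 * z e + 1) * (\<Sum>v\<in>e. t v) ^ 4)"

abbreviation lebesgue_space :: "nat \<Rightarrow> (nat \<Rightarrow> real) measure" where
  "lebesgue_space n \<equiv> Pi\<^sub>M {1..n} (\<lambda>_. lborel)"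

definition Xi :: "nat \<Rightarrow> (nat set \<Rightarrow> real) \<Rightarrow> real" where
  "Xi n z = (LINT t|lebesgue_space n. exp (- q n z t))"

definition gaussian :: "nat \<Rightarrow> (nat set \<Rightarrow> real) \<Rightarrow> (nat \<Rightarrow> real) measure" where
  "gaussian n z = density (lebesgue_space n) (\<lambda>t. ennreal (exp (- q n z t) / Xi n z))"

definition \<mu> :: "nat \<Rightarrow> (nat set \<Rightarrow> real) \<Rightarrow> real" where
  "\<mu> n z = (LINT t|gaussian n z. (f n z t)\<^sup>2)"

definition \<nu> :: "nat \<Rightarrow> (nat set \<Rightarrow> real) \<Rightarrow> real" where
  "\<nu> n z = (LINT t|gaussian n z. h n z t)"

definition U :: "nat \<Rightarrow> (nat \<Rightarrow> real) set" where
  "U n = {1..n} \<rightarrow>\<^sub>E {- (ln (real n) / sqrt (real n)) .. ln (real n) / sqrt (real n)}"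

end

(*
On the box U, expanding the logarithm of each factor of F to fourth order gives
F = exp(-q + i f + h + small); the linear terms cancel because z lies in the degree polytope. So
everything is a statement about the Gaussian measure with density proportional to exp(-q), where
q(t) >= c n |t|^2 with c depending on delta only.

Concentration. By the Prekopa-Leindler inequality, E exp(g) E exp(-g) <= exp(L^2 / kappa) for every
L-Lipschitz g if the Hessian of q is at least kappa. Clipping all coordinates to U is a contraction,
so a polynomial which is L-Lipschitz on U only is concentrated as well. On U, h is Lipschitz with a
polylogarithmic constant while kappa has order n; hence exp(h) may be replaced by exp(E h), both in
the integral of |F| and in the integral of F.

The cubic phase. Gaussian integration by parts gives E[f psi(f)] = E[Gamma psi'(f)] for an explicit
quartic polynomial Gamma with mean mu. Since Gamma is also Lipschitz with a polylogarithmic constant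
on U, it is concentrated, so phi(s) = E exp(i s f) nearly satisfies phi' = - mu s phi, which gives
E exp(i f) = exp(-mu / 2) + o(1).
*)
theory Submission
  imports Defs "HOL-Probability.Characteristic_Functions" "HOL-Real_Asymp.Real_Asymp"
begin

section \<open>The Prekopa-Leindler inequality\<close>

text \<open>The cubic \<open>f\<close> cannot be handled like \<open>h\<close>: on \<open>U\<close>
  its Lipschitz constant has order \<open>sqrt n\<close> up to logarithms, the critical size for a
  Hessian of order \<open>n\<close>, so its fluctuations need not vanish and
  \<open>exp (i f)\<close> cannot be replaced by its value at the mean. Integration by parts trades
  it for a kernel whose Lipschitz constant is only polylogarithmic. Quartic polynomials are not
  globally Lipschitz, and their exponentials need not be integrable against a Gaussian. After
  composition with clipping they are globally Lipschitz; the price is the mass outside the box, at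
  most \<open>2 n exp (- c (ln n)^2)\<close>, which is smaller than every power of \<open>n\<close>.
  This is where the factor \<open>ln n\<close> in the width of \<open>U\<close> matters. Uniformity
  in \<open>n\<close> comes from stating all bounds through \<open>N / \<kappa>\<close>, where
  \<open>N\<close> is the dimension, and \<open>L^2 / \<kappa>\<close>, where \<open>L\<close> is a
  Lipschitz constant. The first stays below \<open>6 / \<delta>\<close>, the second is
  polylogarithmic over \<open>n\<close>. Square roots of the second, and the fifth-order remainder
  of the logarithm, decay like \<open>n\<close> to the power \<open>-1/2\<close> up to logarithms,
  so a threshold polynomial in \<open>1 / \<epsilon>\<close> suffices.\<close>

text \<open>For \<open>a \<in> A\<close> and \<open>b \<in> B\<close>, the sum set contains the translates of \<open>{x \<in> A. x \<le> a}\<close> by \<open>b\<close> and of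
  \<open>{y \<in> B. y \<ge> b}\<close> by \<open>a\<close>, which share a single point.\<close>

lemma brunn_minkowski_real:
  fixes A B C :: "real set"
  assumes [measurable]: "A \<in> sets borel" "B \<in> sets borel" "C \<in> sets borel"
    and "A \<noteq> {}" "B \<noteq> {}" "bdd_above A" "bdd_below B"
    and mid: "\<And>x y. x \<in> A \<Longrightarrow> y \<in> B \<Longrightarrow> (x + y) / 2 \<in> C"
  shows "emeasure lborel A + emeasure lborel B \<le> 2 * emeasure lborel C"
proof (rule ennreal_le_epsilon)
  fix e :: real assume "e > 0"
  \<comment> \<open>\<open>Sup A\<close> and \<open>Inf B\<close> need not be attained. Points
    within \<open>e / 2\<close> of them serve instead, and cutting \<open>A\<close> and
    \<open>B\<close> there loses measure at most \<open>e / 2\<close> each.\<close>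
  obtain a where a: "a \<in> A" "Sup A - e / 2 < a"
    using less_cSup_iff[OF \<open>A \<noteq> {}\<close> \<open>bdd_above A\<close>, of "Sup A - e / 2"] \<open>e > 0\<close> by auto
  obtain b where b: "b \<in> B" "b < Inf B + e / 2"
    using cInf_less_iff[OF \<open>B \<noteq> {}\<close> \<open>bdd_below B\<close>, of "Inf B + e / 2"] \<open>e > 0\<close> by auto
  define P where "P = {x. x - b \<in> A \<and> x - b \<le> a}"
  define R where "R = {x. x - a \<in> B \<and> x - a \<ge> b}"
  define D where "D = {x. x / 2 \<in> C}"
  have [measurable]: "P \<in> sets borel" "R \<in> sets borel" "D \<in> sets borel"
    unfolding P_def R_def D_def by measurable
  have trans: "emeasure lborel {x. x - c \<in> S} = emeasure lborel S"
    if [measurable]: "S \<in> sets borel" for c :: real and S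
  proof -
    have "emeasure lborel S = emeasure (distr lborel borel ((+) (-c))) S"
      by (simp add: lborel_distr_plus)
    also have "\<dots> = emeasure lborel {x. x - c \<in> S}"
      by (subst emeasure_distr) (auto intro!: arg_cong[where f="emeasure lborel"])
    finally show ?thesis ..
  qed
  have "emeasure lborel D = (\<integral>\<^sup>+x. indicator C (x / 2) \<partial>lborel)"
    by (subst nn_integral_indicator[symmetric], simp)
       (intro nn_integral_cong, simp add: D_def indicator_def)
  moreover have "emeasure lborel C = ennreal (1 / 2) * (\<integral>\<^sup>+x. indicator C (x / 2) \<partial>lborel)"
    using nn_integral_real_affine[of "indicator C" "1/2" 0] by simp
  moreover have "2 * ennreal (1 / 2) = 1"
    using ennreal_mult[of 2 "1 / 2"] by simp
  ultimately have D: "emeasure lborel D = 2 * emeasure lborel C"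
    by (metis mult.assoc mult_1)
  have "P \<inter> R \<subseteq> {a + b}" unfolding P_def R_def by auto
  then have PR: "emeasure lborel (P \<inter> R) = 0"
    using emeasure_mono[of "P \<inter> R" "{a + b}" lborel] by simp
  have "P \<union> R \<subseteq> D"
    using mid[OF _ b(1)] mid[OF a(1)] unfolding P_def R_def D_def by fastforce
  then have "emeasure lborel (P \<union> R) \<le> 2 * emeasure lborel C"
    unfolding D[symmetric] by (intro emeasure_mono) auto
  then have PR': "emeasure lborel P + emeasure lborel R \<le> 2 * emeasure lborel C"
    using emeasure_Un_Int[of P lborel R] PR by simp
  have "emeasure lborel A \<le> emeasure lborel ({x\<in>A. x \<le> a} \<union> {a<..Sup A})"
    using cSup_upper[OF _ \<open>bdd_above A\<close>] by (intro emeasure_mono) auto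
  also have "\<dots> \<le> emeasure lborel {x\<in>A. x \<le> a} + emeasure lborel {a<..Sup A}"
    by (intro emeasure_subadditive) auto
  also have "\<dots> \<le> emeasure lborel {x\<in>A. x \<le> a} + ennreal (e / 2)"
    using a cSup_upper[OF _ \<open>bdd_above A\<close>] by (intro add_left_mono) (auto intro!: ennreal_leI)
  also have "emeasure lborel {x\<in>A. x \<le> a} = emeasure lborel P"
    using trans[of "{x\<in>A. x \<le> a}" b] by (simp add: P_def)
  finally have 1: "emeasure lborel A \<le> emeasure lborel P + ennreal (e / 2)" .
  have "emeasure lborel B \<le> emeasure lborel ({x\<in>B. x \<ge> b} \<union> {Inf B..<b})"
    using cInf_lower[OF _ \<open>bdd_below B\<close>] by (intro emeasure_mono) auto
  also have "\<dots> \<le> emeasure lborel {x\<in>B. x \<ge> b} + emeasure lborel {Inf B..<b}"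
    by (intro emeasure_subadditive) auto
  also have "\<dots> \<le> emeasure lborel {x\<in>B. x \<ge> b} + ennreal (e / 2)"
    using b cInf_lower[OF _ \<open>bdd_below B\<close>] by (intro add_left_mono) (auto intro!: ennreal_leI)
  also have "emeasure lborel {x\<in>B. x \<ge> b} = emeasure lborel R"
    using trans[of "{x\<in>B. x \<ge> b}" a] by (simp add: R_def)
  finally have 2: "emeasure lborel B \<le> emeasure lborel R + ennreal (e / 2)" .
  have "emeasure lborel A + emeasure lborel B
      \<le> (emeasure lborel P + emeasure lborel R) + (ennreal (e / 2) + ennreal (e / 2))"
    using add_mono[OF 1 2] by (simp add: ac_simps)
  also have "ennreal (e / 2) + ennreal (e / 2) = ennreal e"
    using \<open>e > 0\<close> by (simp flip: ennreal_plus)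
  finally show "emeasure lborel A + emeasure lborel B \<le> 2 * emeasure lborel C + ennreal e"
    using PR' by (meson add_right_mono order_trans)
qed

text \<open>Heights are written as \<open>s * a\<close> with \<open>s\<close> between 0 and 1, so
  that functions of different size can be compared at the same relative height. Heights above
  \<open>a\<close> are not seen, whence the minimum.\<close>

lemma nn_integral_layer_cake:
  fixes u :: "real \<Rightarrow> real"
  assumes [measurable]: "u \<in> borel_measurable borel" and "a > 0" "\<And>x. 0 \<le> u x"
  shows "(\<integral>\<^sup>+x. ennreal (min a (u x)) \<partial>lborel)
    = ennreal a * (\<integral>\<^sup>+s. emeasure lborel {x. s * a < u x} * indicator {0<..<1} s \<partial>lborel)"
proof -
  have inner: "(\<integral>\<^sup>+s. indicator {0<..<1} s * indicator {x. s * a < u x} x \<partial>lborel)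
      = ennreal (min a (u x) / a)" for x
  proof -
    have "(\<integral>\<^sup>+s. indicator {0<..<1} s * indicator {x. s * a < u x} x \<partial>lborel)
       = (\<integral>\<^sup>+s. indicator {0<..<min a (u x) / a} s \<partial>lborel)"
    proof (intro nn_integral_cong)
      fix s :: real
      have "s < 1 \<longleftrightarrow> s * a < a" using \<open>a > 0\<close> by simp
      then show "indicator {0<..<1} s * indicator {x. s * a < u x} x
          = (indicator {0<..<min a (u x) / a} s :: ennreal)"
        using \<open>a > 0\<close> by (auto simp: indicator_def pos_less_divide_eq)
    qed
    also have "\<dots> = ennreal (min a (u x) / a)"
      using assms by simp
    finally show ?thesis .
  qed
  have "(\<integral>\<^sup>+s. emeasure lborel {x. s * a < u x} * indicator {0<..<1} s \<partial>lborel)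
    = (\<integral>\<^sup>+s. (\<integral>\<^sup>+x. indicator {0<..<1} s * indicator {x. s * a < u x} x \<partial>lborel) \<partial>lborel)"
    by (intro nn_integral_cong) (simp add: nn_integral_cmult mult.commute)
  also have "\<dots> = (\<integral>\<^sup>+x. (\<integral>\<^sup>+s. indicator {0<..<1} s * indicator {x. s * a < u x} x \<partial>lborel) \<partial>lborel)"
    by (rule lborel_pair.Fubini') measurable
  also have "\<dots> = (\<integral>\<^sup>+x. ennreal (min a (u x) / a) \<partial>lborel)"
    by (simp add: inner)
  also have "ennreal a * \<dots> = (\<integral>\<^sup>+x. ennreal a * ennreal (min a (u x) / a) \<partial>lborel)"
    by (rule nn_integral_cmult[symmetric]) measurable
  also have "\<dots> = (\<integral>\<^sup>+x. ennreal (min a (u x)) \<partial>lborel)"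
    using assms by (intro nn_integral_cong) (simp flip: ennreal_mult)
  finally show ?thesis ..
qed

text \<open>AM-GM, which turns the additive inequality for level sets into the multiplicative one
  for integrals.\<close>

lemma ennreal_four_mult_le_add_sq: "4 * (P * R) \<le> (P + R)\<^sup>2" for P R :: ennreal
proof (cases P; cases R)
  fix p r assume *: "P = ennreal p" "0 \<le> p" "R = ennreal r" "0 \<le> r"
  have "4 * (p * r) \<le> (p + r)\<^sup>2"
    using zero_le_power2[of "p - r"] by (simp add: power2_eq_square algebra_simps)
  then show ?thesis
    using * by (simp add: ennreal_power flip: ennreal_plus ennreal_mult ennreal_numeral)
qed (auto simp: power2_eq_square ennreal_top_mult ennreal_mult_top add_top)

text \<open>Let \<open>a\<close>, \<open>b\<close> be the suprema of \<open>u\<close>,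
  \<open>v\<close> and \<open>c = sqrt (a * b)\<close>. The midpoint of a point with
  \<open>u > s * a\<close> and a point with \<open>v > s * b\<close> has \<open>w > s * c\<close>.
  Heights relative to the suprema keep both level sets nonempty for every \<open>s < 1\<close>, and
  the supports keep them bounded, so \<open>brunn_minkowski_real\<close> applies; integrating over
  \<open>s\<close> and AM-GM finish the proof.\<close>

lemma prekopa_leindler_real_bounded:
  fixes u v w :: "real \<Rightarrow> real"
  assumes [measurable]: "u \<in> borel_measurable borel" "v \<in> borel_measurable borel"
      "w \<in> borel_measurable borel"
    and nn: "\<And>x. 0 \<le> u x" "\<And>x. 0 \<le> v x" "\<And>x. 0 \<le> w x"
    and bd: "\<And>x. u x \<le> K" "\<And>x. v x \<le> K"
    and supp: "\<And>x. K < \<bar>x\<bar> \<Longrightarrow> u x = 0" "\<And>x. K < \<bar>x\<bar> \<Longrightarrow> v x = 0"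
    and le: "\<And>x y. u x * v y \<le> (w ((x + y) / 2))\<^sup>2"
  shows "(\<integral>\<^sup>+x. u x \<partial>lborel) * (\<integral>\<^sup>+x. v x \<partial>lborel) \<le> (\<integral>\<^sup>+x. w x \<partial>lborel)\<^sup>2"
proof -
  define a where "a = (SUP x. u x)"
  define b where "b = (SUP x. v x)"
  have bdd: "bdd_above (range u)" "bdd_above (range v)"
    using bd by (auto intro!: bdd_aboveI[where M=K])
  have ua: "u x \<le> a" and vb: "v x \<le> b" for x
    unfolding a_def b_def using bdd by (auto intro!: cSUP_upper)
  show ?thesis
  proof (cases "a = 0 \<or> b = 0")
    case True
    then have "(\<forall>x. u x = 0) \<or> (\<forall>x. v x = 0)" using ua vb nn by (metis order_antisym)
    then show ?thesis by auto
  next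
    case False
    then have ab: "a > 0" "b > 0"
      using ua[of 0] vb[of 0] nn(1)[of 0] nn(2)[of 0] by linarith+
    define c where "c = sqrt (a * b)"
    have c: "c > 0" "c\<^sup>2 = a * b" using ab by (auto simp: c_def)
    define m where "m t r = (\<integral>\<^sup>+s. emeasure lborel {x. s * r < t x} * indicator {0<..<1} s \<partial>lborel)"
      for t :: "real \<Rightarrow> real" and r :: real
    have u: "(\<integral>\<^sup>+x. u x \<partial>lborel) = ennreal a * m u a"
      using nn_integral_layer_cake[of u a] ab nn ua by (simp add: m_def min_absorb2)
    have v: "(\<integral>\<^sup>+x. v x \<partial>lborel) = ennreal b * m v b"
      using nn_integral_layer_cake[of v b] ab nn vb by (simp add: m_def min_absorb2)
    \<comment> \<open>For \<open>w\<close> there is only an inequality: it may exceed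
      \<open>c\<close>, and what lies above is discarded.\<close>
    have "ennreal c * m w c = (\<integral>\<^sup>+x. ennreal (min c (w x)) \<partial>lborel)"
      using nn_integral_layer_cake[of w c] c nn by (simp add: m_def)
    also have "\<dots> \<le> (\<integral>\<^sup>+x. w x \<partial>lborel)"
      by (intro nn_integral_mono) (auto intro!: ennreal_leI)
    finally have w: "ennreal c * m w c \<le> (\<integral>\<^sup>+x. w x \<partial>lborel)" .
    have bm: "emeasure lborel {x. s * a < u x} + emeasure lborel {x. s * b < v x}
        \<le> 2 * emeasure lborel {x. s * c < w x}" if s: "0 < s" "s < 1" for s
    proof (rule brunn_minkowski_real)
      have "s * a < a" "s * b < b" using s ab by auto
      then show "{x. s * a < u x} \<noteq> {}" "{x. s * b < v x} \<noteq> {}"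
        using less_cSUP_iff[OF _ bdd(1), of "s * a"] less_cSUP_iff[OF _ bdd(2), of "s * b"]
        by (auto simp: a_def b_def)
      have "x \<le> K" if "s * a < u x" for x
        using that supp(1)[of x] mult_pos_pos[OF s(1) ab(1)] by force
      then show "bdd_above {x. s * a < u x}" by (auto intro!: bdd_aboveI[where M=K])
      have "- K \<le> x" if "s * b < v x" for x
        using that supp(2)[of x] mult_pos_pos[OF s(1) ab(2)] by force
      then show "bdd_below {x. s * b < v x}" by (auto intro!: bdd_belowI[where m="-K"])
      fix x y assume "x \<in> {x. s * a < u x}" "y \<in> {x. s * b < v x}"
      then have "(s * a) * (s * b) < u x * v y"
        using s ab by (intro mult_strict_mono) (auto intro: order.strict_trans[rotated])
      also have "\<dots> \<le> (w ((x + y) / 2))\<^sup>2" by (rule le)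
      finally have "(s * c)\<^sup>2 < (w ((x + y) / 2))\<^sup>2"
        unfolding power_mult_distrib c(2) by (simp add: power2_eq_square ac_simps)
      then show "(x + y) / 2 \<in> {x. s * c < w x}"
        using nn(3) by (simp add: power2_less_imp_less)
    qed measurable
    have "m u a + m v b = (\<integral>\<^sup>+s. emeasure lborel {x. s * a < u x} * indicator {0<..<1} s
        + emeasure lborel {x. s * b < v x} * indicator {0<..<1} s \<partial>lborel)"
      unfolding m_def by (subst nn_integral_add) auto
    also have "\<dots> \<le> (\<integral>\<^sup>+s. 2 * (emeasure lborel {x. s * c < w x} * indicator {0<..<1} s) \<partial>lborel)"
      using bm by (intro nn_integral_mono) (auto simp: indicator_def)
    also have "\<dots> = 2 * m w c"
      unfolding m_def by (rule nn_integral_cmult) measurable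
    finally have "(m u a + m v b)\<^sup>2 \<le> (2 * m w c)\<^sup>2" by (intro power_mono) auto
    then have "4 * (m u a * m v b) \<le> 4 * (m w c)\<^sup>2"
      using ennreal_four_mult_le_add_sq[of "m u a" "m v b"] by (simp add: power_mult_distrib)
    then have "m u a * m v b \<le> (m w c)\<^sup>2"
      using ennreal_mult_le_mult_iff[of 4 "m u a * m v b" "(m w c)\<^sup>2"] by simp
    then have "(ennreal a * ennreal b) * (m u a * m v b) \<le> (ennreal a * ennreal b) * (m w c)\<^sup>2"
      by (rule mult_left_mono) simp
    also have "(ennreal a * ennreal b) * (m w c)\<^sup>2 = (ennreal c * m w c)\<^sup>2"
      using c ab by (simp add: power_mult_distrib ennreal_power flip: ennreal_mult)
    also have "\<dots> \<le> (\<integral>\<^sup>+x. w x \<partial>lborel)\<^sup>2"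
      using power_mono[OF w, of 2] by simp
    finally show ?thesis
      unfolding u v by (simp add: ac_simps)
  qed
qed

text \<open>Truncating height and range reduces this to real functions of bounded support; monotone
  convergence removes the truncation.\<close>

lemma prekopa_leindler_real:
  fixes u v w :: "real \<Rightarrow> ennreal"
  assumes [measurable]: "u \<in> borel_measurable borel" "v \<in> borel_measurable borel"
      "w \<in> borel_measurable borel"
    and le: "\<And>x y. u x * v y \<le> (w ((x + y) / 2))\<^sup>2"
  shows "(\<integral>\<^sup>+x. u x \<partial>lborel) * (\<integral>\<^sup>+x. v x \<partial>lborel) \<le> (\<integral>\<^sup>+x. w x \<partial>lborel)\<^sup>2"
proof -
  define T where "T N t x = (min (of_nat N) (t x)) * indicator {- real N..real N} x"
    for N :: nat and t :: "real \<Rightarrow> ennreal" and x :: real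
  have Tmeas[measurable]: "T N t \<in> borel_measurable borel" if [measurable]: "t \<in> borel_measurable borel" for N t
    unfolding T_def by measurable
  have Tfin: "T N t x < top" for N t x
    by (auto simp: T_def indicator_def min_less_iff_disj of_nat_less_top)
  have TN: "T N t x \<le> of_nat N" for N t x
    by (auto simp: T_def indicator_def)
  have Tt: "T N t x \<le> t x" for N t x
    by (auto simp: T_def indicator_def)
  have step: "(\<integral>\<^sup>+x. T N u x \<partial>lborel) * (\<integral>\<^sup>+x. T N v x \<partial>lborel) \<le> (\<integral>\<^sup>+x. w x \<partial>lborel)\<^sup>2" for N
  proof -
    \<comment> \<open>\<open>w\<close> is capped as well, so that it can be read as a real function.
      The hypothesis survives because the truncated product on the left is at most the square of the
      cap.\<close>
    define w' where "w' x = min (of_nat N) (w x)" for x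
    have w'fin: "w' x < top" for x by (auto simp: w'_def min_less_iff_disj of_nat_less_top)
    have [measurable]: "w' \<in> borel_measurable borel" unfolding w'_def by measurable
    have le': "T N u x * T N v y \<le> (w' ((x + y) / 2))\<^sup>2" for x y
    proof -
      have "T N u x * T N v y \<le> u x * v y" by (intro mult_mono Tt) auto
      also note le
      finally have 1: "T N u x * T N v y \<le> (w ((x + y) / 2))\<^sup>2" .
      have 2: "T N u x * T N v y \<le> (of_nat N)\<^sup>2"
        unfolding power2_eq_square by (intro mult_mono TN) auto
      show ?thesis using 1 2 by (auto simp: w'_def min_def)
    qed
    have "(\<integral>\<^sup>+x. enn2real (T N u x) \<partial>lborel) * (\<integral>\<^sup>+x. enn2real (T N v x) \<partial>lborel)
        \<le> (\<integral>\<^sup>+x. enn2real (w' x) \<partial>lborel)\<^sup>2"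
    proof (rule prekopa_leindler_real_bounded[where K = "real N"])
      show "enn2real (T N u x) \<le> real N" "enn2real (T N v x) \<le> real N" for x
        using enn2real_mono[OF TN[of N u x]] enn2real_mono[OF TN[of N v x]]
        by (auto simp: of_nat_less_top)
      show "enn2real (T N u x) * enn2real (T N v y) \<le> (enn2real (w' ((x + y) / 2)))\<^sup>2" for x y
        using enn2real_mono[OF le'[of x y]] w'fin
        by (simp add: enn2real_mult power2_eq_square ennreal_mult_less_top)
    qed (auto simp: T_def indicator_def abs_le_iff)
    moreover have "ennreal (enn2real (t x)) = t x" if "t x < top" for t :: "real \<Rightarrow> ennreal" and x
      using that by simp
    ultimately have "(\<integral>\<^sup>+x. T N u x \<partial>lborel) * (\<integral>\<^sup>+x. T N v x \<partial>lborel) \<le> (\<integral>\<^sup>+x. w' x \<partial>lborel)\<^sup>2"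
      using Tfin w'fin by simp
    also have "\<dots> \<le> (\<integral>\<^sup>+x. w x \<partial>lborel)\<^sup>2"
      by (intro power_mono nn_integral_mono) (auto simp: w'_def)
    finally show ?thesis .
  qed
  have Tinc: "incseq (\<lambda>N. T N t)" for t
    unfolding incseq_def le_fun_def T_def
    by (auto intro!: mult_mono min.mono of_nat_mono simp: indicator_def min.coboundedI1)
  have Tsup: "(SUP N. T N t x) = t x" for t x
  proof (rule antisym)
    show "(SUP N. T N t x) \<le> t x" by (rule SUP_least) (rule Tt)
    show "t x \<le> (SUP N. T N t x)"
    proof (rule le_SUP_iff[THEN iffD2], intro allI impI)
      fix y assume y: "y < t x"
      obtain N1 where N1: "y < of_nat N1"
        using ennreal_Ex_less_of_nat[of y] y by (metis less_le_trans top_greatest)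
      obtain N2 :: nat where N2: "\<bar>x\<bar> \<le> real N2" using real_arch_simple by blast
      have "y < T (max N1 N2) t x"
        using y N2 less_le_trans[OF N1, of "of_nat (max N1 N2)"]
        by (auto simp: T_def abs_le_iff indicator_def)
      then show "\<exists>i\<in>UNIV. y < T i t x" by blast
    qed
  qed
  have mono: "incseq (\<lambda>N. \<integral>\<^sup>+x. T N t x \<partial>lborel)" for t
    using Tinc[of t] by (auto simp: incseq_def le_fun_def intro!: nn_integral_mono)
  have sup: "(\<integral>\<^sup>+x. t x \<partial>lborel) = (SUP N. \<integral>\<^sup>+x. T N t x \<partial>lborel)"
    if [measurable]: "t \<in> borel_measurable borel" for t
  proof -
    have "(\<integral>\<^sup>+x. t x \<partial>lborel) = (\<integral>\<^sup>+x. (SUP N. T N t x) \<partial>lborel)" by (simp add: Tsup)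
    also have "\<dots> = (SUP N. \<integral>\<^sup>+x. T N t x \<partial>lborel)"
      by (intro nn_integral_monotone_convergence_SUP Tinc) simp
    finally show ?thesis .
  qed
  show ?thesis
    unfolding sup[of u, OF assms(1)] sup[of v, OF assms(2)]
    unfolding SUP_mult_left_ennreal SUP_mult_right_ennreal
  proof (intro SUP_least)
    \<comment> \<open>The product of two suprema carries two independent truncation levels; both are
      raised to their maximum.\<close>
    fix i j
    have "(\<integral>\<^sup>+x. T j u x \<partial>lborel) * (\<integral>\<^sup>+x. T i v x \<partial>lborel)
       \<le> (\<integral>\<^sup>+x. T (max i j) u x \<partial>lborel) * (\<integral>\<^sup>+x. T (max i j) v x \<partial>lborel)"
      using mono by (intro mult_mono) (auto simp: incseq_def)
    also have "\<dots> \<le> (\<integral>\<^sup>+x. w x \<partial>lborel)\<^sup>2" by (rule step)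
    finally show "(\<integral>\<^sup>+x. T j u x \<partial>lborel) * (\<integral>\<^sup>+x. T i v x \<partial>lborel) \<le> (\<integral>\<^sup>+x. w x \<partial>lborel)\<^sup>2" .
  qed
qed

text \<open>Induction on the coordinates: the one-dimensional inequality on the fibres over
  \<open>x\<close>, \<open>y\<close> and their midpoint is exactly the hypothesis needed for the
  functions with one coordinate integrated out.\<close>

lemma prekopa_leindler_PiM:
  fixes u v w :: "('i \<Rightarrow> real) \<Rightarrow> ennreal"
  assumes "finite I"
    and "u \<in> borel_measurable (PiM I (\<lambda>_. lborel))" "v \<in> borel_measurable (PiM I (\<lambda>_. lborel))"
      "w \<in> borel_measurable (PiM I (\<lambda>_. lborel))"
    and "\<And>x y. x \<in> extensional I \<Longrightarrow> y \<in> extensional I \<Longrightarrow>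
      u x * v y \<le> (w (\<lambda>i\<in>I. (x i + y i) / 2))\<^sup>2"
  shows "(\<integral>\<^sup>+x. u x \<partial>PiM I (\<lambda>_. lborel)) * (\<integral>\<^sup>+x. v x \<partial>PiM I (\<lambda>_. lborel))
    \<le> (\<integral>\<^sup>+x. w x \<partial>PiM I (\<lambda>_. lborel))\<^sup>2"
  using assms
proof (induction I arbitrary: u v w rule: finite_induct)
  case empty
  then show ?case
    by (auto simp: nn_integral_empty PiM_empty nn_integral_count_space_finite power2_eq_square restrict_def)
next
  case (insert i I)
  interpret product_sigma_finite "\<lambda>_ :: 'i. lborel :: real measure" ..
  note [measurable] = insert.prems(1-3)
  have upd[measurable]: "(\<lambda>p. (fst p)(i := snd p)) \<in> PiM I (\<lambda>_. lborel) \<Otimes>\<^sub>M lborel \<rightarrow>\<^sub>M PiM (insert i I) (\<lambda>_. lborel :: real measure)"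
    by measurable
  have [measurable]: "(\<lambda>x. \<integral>\<^sup>+y. g (x(i := y)) \<partial>lborel) \<in> borel_measurable (PiM I (\<lambda>_. lborel))"
    if [measurable]: "g \<in> borel_measurable (PiM (insert i I) (\<lambda>_. lborel))"
    for g :: "('i \<Rightarrow> real) \<Rightarrow> ennreal"
    by measurable
  show ?case
    unfolding product_nn_integral_insert[OF insert.hyps insert.prems(1)]
      product_nn_integral_insert[OF insert.hyps insert.prems(2)]
      product_nn_integral_insert[OF insert.hyps insert.prems(3)]
  proof (rule insert.IH)
    fix x y :: "'i \<Rightarrow> real" assume x: "x \<in> extensional I" and y: "y \<in> extensional I"
    define m where "m = (\<lambda>j\<in>I. (x j + y j) / 2)"
    \<comment> \<open>Extensionality of the base point places it in the product space, which makes
      the section measurable.\<close>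
    have sec: "(\<lambda>s. g (a(i := s))) \<in> borel_measurable borel"
      if [measurable]: "g \<in> borel_measurable (PiM (insert i I) (\<lambda>_. lborel))" and "a \<in> extensional I"
      for g :: "('i \<Rightarrow> real) \<Rightarrow> ennreal" and a :: "'i \<Rightarrow> real"
    proof -
      have a: "a \<in> space (PiM I (\<lambda>_. lborel :: real measure))" using that by (simp add: space_PiM PiE_def)
      show ?thesis
        using measurable_compose[OF measurable_Pair1'[OF a] measurable_compose[OF upd that(1)]]
        by simp
    qed
    have m: "m \<in> extensional I" by (simp add: m_def)
    show "(\<integral>\<^sup>+s. u (x(i := s)) \<partial>lborel) * (\<integral>\<^sup>+s. v (y(i := s)) \<partial>lborel)
      \<le> (\<integral>\<^sup>+s. w (m(i := s)) \<partial>lborel)\<^sup>2"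
    proof (rule prekopa_leindler_real)
      fix s t :: real
      have "(\<lambda>j\<in>insert i I. ((x(i := s)) j + (y(i := t)) j) / 2) = m(i := (s + t) / 2)"
        using insert.hyps by (auto simp: m_def restrict_def)
      moreover have "x(i := s) \<in> extensional (insert i I)" "y(i := t) \<in> extensional (insert i I)"
        using x y by (auto simp: extensional_def)
      ultimately show "u (x(i := s)) * v (y(i := t)) \<le> (w (m(i := (s + t) / 2)))\<^sup>2"
        using insert.prems(4)[of "x(i := s)" "y(i := t)"] by metis
    qed (use sec x y m insert.prems in auto)
  qed (use insert.prems in measurable)
qed

section \<open>Gaussian measures given by a quadratic form\<close>

lemma gaussian_integral_real:
  fixes c :: real
  assumes "c > 0"
  shows "integrable lborel (\<lambda>x. exp (- c * x\<^sup>2))" "(LINT x|lborel. exp (- c * x\<^sup>2)) = sqrt (pi / c)"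
proof -
  define \<sigma> where "\<sigma> = 1 / sqrt (2 * c)"
  have \<sigma>: "\<sigma> > 0" "\<sigma>\<^sup>2 = 1 / (2 * c)" using assms by (auto simp: \<sigma>_def power_divide)
  have "sqrt (2 * pi * \<sigma>\<^sup>2) = sqrt (pi / c)" using \<sigma> by simp
  moreover have "- (x - 0)\<^sup>2 / (2 * \<sigma>\<^sup>2) = - c * x\<^sup>2" for x :: real using assms \<sigma> by simp
  ultimately have eq: "exp (- c * x\<^sup>2) = sqrt (pi / c) * normal_density 0 \<sigma> x" for x
    using assms unfolding normal_density_def by simp
  show "integrable lborel (\<lambda>x. exp (- c * x\<^sup>2))"
    unfolding eq using \<sigma> by (intro integrable_mult_right integrable_normal_density) auto
  show "(LINT x|lborel. exp (- c * x\<^sup>2)) = sqrt (pi / c)"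
    unfolding eq using \<sigma> by simp
qed

text \<open>Half of the quadratic decay absorbs the linear term, by completing the square.\<close>

lemma exp_abs_le_gaussian:
  fixes a x \<kappa> :: real
  assumes "\<kappa> > 0"
  shows "exp (a * \<bar>x\<bar> - \<kappa> / 2 * x\<^sup>2) \<le> exp (a\<^sup>2 / \<kappa>) * exp (- (\<kappa> / 4) * x\<^sup>2)"
proof -
  have "0 \<le> (\<kappa> * \<bar>x\<bar> / 2 - a)\<^sup>2 / \<kappa>" using assms by simp
  also have "\<dots> = \<kappa> / 4 * x\<^sup>2 - a * \<bar>x\<bar> + a\<^sup>2 / \<kappa>"
    using assms by (simp add: power2_eq_square field_simps)
  finally show ?thesis by (simp flip: exp_add)
qed

lemma integrable_exp_abs_gaussian:
  fixes a \<kappa> :: real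
  assumes "\<kappa> > 0"
  shows "integrable lborel (\<lambda>x. exp (a * \<bar>x\<bar> - \<kappa> / 2 * x\<^sup>2))"
  by (rule Bochner_Integration.integrable_bound[of _ "\<lambda>x. exp (a\<^sup>2 / \<kappa>) * exp (- (\<kappa> / 4) * x\<^sup>2)"])
     (use assms exp_abs_le_gaussian[OF assms] gaussian_integral_real[of "\<kappa> / 4"] in
       \<open>auto intro!: integrable_mult_right\<close>)

text \<open>\<open>B\<close> is the Hessian of the exponent \<open>Q\<close>, and
  \<open>\<kappa>\<close> bounds it from below. Symmetry is demanded at all indices, so that
  rewriting with it has no side conditions.\<close>

locale quad_form =
  fixes I :: "'i set" and B :: "'i \<Rightarrow> 'i \<Rightarrow> real" and \<kappa> :: real
  assumes fin: "finite I" and \<kappa>_pos: "\<kappa> > 0"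
    and sym: "\<And>i j. B i j = B j i"
    and coercive: "\<And>t. \<kappa> * (\<Sum>i\<in>I. (t i)\<^sup>2) \<le> (\<Sum>i\<in>I. \<Sum>j\<in>I. B i j * t i * t j)"
begin

abbreviation "Leb \<equiv> PiM I (\<lambda>_. lborel :: real measure)"

abbreviation l1 :: "('i \<Rightarrow> real) \<Rightarrow> real" where "l1 t \<equiv> \<Sum>i\<in>I. \<bar>t i\<bar>"

abbreviation dst :: "('i \<Rightarrow> real) \<Rightarrow> ('i \<Rightarrow> real) \<Rightarrow> real" where
  "dst x y \<equiv> L2_set (\<lambda>i. x i - y i) I"

abbreviation envelope :: "real \<Rightarrow> ('i \<Rightarrow> real) \<Rightarrow> real" where
  "envelope a t \<equiv> \<Prod>i\<in>I. exp (a * \<bar>t i\<bar> - \<kappa> / 2 * (t i)\<^sup>2)"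

definition Q :: "('i \<Rightarrow> real) \<Rightarrow> real" where
  "Q t = 1 / 2 * (\<Sum>i\<in>I. \<Sum>j\<in>I. B i j * t i * t j)"

definition Z :: real where "Z = (LINT t|Leb. exp (- Q t))"

definition M :: "('i \<Rightarrow> real) measure" where
  "M = density Leb (\<lambda>t. ennreal (exp (- Q t) / Z))"

text \<open>The covariance matrix. That it inverts \<open>B\<close> is a case of integration by parts (see \<open>B_S\<close>), so
  no matrix inversion is needed.\<close>

definition S :: "'i \<Rightarrow> 'i \<Rightarrow> real" where
  "S j k = (LINT t|M. t j * t k)"

text \<open>A class of integrands closed under sums and products that contains polynomials and
  exponentials of Lipschitz functions; membership settles every integrability question. The
  \<open>l1\<close> norm is used because its exponential factors over the coordinates.\<close>

definition exp_growth :: "(('i \<Rightarrow> real) \<Rightarrow> 'b::{banach, second_countable_topology}) \<Rightarrow> bool" where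
  "exp_growth g \<longleftrightarrow> g \<in> borel_measurable Leb \<and> (\<exists>C a. \<forall>t. norm (g t) \<le> C * exp (a * l1 t))"

sublocale product_sigma_finite "\<lambda>_ :: 'i. lborel :: real measure" ..

lemma Q_ge: "\<kappa> / 2 * (\<Sum>i\<in>I. (t i)\<^sup>2) \<le> Q t"
  using coercive[of t] by (simp add: Q_def)

lemma component_measurable[measurable]: "i \<in> I \<Longrightarrow> (\<lambda>t. t i) \<in> borel_measurable Leb"
  using measurable_component_singleton[of i I "\<lambda>_. lborel :: real measure"] by simp

lemma Q_measurable[measurable]: "Q \<in> borel_measurable Leb"
  unfolding Q_def by (intro borel_measurable_times borel_measurable_sum) auto

lemma exp_growthI:
  assumes "g \<in> borel_measurable Leb" "\<And>t. norm (g t) \<le> C * exp (a * l1 t)"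
  shows "exp_growth g"
  using assms unfolding exp_growth_def by blast

lemma exp_growth_measurable: "exp_growth g \<Longrightarrow> g \<in> borel_measurable Leb"
  by (simp add: exp_growth_def)

lemma exp_growthE:
  assumes "exp_growth g"
  obtains C a where "C \<ge> 0" "a \<ge> 0" "\<And>t. norm (g t) \<le> C * exp (a * l1 t)"
proof -
  obtain C a where *: "\<And>t. norm (g t) \<le> C * exp (a * l1 t)"
    using assms unfolding exp_growth_def by blast
  have "norm (g t) \<le> \<bar>C\<bar> * exp (\<bar>a\<bar> * l1 t)" for t
  proof -
    have "0 \<le> l1 t" by (simp add: sum_nonneg)
    then have "a * l1 t \<le> \<bar>a\<bar> * l1 t" by (simp add: mult_right_mono)
    then have "C * exp (a * l1 t) \<le> \<bar>C\<bar> * exp (\<bar>a\<bar> * l1 t)"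
      by (intro mult_mono) auto
    with *[of t] show ?thesis by (rule order_trans)
  qed
  then show thesis using that[of "\<bar>C\<bar>" "\<bar>a\<bar>"] by auto
qed

lemma exp_growth_const: "exp_growth (\<lambda>_. c)"
  by (rule exp_growthI[of _ "norm c" 0]) auto

lemma exp_growth_bounded:
  assumes "g \<in> borel_measurable Leb" "\<And>t. norm (g t) \<le> C"
  shows "exp_growth g"
  using assms by (intro exp_growthI[of _ C 0]) auto

lemma exp_growth_component: "i \<in> I \<Longrightarrow> exp_growth (\<lambda>t. t i)"
proof (rule exp_growthI[of _ 1 1])
  fix t :: "'i \<Rightarrow> real" assume "i \<in> I"
  then have "\<bar>t i\<bar> \<le> l1 t" using fin by (intro member_le_sum) auto
  also have "\<dots> \<le> exp (l1 t)"
    using exp_ge_add_one_self[of "\<Sum>i\<in>I. \<bar>t i\<bar>"] by linarith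
  finally show "norm (t i) \<le> 1 * exp (1 * l1 t)" by simp
qed auto

lemma exp_growth_add:
  assumes "exp_growth g" "exp_growth g'"
  shows "exp_growth (\<lambda>t. g t + g' t)"
proof -
  obtain C a where g: "C \<ge> 0" "a \<ge> 0" "\<And>t. norm (g t) \<le> C * exp (a * l1 t)"
    using exp_growthE[OF assms(1)] by metis
  obtain D b where h: "D \<ge> 0" "b \<ge> 0" "\<And>t. norm (g' t) \<le> D * exp (b * l1 t)"
    using exp_growthE[OF assms(2)] by metis
  note [measurable] = exp_growth_measurable[OF assms(1)] exp_growth_measurable[OF assms(2)]
  show ?thesis
  proof (rule exp_growthI)
    fix t :: "'i \<Rightarrow> real"
    let ?s = "\<Sum>i\<in>I. \<bar>t i\<bar>"
    have "0 \<le> ?s" by (simp add: sum_nonneg)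
    then have "C * exp (a * ?s) \<le> C * exp (max a b * ?s)" "D * exp (b * ?s) \<le> D * exp (max a b * ?s)"
      using g(1) h(1) by (auto intro!: mult_left_mono mult_right_mono)
    then show "norm (g t + g' t) \<le> (C + D) * exp (max a b * ?s)"
      using norm_triangle_ineq[of "g t" "g' t"] g(3)[of t] h(3)[of t] by (simp add: distrib_right)
  qed measurable
qed

lemma exp_growth_sum: "(\<And>k. k \<in> K \<Longrightarrow> exp_growth (g k)) \<Longrightarrow> exp_growth (\<lambda>t. \<Sum>k\<in>K. g k t)"
  by (induction K rule: infinite_finite_induct) (auto simp: exp_growth_const intro!: exp_growth_add)

lemma exp_growth_scaleR:
  fixes g' :: "('i \<Rightarrow> real) \<Rightarrow> 'b::{banach, second_countable_topology}"
  assumes "exp_growth g" "exp_growth g'"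
  shows "exp_growth (\<lambda>t. g t *\<^sub>R g' t)"
proof -
  obtain C a where g: "C \<ge> 0" "a \<ge> 0" "\<And>t. norm (g t) \<le> C * exp (a * l1 t)"
    using exp_growthE[OF assms(1)] by metis
  obtain D b where h: "D \<ge> 0" "b \<ge> 0" "\<And>t. norm (g' t) \<le> D * exp (b * l1 t)"
    using exp_growthE[OF assms(2)] by metis
  note [measurable] = exp_growth_measurable[OF assms(1)] exp_growth_measurable[OF assms(2)]
  show ?thesis
  proof (rule exp_growthI)
    fix t :: "'i \<Rightarrow> real"
    let ?s = "\<Sum>i\<in>I. \<bar>t i\<bar>"
    have "norm (g t *\<^sub>R g' t) \<le> (C * exp (a * ?s)) * (D * exp (b * ?s))"
      unfolding norm_scaleR using g(1,3) h(3)[of t]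
      by (intro mult_mono) (auto simp: real_norm_def[symmetric] simp del: real_norm_def)
    then show "norm (g t *\<^sub>R g' t) \<le> (C * D) * exp ((a + b) * ?s)"
      by (simp add: algebra_simps exp_add)
  qed measurable
qed

lemma exp_growth_mult: "exp_growth g \<Longrightarrow> exp_growth g' \<Longrightarrow> exp_growth (\<lambda>t. g t * g' t :: real)"
  using exp_growth_scaleR[of g g'] by simp

lemma exp_growth_power: "exp_growth g \<Longrightarrow> exp_growth (\<lambda>t. g t ^ m :: real)"
  by (induction m) (auto simp: exp_growth_const intro!: exp_growth_mult)

lemma exp_growth_cmult: "exp_growth g \<Longrightarrow> exp_growth (\<lambda>t. c * g t :: real)"
  by (intro exp_growth_mult exp_growth_const)

lemma exp_growth_diff: "exp_growth g \<Longrightarrow> exp_growth g' \<Longrightarrow> exp_growth (\<lambda>t. g t - g' t :: real)"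
  using exp_growth_add[of g "\<lambda>t. (- 1) * g' t"] exp_growth_cmult[of g' "-1"] by simp

lemma exp_growth_mono:
  assumes "exp_growth g" "g' \<in> borel_measurable Leb" "\<And>t. norm (g' t) \<le> norm (g t)"
  shows "exp_growth g'"
proof -
  obtain C a where "\<And>t. norm (g t) \<le> C * exp (a * l1 t)"
    using exp_growthE[OF assms(1)] by metis
  then show ?thesis
    by (intro exp_growthI[of _ C a] assms(2) order_trans[OF assms(3)])
qed

lemmas exp_growth_intros = exp_growth_const exp_growth_component exp_growth_add exp_growth_sum
  exp_growth_scaleR exp_growth_mult exp_growth_power exp_growth_diff

lemma exp_growth_of_real: "exp_growth g \<Longrightarrow> exp_growth (\<lambda>t. complex_of_real (g t))"
  using exp_growth_scaleR[OF _ exp_growth_const[of "1 :: complex"], of g]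
  by (simp add: scaleR_conv_of_real)

lemma exp_growth_abs: "exp_growth g \<Longrightarrow> exp_growth (\<lambda>t. \<bar>g t\<bar> :: real)"
  by (rule exp_growth_mono[of g]) (auto dest: exp_growth_measurable)

text \<open>The bound is a product over coordinates. It is thus integrable by Fubini, and with all
  coordinates but one fixed it still dominates along that line.\<close>

lemma exp_growth_weighted_bound:
  assumes "exp_growth g"
  obtains C a where "C \<ge> 0" "a \<ge> 0"
    "\<And>t. norm (exp (- Q t) *\<^sub>R g t) \<le> C * envelope a t"
proof -
  obtain C a where g: "C \<ge> 0" "a \<ge> 0" "\<And>t. norm (g t) \<le> C * exp (a * l1 t)"
    using exp_growthE[OF assms(1)] by metis
  have "norm (exp (- Q t) *\<^sub>R g t) \<le> C * envelope a t" for t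
  proof -
    have "norm (exp (- Q t) *\<^sub>R g t) \<le> exp (- (\<kappa> / 2 * (\<Sum>i\<in>I. (t i)\<^sup>2))) * (C * exp (a * l1 t))"
      unfolding norm_scaleR using g(3)[of t] Q_ge[of t] by (intro mult_mono) auto
    also have "\<dots> = C * envelope a t"
      unfolding exp_sum[OF fin, symmetric] sum_subtractf sum_distrib_left[symmetric]
      by (simp add: mult.left_commute flip: exp_add)
    finally show ?thesis .
  qed
  with g show thesis using that by blast
qed

lemma integrable_Leb:
  assumes "exp_growth g"
  shows "integrable Leb (\<lambda>t. exp (- Q t) *\<^sub>R g t)"
proof -
  obtain C a where *: "\<And>t. norm (exp (- Q t) *\<^sub>R g t) \<le> C * envelope a t"
    by (rule exp_growth_weighted_bound[OF assms]) (rule that)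
  note [measurable] = exp_growth_measurable[OF assms]
  have "integrable Leb (\<lambda>t. C * envelope a t)"
  proof (rule integrable_mult_right)
    show "integrable Leb (\<lambda>t. \<Prod>i\<in>I. exp (a * \<bar>t i\<bar> - \<kappa> / 2 * (t i)\<^sup>2))"
      using integrable_exp_abs_gaussian[OF \<kappa>_pos]
      by (rule product_integrable_prod[OF fin, where f="\<lambda>_ x. exp (a * \<bar>x\<bar> - \<kappa> / 2 * x\<^sup>2)"])
  qed
  then show ?thesis
  proof (rule Bochner_Integration.integrable_bound)
    show "AE t in Leb. norm (exp (- Q t) *\<^sub>R g t)
        \<le> norm (C * envelope a t)"
    proof (rule AE_I2)
      fix t :: "'i \<Rightarrow> real"
      show "norm (exp (- Q t) *\<^sub>R g t) \<le> norm (C * envelope a t)"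
        unfolding real_norm_def[of "C * _"] by (rule order_trans[OF * abs_ge_self])
    qed
  qed measurable
qed

text \<open>Comparison with a product of one-dimensional Gaussian integrals. It yields both the
  positivity of \<open>Z\<close> and the lower bound on \<open>Xi\<close>.\<close>

lemma Z_ge:
  assumes "c > 0" and le: "\<And>t. Q t \<le> c * (\<Sum>i\<in>I. (t i)\<^sup>2)"
  shows "sqrt (pi / c) ^ card I \<le> Z"
proof -
  have eq: "exp (- (c * (\<Sum>i\<in>I. (t i)\<^sup>2))) = (\<Prod>i\<in>I. exp (- c * (t i)\<^sup>2))" for t :: "'i \<Rightarrow> real"
    unfolding exp_sum[OF fin, symmetric] by (simp add: sum_distrib_left sum_negf)
  have "sqrt (pi / c) ^ card I = (LINT t|Leb. (\<Prod>i\<in>I. exp (- c * (t i)\<^sup>2)))"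
    by (subst product_integral_prod[OF fin]) (use gaussian_integral_real[OF assms(1)] in auto)
  also have "\<dots> \<le> Z"
    unfolding Z_def eq[symmetric]
  proof (rule integral_mono)
    show "integrable Leb (\<lambda>t. exp (- (c * (\<Sum>i\<in>I. (t i)\<^sup>2))))"
      unfolding eq by (rule product_integrable_prod[OF fin]) (use gaussian_integral_real[OF assms(1)] in auto)
    show "integrable Leb (\<lambda>t. exp (- Q t))"
      using integrable_Leb[OF exp_growth_const[of "1::real"]] by simp
  qed (use le in auto)
  finally show ?thesis .
qed

lemma Z_pos: "Z > 0"
proof -
  \<comment> \<open>A crude constant: only positivity of the resulting bound matters.\<close>
  define c where "c = (\<Sum>i\<in>I. \<Sum>j\<in>I. \<bar>B i j\<bar>) + 1"
  have c: "c > 0" unfolding c_def by (intro add_nonneg_pos sum_nonneg) auto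
  have "Q t \<le> c * (\<Sum>i\<in>I. (t i)\<^sup>2)" for t
  proof -
    let ?s = "\<Sum>i\<in>I. (t i)\<^sup>2"
    have s: "0 \<le> ?s" by (simp add: sum_nonneg)
    have le: "(t i)\<^sup>2 \<le> ?s" if "i \<in> I" for i using that fin by (intro member_le_sum) auto
    have "B i j * t i * t j \<le> \<bar>B i j\<bar> * ?s" if "i \<in> I" "j \<in> I" for i j
    proof -
      have "2 * \<bar>t i * t j\<bar> \<le> (t i)\<^sup>2 + (t j)\<^sup>2"
        using sum_squares_bound[of "\<bar>t i\<bar>" "\<bar>t j\<bar>"] by (simp add: abs_mult)
      then have "\<bar>t i * t j\<bar> \<le> ?s" using le[OF that(1)] le[OF that(2)] by linarith
      then have "\<bar>B i j\<bar> * \<bar>t i * t j\<bar> \<le> \<bar>B i j\<bar> * ?s" by (intro mult_left_mono) auto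
      moreover have "B i j * t i * t j \<le> \<bar>B i j\<bar> * \<bar>t i * t j\<bar>"
        by (metis abs_ge_self abs_mult mult.assoc)
      ultimately show ?thesis by linarith
    qed
    then have "(\<Sum>i\<in>I. \<Sum>j\<in>I. B i j * t i * t j) \<le> (\<Sum>i\<in>I. \<Sum>j\<in>I. \<bar>B i j\<bar>) * ?s"
      unfolding sum_distrib_right by (intro sum_mono) (metis sum_distrib_right)
    moreover have "0 \<le> (\<Sum>i\<in>I. \<Sum>j\<in>I. \<bar>B i j\<bar>) * ?s" using s by (intro mult_nonneg_nonneg sum_nonneg) auto
    ultimately show ?thesis using s unfolding Q_def c_def by (simp add: distrib_right)
  qed
  note Z_ge[OF c this]
  moreover have "0 < sqrt (pi / c) ^ card I" using c by simp
  ultimately show ?thesis by linarith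
qed

lemma sets_M[measurable_cong]: "sets M = sets Leb" by (simp add: M_def)

lemma space_M: "space M = space Leb" by (simp add: M_def)

lemma integrable_M:
  assumes "exp_growth g"
  shows "integrable M g"
proof -
  have "integrable Leb (\<lambda>t. (exp (- Q t) / Z) *\<^sub>R g t)"
    using integrable_scaleR_right[OF integrable_Leb[OF assms], of "1 / Z"] by simp
  then show ?thesis
    unfolding M_def using exp_growth_measurable[OF assms] Z_pos
    by (subst integrable_density[of g Leb "\<lambda>t. exp (- Q t) / Z"]) auto
qed

lemma integral_M:
  fixes g :: "('i \<Rightarrow> real) \<Rightarrow> 'b::{banach, second_countable_topology}"
  assumes "g \<in> borel_measurable Leb"
  shows "(LINT t|M. g t) = (1 / Z) *\<^sub>R (LINT t|Leb. exp (- Q t) *\<^sub>R g t)"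
proof -
  have "(LINT t|M. g t) = (LINT t|Leb. (exp (- Q t) / Z) *\<^sub>R g t)"
    unfolding M_def using assms Z_pos by (subst integral_density[of g Leb "\<lambda>t. exp (- Q t) / Z"]) auto
  also have "\<dots> = (LINT t|Leb. (1 / Z) *\<^sub>R (exp (- Q t) *\<^sub>R g t))" by simp
  finally show ?thesis by (simp only: integral_scaleR_right)
qed

sublocale prob_space M
proof
  have "emeasure M (space M) = (\<integral>\<^sup>+t. ennreal (exp (- Q t) / Z) \<partial>Leb)"
    unfolding M_def by (subst emeasure_density) (auto intro!: nn_integral_cong simp: indicator_def)
  also have "\<dots> = ennreal (LINT t|Leb. exp (- Q t) / Z)"
    using integrable_Leb[OF exp_growth_const[of "1::real"]] Z_pos
    by (intro nn_integral_eq_integral) (auto intro!: AE_I2)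
  also have "\<dots> = 1" using Z_pos by (simp add: Z_def)
  finally show "emeasure M (space M) = 1" .
qed

abbreviation E :: "(('i \<Rightarrow> real) \<Rightarrow> 'b::{banach, second_countable_topology}) \<Rightarrow> 'b" where
  "E \<equiv> expectation"

end

section \<open>Gaussian integration by parts\<close>

context quad_form begin

lemma Q_deriv:
  assumes "i \<in> I"
  shows "((\<lambda>y. Q (t(i := y))) has_real_derivative (\<Sum>j\<in>I. B i j * (t(i := y)) j)) (at y)"
proof -
  define d where "d k = (if k = i then 1 else 0 :: real)" for k
  define s where "s = t(i := y)"
  have comp: "((\<lambda>y. (t(i := y)) k) has_real_derivative d k) (at y)" for k
    by (cases "k = i") (auto simp: d_def)
  have "((\<lambda>y. Q (t(i := y))) has_real_derivative
      1 / 2 * (\<Sum>k\<in>I. \<Sum>j\<in>I. (B k j * s k) * d j + (B k j * d k) * s j)) (at y)"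
    unfolding Q_def s_def
    by (intro DERIV_cmult DERIV_sum, rule DERIV_cong[OF DERIV_mult[OF DERIV_cmult[OF comp] comp]])
       (simp add: algebra_simps)
  also have "1 / 2 * (\<Sum>k\<in>I. \<Sum>j\<in>I. (B k j * s k) * d j + (B k j * d k) * s j)
      = (\<Sum>j\<in>I. B i j * s j)"
  proof -
    have "(\<Sum>k\<in>I. \<Sum>j\<in>I. (B k j * s k) * d j) = (\<Sum>k\<in>I. B k i * s k)"
      using assms fin by (intro sum.cong refl) (simp add: d_def if_distrib cong: if_cong)
    moreover have "(\<Sum>k\<in>I. \<Sum>j\<in>I. (B k j * d k) * s j) = (\<Sum>j\<in>I. B i j * s j)"
      using assms fin by (subst sum.swap, intro sum.cong refl)
        (simp add: d_def if_distrib if_distribR cong: if_cong)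
    ultimately show ?thesis by (simp add: sum.distrib sym[of _ i])
  qed
  finally show ?thesis unfolding s_def .
qed

text \<open>Along coordinate \<open>i\<close>, the function \<open>exp (- Q) (G' - b G)\<close>,
  with \<open>b\<close> the partial derivative of \<open>Q\<close>, is the derivative of
  \<open>exp (- Q) G\<close>, which vanishes at both ends. Hence its integral over every line is 0,
  and Fubini gives the claim. Continuity of \<open>G'\<close> serves the fundamental theorem of
  calculus.\<close>

theorem integration_by_parts:
  fixes G G' :: "('i \<Rightarrow> real) \<Rightarrow> 'b::euclidean_space"
  assumes i: "i \<in> I" and G: "exp_growth G" and G': "exp_growth G'"
    and deriv: "\<And>t. ((\<lambda>x. G (t(i := x))) has_vector_derivative G' t) (at (t i))"
    and cont: "\<And>t. isCont (\<lambda>x. G' (t(i := x))) (t i)"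
  shows "E G' = E (\<lambda>t. (\<Sum>j\<in>I. B i j * t j) *\<^sub>R G t)"
proof -
  define b where "b t = (\<Sum>j\<in>I. B i j * t j)" for t :: "'i \<Rightarrow> real"
  define \<psi> where "\<psi> t = G' t + (- b t) *\<^sub>R G t" for t
  define \<phi> where "\<phi> t = exp (- Q t) *\<^sub>R \<psi> t" for t
  have b: "exp_growth b" unfolding b_def by (intro exp_growth_intros)
  have bG: "exp_growth (\<lambda>t. b t *\<^sub>R G t)" by (intro exp_growth_intros b G)
  have \<psi>: "exp_growth \<psi>"
    unfolding \<psi>_def using exp_growth_scaleR[OF exp_growth_cmult[OF b, of "-1"] G]
    by (intro exp_growth_add G') simp
  have line: "(LINT y|lborel. \<phi> (x(i := y))) = 0" for x
  proof -
    define F where "F y = exp (- Q (x(i := y))) *\<^sub>R G (x(i := y))" for y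
    have dG: "((\<lambda>y. G (x(i := y))) has_vector_derivative G' (x(i := y))) (at y)" for y
      using deriv[of "x(i := y)"] by simp
    have cG': "isCont (\<lambda>y. G' (x(i := y))) y" for y
      using cont[of "x(i := y)"] by simp
    have dQ: "((\<lambda>y. Q (x(i := y))) has_real_derivative b (x(i := y))) (at y)" for y
      unfolding b_def by (rule Q_deriv[OF i])
    have dF: "(F has_vector_derivative \<phi> (x(i := y))) (at y)" for y
      unfolding F_def \<phi>_def \<psi>_def
      by (rule has_vector_derivative_eq_rhs, rule has_vector_derivative_scaleR[OF _ dG])
         (auto intro!: derivative_eq_intros dQ simp: scaleR_diff_right)
    have cb: "isCont (\<lambda>y. b (x(i := y))) y" for y
    proof -
      have "isCont (\<lambda>y. (x(i := y)) k) y" for k by (cases "k = i") auto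
      then show ?thesis unfolding b_def by (intro continuous_intros) auto
    qed
    have c\<phi>: "isCont (\<lambda>y. \<phi> (x(i := y))) y" for y
      unfolding \<phi>_def \<psi>_def
      using DERIV_isCont[OF dQ] has_vector_derivative_continuous[OF dG] cG' cb
      by (intro continuous_intros) auto
    \<comment> \<open>The product envelope restricted to a line, its other factors gathered into the
      constant. It is needed both for \<open>\<phi>\<close> (integrability) and for \<open>F\<close>
      (boundary values).\<close>
    have bound: "\<exists>D a. \<forall>y. norm (exp (- Q (x(i := y))) *\<^sub>R g (x(i := y))) \<le> D * exp (a * \<bar>y\<bar> - \<kappa> / 2 * y\<^sup>2)"
      if g: "exp_growth g" for g :: "('i \<Rightarrow> real) \<Rightarrow> 'b"
    proof -
      obtain C a where *: "\<And>t. norm (exp (- Q t) *\<^sub>R g t) \<le> C * envelope a t"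
        by (rule exp_growth_weighted_bound[OF g]) (rule that)
      define D where "D = C * (\<Prod>k\<in>I - {i}. exp (a * \<bar>x k\<bar> - \<kappa> / 2 * (x k)\<^sup>2))"
      have "(\<Prod>k\<in>I. exp (a * \<bar>(x(i := y)) k\<bar> - \<kappa> / 2 * ((x(i := y)) k)\<^sup>2))
        = exp (a * \<bar>y\<bar> - \<kappa> / 2 * y\<^sup>2) * (\<Prod>k\<in>I - {i}. exp (a * \<bar>x k\<bar> - \<kappa> / 2 * (x k)\<^sup>2))" for y
        unfolding prod.remove[OF fin i] by simp
      then have "norm (exp (- Q (x(i := y))) *\<^sub>R g (x(i := y))) \<le> D * exp (a * \<bar>y\<bar> - \<kappa> / 2 * y\<^sup>2)" for y
        using *[of "x(i := y)"] by (simp add: D_def ac_simps)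
      then show ?thesis by blast
    qed
    obtain D a where \<phi>_bd: "\<And>y. norm (\<phi> (x(i := y))) \<le> D * exp (a * \<bar>y\<bar> - \<kappa> / 2 * y\<^sup>2)"
      using bound[OF \<psi>] unfolding \<phi>_def by blast
    obtain D' a' where F_bd: "\<And>y. norm (F y) \<le> D' * exp (a' * \<bar>y\<bar> - \<kappa> / 2 * y\<^sup>2)"
      using bound[OF G] unfolding F_def by blast
    have int: "integrable lborel (\<lambda>y. \<phi> (x(i := y)))"
    proof (rule Bochner_Integration.integrable_bound)
      show "integrable lborel (\<lambda>y. D * exp (a * \<bar>y\<bar> - \<kappa> / 2 * y\<^sup>2))"
        by (intro integrable_mult_right integrable_exp_abs_gaussian \<kappa>_pos)
      show "(\<lambda>y. \<phi> (x(i := y))) \<in> borel_measurable lborel"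
        unfolding measurable_lborel2 using c\<phi>
        by (intro borel_measurable_continuous_onI continuous_at_imp_continuous_on) auto
      show "AE y in lborel. norm (\<phi> (x(i := y))) \<le> norm (D * exp (a * \<bar>y\<bar> - \<kappa> / 2 * y\<^sup>2))"
        unfolding real_norm_def[of "D * _"] by (rule AE_I2, rule order_trans[OF \<phi>_bd abs_ge_self])
    qed
    have lim: "((\<lambda>y. D' * exp (a' * \<bar>y\<bar> - \<kappa> / 2 * y\<^sup>2)) \<longlongrightarrow> 0) at_top"
        "((\<lambda>y. D' * exp (a' * \<bar>y\<bar> - \<kappa> / 2 * y\<^sup>2)) \<longlongrightarrow> 0) at_bot"
      using \<kappa>_pos by real_asymp+
    have "(F \<longlongrightarrow> 0) at_top" "(F \<longlongrightarrow> 0) at_bot"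
      by (rule Lim_null_comparison[OF always_eventually lim(1)] Lim_null_comparison[OF always_eventually lim(2)];
          use F_bd in blast)+
    then have "(LBINT y=-\<infinity>..\<infinity>. \<phi> (x(i := y))) = 0 - 0"
      using int c\<phi> dF
      by (intro interval_integral_FTC_integrable[where F=F])
         (auto simp: ereal_tendsto_simps set_integrable_def)
    then show ?thesis
      by (simp add: interval_lebesgue_integral_def set_lebesgue_integral_def)
  qed
  have ins: "insert i (I - {i}) = I" using i by blast
  have "(LINT t|Leb. \<phi> t) = (LINT x|PiM (I - {i}) (\<lambda>_. lborel). (LINT y|lborel. \<phi> (x(i := y))))"
    using product_integral_insert[of "I - {i}" i \<phi>] fin integrable_Leb[OF \<psi>]
    unfolding ins \<phi>_def[symmetric] by simp
  then have "(LINT t|Leb. \<phi> t) = 0" by (simp add: line)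
  then have "E \<psi> = 0"
    using integral_M[OF exp_growth_measurable[OF \<psi>]] by (simp add: \<phi>_def)
  moreover have "\<psi> = (\<lambda>t. G' t - b t *\<^sub>R G t)" by (simp add: \<psi>_def fun_eq_iff)
  ultimately have "E G' - E (\<lambda>t. b t *\<^sub>R G t) = 0"
    using integrable_M[OF G'] integrable_M[OF bG] by simp
  then show ?thesis by (simp add: b_def)
qed

lemma S_sym: "S j k = S k j"
  by (simp add: S_def mult.commute)

lemma integrable_component_mult: "i \<in> I \<Longrightarrow> exp_growth g \<Longrightarrow> integrable M (\<lambda>t. t i *\<^sub>R g t)"
  by (intro integrable_M exp_growth_intros)

lemma B_S:
  assumes "i \<in> I" "k \<in> I"
  shows "(\<Sum>j\<in>I. B i j * S j k) = (if i = k then 1 else 0)"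
proof -
  have "E (\<lambda>t. if i = k then 1 else 0) = E (\<lambda>t. (\<Sum>j\<in>I. B i j * t j) *\<^sub>R t k)"
    by (rule integration_by_parts) (use assms in \<open>auto intro!: exp_growth_intros\<close>)
  also have "\<dots> = E (\<lambda>t. \<Sum>j\<in>I. B i j * (t j * t k))"
    by (simp add: sum_distrib_right mult.assoc)
  also have "\<dots> = (\<Sum>j\<in>I. B i j * S j k)"
    unfolding S_def using assms
    by (subst Bochner_Integration.integral_sum) (auto intro!: integrable_M exp_growth_intros)
  finally show ?thesis by (simp add: prob_space)
qed

text \<open>\<open>integration_by_parts\<close> for all \<open>i\<close> is a linear system with
  matrix \<open>B\<close> for the unknowns \<open>E (t j G)\<close>. Multiplying by
  \<open>S\<close>, which inverts \<open>B\<close> by \<open>B_S\<close>, solves it.\<close>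

theorem gaussian_ibp:
  fixes G :: "('i \<Rightarrow> real) \<Rightarrow> 'b::euclidean_space" and G' :: "'i \<Rightarrow> ('i \<Rightarrow> real) \<Rightarrow> 'b"
  assumes k: "k \<in> I" and G: "exp_growth G" and G': "\<And>i. i \<in> I \<Longrightarrow> exp_growth (G' i)"
    and deriv: "\<And>i t. i \<in> I \<Longrightarrow> ((\<lambda>x. G (t(i := x))) has_vector_derivative G' i t) (at (t i))"
    and cont: "\<And>i t. i \<in> I \<Longrightarrow> isCont (\<lambda>x. G' i (t(i := x))) (t i)"
  shows "E (\<lambda>t. t k *\<^sub>R G t) = (\<Sum>i\<in>I. S k i *\<^sub>R E (G' i))"
proof -
  have int: "integrable M (\<lambda>t. t j *\<^sub>R G t)" if "j \<in> I" for j
    using that G by (rule integrable_component_mult)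
  have "E (G' i) = (\<Sum>j\<in>I. B i j *\<^sub>R E (\<lambda>t. t j *\<^sub>R G t))" if "i \<in> I" for i
  proof -
    have "E (G' i) = E (\<lambda>t. (\<Sum>j\<in>I. B i j * t j) *\<^sub>R G t)"
      using that G G' deriv cont by (intro integration_by_parts)
    also have "\<dots> = E (\<lambda>t. \<Sum>j\<in>I. B i j *\<^sub>R (t j *\<^sub>R G t))"
      by (simp add: scaleR_sum_left)
    also have "\<dots> = (\<Sum>j\<in>I. B i j *\<^sub>R E (\<lambda>t. t j *\<^sub>R G t))"
      using int by (subst Bochner_Integration.integral_sum) (auto simp del: scaleR_scaleR)
    finally show ?thesis .
  qed
  then have "(\<Sum>i\<in>I. S k i *\<^sub>R E (G' i))
    = (\<Sum>i\<in>I. \<Sum>j\<in>I. (B j i * S i k) *\<^sub>R E (\<lambda>t. t j *\<^sub>R G t))"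
    by (simp add: scaleR_sum_right sym[of _ "_ :: 'i"] S_sym[of k] mult.commute cong: sum.cong)
  also have "\<dots> = (\<Sum>j\<in>I. (\<Sum>i\<in>I. B j i * S i k) *\<^sub>R E (\<lambda>t. t j *\<^sub>R G t))"
    unfolding scaleR_sum_left by (rule sum.swap)
  also have "\<dots> = (\<Sum>j\<in>I. if j = k then E (\<lambda>t. t j *\<^sub>R G t) else 0)"
    using k by (intro sum.cong refl) (simp add: B_S)
  also have "\<dots> = E (\<lambda>t. t k *\<^sub>R G t)" using k fin by simp
  finally show ?thesis ..
qed

lemma expectation_component: "k \<in> I \<Longrightarrow> E (\<lambda>t. t k) = 0"
  using gaussian_ibp[of k "\<lambda>_. 1 :: real" "\<lambda>_ _. 0"] by (simp add: exp_growth_const)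

text \<open>The operator norm of the inverse of \<open>B\<close> is at most
  \<open>1 / \<kappa>\<close>: if \<open>y = S w\<close> then \<open>B y = w\<close>, and coercivity
  gives \<open>\<kappa> |y|^2 <= <y, w> <= |y| |w|\<close>.\<close>

lemma S_bilinear_bound:
  "\<bar>\<Sum>i\<in>I. \<Sum>j\<in>I. v i * S i j * w j\<bar> \<le> L2_set v I * L2_set w I / \<kappa>"
proof -
  define y where "y i = (\<Sum>j\<in>I. S i j * w j)" for i
  have By: "(\<Sum>j\<in>I. B i j * y j) = w i" if "i \<in> I" for i
  proof -
    have "(\<Sum>j\<in>I. B i j * y j) = (\<Sum>j\<in>I. \<Sum>k\<in>I. B i j * S j k * w k)"
      by (simp add: y_def sum_distrib_left mult.assoc)
    also have "\<dots> = (\<Sum>k\<in>I. (\<Sum>j\<in>I. B i j * S j k) * w k)"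
      unfolding sum_distrib_right by (rule sum.swap)
    also have "\<dots> = (\<Sum>k\<in>I. if i = k then w k else 0)"
      using that by (intro sum.cong refl) (simp add: B_S)
    finally show ?thesis using that fin by simp
  qed
  have CS: "\<bar>\<Sum>i\<in>I. a i * b i\<bar> \<le> L2_set a I * L2_set b I" for a b :: "'i \<Rightarrow> real"
    using L2_set_mult_ineq[of a b I] sum_abs[of "\<lambda>i. a i * b i" I] by (simp add: abs_mult)
  have "\<kappa> * (L2_set y I)\<^sup>2 \<le> (\<Sum>i\<in>I. \<Sum>j\<in>I. B i j * y i * y j)"
    using coercive[of y] by (simp add: L2_set_def sum_nonneg)
  also have "\<dots> = (\<Sum>i\<in>I. y i * (\<Sum>j\<in>I. B i j * y j))"
    by (simp add: sum_distrib_left ac_simps)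
  also have "\<dots> = (\<Sum>i\<in>I. y i * w i)" by (simp add: By cong: sum.cong)
  also have "\<dots> \<le> L2_set y I * L2_set w I" using CS[of y w] by linarith
  finally have "\<kappa> * L2_set y I * L2_set y I \<le> L2_set w I * L2_set y I"
    by (simp add: power2_eq_square ac_simps)
  then have "\<kappa> * L2_set y I \<le> L2_set w I"
    using mult_right_le_imp_le[of "\<kappa> * L2_set y I" "L2_set y I" "L2_set w I"]
    by (cases "L2_set y I = 0") (auto simp: less_le)
  then have y: "L2_set y I \<le> L2_set w I / \<kappa>" using \<kappa>_pos by (simp add: field_simps)
  have "(\<Sum>i\<in>I. \<Sum>j\<in>I. v i * S i j * w j) = (\<Sum>i\<in>I. v i * y i)"
    by (simp add: y_def sum_distrib_left mult.assoc)
  also have "\<bar>\<dots>\<bar> \<le> L2_set v I * (L2_set w I / \<kappa>)"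
    by (rule order_trans[OF CS mult_left_mono[OF y]]) simp
  finally show ?thesis by simp
qed

end

section \<open>Concentration of Lipschitz functions\<close>

text \<open>Converts exponential moments into a variance. The subtracted 2 makes the bound vanish
  when the exponential moments tend to 1.\<close>

lemma square_le_exp_add_exp: "(x::real)\<^sup>2 \<le> 2 * (exp x + exp (- x) - 2)"
proof -
  have "x\<^sup>2 / 2 \<le> (exp \<bar>x\<bar> - 1 - \<bar>x\<bar>)"
    using exp_lower_Taylor_quadratic[of "\<bar>x\<bar>"] by simp
  moreover have "0 \<le> exp (- \<bar>x\<bar>) - 1 + \<bar>x\<bar>"
    using exp_ge_add_one_self[of "- \<bar>x\<bar>"] by linarith
  ultimately show ?thesis by (cases "x \<ge> 0") auto
qed

lemma even_power_le_exp: "(x::real) ^ (2 * m) \<le> fact (2 * m) * (exp x + exp (- x))"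
proof -
  have "\<bar>x\<bar> ^ (2 * m) /\<^sub>R fact (2 * m) \<le> exp \<bar>x\<bar>"
    unfolding exp_def by (rule order_trans[OF _ sum_le_suminf[where I="{2 * m}"]])
      (use summable_exp[of "\<bar>x\<bar>"] in auto)
  then have "\<bar>x\<bar> ^ (2 * m) \<le> fact (2 * m) * exp \<bar>x\<bar>"
    by (simp add: field_simps)
  also have "\<dots> \<le> fact (2 * m) * (exp x + exp (- x))"
    by (intro mult_left_mono) (auto simp: abs_if)
  finally show ?thesis by (simp add: power_even_abs)
qed

context quad_form begin

definition Lip :: "real \<Rightarrow> (('i \<Rightarrow> real) \<Rightarrow> real) \<Rightarrow> bool" where
  "Lip L g \<longleftrightarrow> g \<in> borel_measurable Leb \<and> (\<forall>x y. \<bar>g x - g y\<bar> \<le> L * dst x y)"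

text \<open>The last term is the gain from uniform convexity that pays for a Lipschitz perturbation.
  The midpoint is restricted to \<open>I\<close> to match
  \<open>prekopa_leindler_PiM\<close>.\<close>

lemma Q_parallelogram:
  "Q x + Q y = 2 * Q (\<lambda>i\<in>I. (x i + y i) / 2) + 1 / 2 * Q (\<lambda>i. x i - y i)"
  unfolding Q_def distrib_left[symmetric] sum_distrib_left sum.distrib[symmetric]
  by (intro sum.cong refl) (simp add: field_simps)

lemma Lip_measurable: "Lip L g \<Longrightarrow> g \<in> borel_measurable Leb"
  by (simp add: Lip_def)

lemma LipD: "Lip L g \<Longrightarrow> \<bar>g x - g y\<bar> \<le> L * dst x y"
  by (simp add: Lip_def)

lemma Lip_cmult: "Lip L g \<Longrightarrow> Lip (\<bar>c\<bar> * L) (\<lambda>t. c * g t)"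
  unfolding Lip_def by (auto simp: abs_mult mult.assoc right_diff_distrib[symmetric] intro!: mult_left_mono)

lemma Lip_add_const: "Lip L g \<Longrightarrow> Lip L (\<lambda>t. g t - c)"
  unfolding Lip_def by auto

lemma Lip_growth:
  assumes "Lip L g"
  shows "\<bar>g t\<bar> \<le> \<bar>g (\<lambda>_. 0)\<bar> + \<bar>L\<bar> * l1 t"
proof -
  have "\<bar>g t - g (\<lambda>_. 0)\<bar> \<le> L * L2_set t I"
    using LipD[OF assms, of t "\<lambda>_. 0"] by simp
  also have "\<dots> \<le> \<bar>L\<bar> * l1 t"
    by (intro mult_mono L2_set_le_sum_abs) auto
  finally show ?thesis by linarith
qed

lemma exp_growth_exp_Lip:
  assumes "Lip L g"
  shows "exp_growth (\<lambda>t. exp (g t))"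
proof (rule exp_growthI)
  note [measurable] = Lip_measurable[OF assms]
  show "(\<lambda>t. exp (g t)) \<in> borel_measurable Leb" by measurable
  show "norm (exp (g t)) \<le> exp \<bar>g (\<lambda>_. 0)\<bar> * exp (\<bar>L\<bar> * l1 t)" for t
    using Lip_growth[OF assms, of t] by (simp flip: exp_add)
qed

lemma exp_growth_Lip:
  assumes "Lip L g"
  shows "exp_growth g"
proof (rule exp_growth_mono)
  show "exp_growth (\<lambda>t. exp (g t) + exp (- 1 * g t))"
    by (intro exp_growth_add exp_growth_exp_Lip[OF assms] exp_growth_exp_Lip[OF Lip_cmult[OF assms]])
  fix t
  show "norm (g t) \<le> norm (exp (g t) + exp (- 1 * g t))"
    using exp_ge_add_one_self[of "g t"] exp_ge_add_one_self[of "- 1 * g t"]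
      exp_gt_zero[of "g t"] exp_gt_zero[of "- 1 * g t"] unfolding real_norm_def by linarith
qed (rule Lip_measurable[OF assms])

text \<open>Prekopa-Leindler for \<open>exp (- Q + g)\<close>, \<open>exp (- Q - g)\<close> and
  \<open>exp (- Q + e)\<close>. At points at distance \<open>r\<close> the gain
  \<open>g x - g y <= L r\<close> competes with the convexity term
  \<open>\<kappa> r^2 / 4\<close>.\<close>

theorem exp_Lip_product:
  assumes g: "Lip L g"
  shows "E (\<lambda>t. exp (g t)) * E (\<lambda>t. exp (- g t)) \<le> exp (L\<^sup>2 / \<kappa>)"
proof -
  note [measurable] = Lip_measurable[OF g]
  have E: "(\<integral>\<^sup>+t. ennreal (exp (- Q t + k t)) \<partial>Leb) = ennreal (Z * E (\<lambda>t. exp (k t)))"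
    if k: "Lip l k" for l k
  proof -
    note kg = exp_growth_exp_Lip[OF k]
    have "(\<integral>\<^sup>+t. ennreal (exp (- Q t + k t)) \<partial>Leb) = (\<integral>\<^sup>+t. ennreal (exp (- Q t) *\<^sub>R exp (k t)) \<partial>Leb)"
      by (intro nn_integral_cong) (simp flip: exp_add)
    also have "\<dots> = ennreal (LINT t|Leb. exp (- Q t) *\<^sub>R exp (k t))"
      by (intro nn_integral_eq_integral integrable_Leb kg) auto
    also have "(LINT t|Leb. exp (- Q t) *\<^sub>R exp (k t)) = Z * E (\<lambda>t. exp (k t))"
      using integral_M[OF exp_growth_measurable[OF kg]] Z_pos by simp
    finally show ?thesis .
  qed
  have zero: "Lip 0 (\<lambda>_. c)" for c by (simp add: Lip_def)
  have mg: "Lip L (\<lambda>t. - g t)" using Lip_cmult[OF g, of "-1"] by simp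
  \<comment> \<open>Half of \<open>L\<^sup>2 / \<kappa>\<close>, the maximum of
    \<open>L r - \<kappa> r^2 / 4\<close> over \<open>r\<close>, because the third function enters
    squared.\<close>
  define e where "e = L\<^sup>2 / (2 * \<kappa>)"
  have "(\<integral>\<^sup>+t. ennreal (exp (- Q t + g t)) \<partial>Leb) * (\<integral>\<^sup>+t. ennreal (exp (- Q t + - g t)) \<partial>Leb)
     \<le> (\<integral>\<^sup>+t. ennreal (exp (- Q t + e)) \<partial>Leb)\<^sup>2"
  proof (rule prekopa_leindler_PiM[OF fin])
    fix x y :: "'i \<Rightarrow> real"
    define m where "m = (\<lambda>i\<in>I. (x i + y i) / 2)"
    define r where "r = dst x y"
    have "g x - g y \<le> L * r" using LipD[OF g, of x y] by (simp add: r_def)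
    moreover have "\<kappa> / 2 * r\<^sup>2 \<le> Q (\<lambda>i. x i - y i)"
      using Q_ge[of "\<lambda>i. x i - y i"] by (simp add: r_def L2_set_def sum_nonneg)
    moreover have "L * r - \<kappa> / 4 * r\<^sup>2 \<le> L\<^sup>2 / \<kappa>"
    proof -
      have "0 \<le> (\<kappa> / 2 * r - L)\<^sup>2 / \<kappa>" using \<kappa>_pos by simp
      also have "\<dots> = \<kappa> / 4 * r\<^sup>2 - L * r + L\<^sup>2 / \<kappa>"
        using \<kappa>_pos by (simp add: power2_eq_square field_simps)
      finally show ?thesis by simp
    qed
    moreover have "Q x + Q y = 2 * Q m + 1 / 2 * Q (\<lambda>i. x i - y i)"
      unfolding m_def by (rule Q_parallelogram)
    ultimately have "(- Q x + g x) + (- Q y + - g y) \<le> 2 * (- Q m + e)"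
      by (simp add: e_def)
    then have "exp (- Q x + g x) * exp (- Q y + - g y) \<le> (exp (- Q m + e))\<^sup>2"
      by (simp flip: exp_add exp_double)
    then show "ennreal (exp (- Q x + g x)) * ennreal (exp (- Q y + - g y))
        \<le> (ennreal (exp (- Q (\<lambda>i\<in>I. (x i + y i) / 2) + e)))\<^sup>2"
      by (simp add: m_def ennreal_power ennreal_leI flip: ennreal_mult)
  qed measurable
  then have "ennreal (Z * E (\<lambda>t. exp (g t))) * ennreal (Z * E (\<lambda>t. exp (- g t)))
    \<le> (ennreal (Z * exp e))\<^sup>2"
    unfolding E[OF g] E[OF mg] E[OF zero] by (simp add: prob_space)
  then have "(Z * E (\<lambda>t. exp (g t))) * (Z * E (\<lambda>t. exp (- g t))) \<le> (Z * exp e)\<^sup>2"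
    using Z_pos by (simp add: ennreal_power flip: ennreal_mult)
  then have "Z\<^sup>2 * (E (\<lambda>t. exp (g t)) * E (\<lambda>t. exp (- g t))) \<le> Z\<^sup>2 * (exp e)\<^sup>2"
    by (simp add: power2_eq_square ac_simps)
  then have "E (\<lambda>t. exp (g t)) * E (\<lambda>t. exp (- g t)) \<le> (exp e)\<^sup>2"
    using Z_pos by simp
  also have "(exp e)\<^sup>2 = exp (L\<^sup>2 / \<kappa>)" by (simp add: e_def flip: exp_double)
  finally show ?thesis .
qed

lemma exp_Lip_ge_one:
  assumes "Lip L g" "E g = 0"
  shows "1 \<le> E (\<lambda>t. exp (g t))"
proof -
  have "1 = E (\<lambda>t. 1 + g t)"
    using assms(2) integrable_M[OF exp_growth_Lip[OF assms(1)]] by (simp add: prob_space)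
  also have "\<dots> \<le> E (\<lambda>t. exp (g t))"
    using integrable_M[OF exp_growth_Lip[OF assms(1)]] integrable_M[OF exp_growth_exp_Lip[OF assms(1)]]
    by (intro integral_mono) auto
  finally show ?thesis .
qed

lemma exp_Lip_centered:
  assumes g: "Lip L g" "E g = 0"
  shows "E (\<lambda>t. exp (g t)) \<le> exp (L\<^sup>2 / \<kappa>)"
proof -
  have mg: "Lip L (\<lambda>t. - g t)" using Lip_cmult[OF g(1), of "-1"] by simp
  have "E (\<lambda>t. exp (g t)) * 1 \<le> E (\<lambda>t. exp (g t)) * E (\<lambda>t. exp (- g t))"
    using exp_Lip_ge_one[OF mg] g(2) by (intro mult_left_mono) (auto intro: integral_nonneg)
  also note exp_Lip_product[OF g(1)]
  finally show ?thesis by simp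
qed

lemma Lip_variance:
  assumes g: "Lip L g"
  shows "E (\<lambda>t. (g t - E g)\<^sup>2) \<le> 4 * (exp (L\<^sup>2 / \<kappa>) - 1)"
proof -
  define k where "k t = g t - E g" for t
  have k: "Lip L k" unfolding k_def by (rule Lip_add_const[OF g])
  have mk: "Lip L (\<lambda>t. - k t)" using Lip_cmult[OF k, of "-1"] by simp
  have k0: "E k = 0"
    unfolding k_def using integrable_M[OF exp_growth_Lip[OF g]] by (simp add: prob_space)
  have "E (\<lambda>t. (k t)\<^sup>2) \<le> E (\<lambda>t. 2 * (exp (k t) + exp (- k t) - 2))"
    using square_le_exp_add_exp exp_growth_Lip[OF k] exp_growth_exp_Lip[OF k] exp_growth_exp_Lip[OF mk]
    by (intro integral_mono integrable_M exp_growth_intros) auto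
  also have "\<dots> = 2 * (E (\<lambda>t. exp (k t)) + E (\<lambda>t. exp (- k t)) - 2)"
    using integrable_M[OF exp_growth_exp_Lip[OF k]] integrable_M[OF exp_growth_exp_Lip[OF mk]]
    by (simp add: prob_space)
  also have "\<dots> \<le> 4 * (exp (L\<^sup>2 / \<kappa>) - 1)"
    using exp_Lip_centered[OF k k0] exp_Lip_centered[OF mk] k0 by simp
  finally show ?thesis unfolding k_def .
qed

text \<open>Expanding the square leaves \<open>E (exp (2 k)) - 2 E (exp k) + 1\<close>. The first
  term is bounded with Lipschitz constant \<open>2 L\<close>, and the second by
  \<open>E (exp k) >= 1\<close>.\<close>

lemma Lip_exp_deviation:
  assumes g: "Lip L g"
  shows "E (\<lambda>t. (exp (g t - E g) - 1)\<^sup>2) \<le> exp (4 * L\<^sup>2 / \<kappa>) - 1"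
proof -
  define k where "k t = g t - E g" for t
  have k: "Lip L k" unfolding k_def by (rule Lip_add_const[OF g])
  have k2: "Lip (2 * L) (\<lambda>t. 2 * k t)" using Lip_cmult[OF k, of 2] by simp
  have k0: "E k = 0"
    unfolding k_def using integrable_M[OF exp_growth_Lip[OF g]] by (simp add: prob_space)
  have "E (\<lambda>t. (exp (k t) - 1)\<^sup>2) = E (\<lambda>t. exp (2 * k t) - 2 * exp (k t) + 1)"
    by (intro Bochner_Integration.integral_cong refl) (simp add: power2_diff exp_double)
  also have "\<dots> = E (\<lambda>t. exp (2 * k t)) - 2 * E (\<lambda>t. exp (k t)) + 1"
    using integrable_M[OF exp_growth_exp_Lip[OF k]] integrable_M[OF exp_growth_exp_Lip[OF k2]]
    by (simp add: prob_space)
  also have "\<dots> \<le> exp ((2 * L)\<^sup>2 / \<kappa>) - 1"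
    using exp_Lip_centered[OF k2] exp_Lip_ge_one[OF k k0] k0 by simp
  finally show ?thesis unfolding k_def by (simp add: power_mult_distrib)
qed

lemma Lip_component:
  assumes "k \<in> I"
  shows "Lip 1 (\<lambda>t. t k)"
proof -
  have "\<bar>x k - y k\<bar> \<le> dst x y" for x y :: "'i \<Rightarrow> real"
    using member_le_L2_set[OF fin assms, of "\<lambda>i. \<bar>x i - y i\<bar>"] by (simp add: L2_set_def)
  then show ?thesis using assms by (auto simp: Lip_def)
qed

lemma exp_component:
  assumes "k \<in> I"
  shows "E (\<lambda>t. exp (c * t k)) \<le> exp (c\<^sup>2 / \<kappa>)" "exp_growth (\<lambda>t. exp (c * t k))"
  using exp_Lip_centered[OF Lip_cmult[OF Lip_component[OF assms]], of c] expectation_component[OF assms]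
    exp_growth_exp_Lip[OF Lip_cmult[OF Lip_component[OF assms]], of c]
  by auto

lemma component_moment:
  assumes "k \<in> I"
  shows "E (\<lambda>t. t k ^ (2 * m)) \<le> 6 * fact (2 * m) / \<kappa> ^ m"
proof -
  \<comment> \<open>At this scale the exponential moments are at most \<open>exp 1\<close>; the
    constant 6 bounds \<open>2 * exp 1\<close>.\<close>
  define s where "s = sqrt \<kappa>"
  have s: "s > 0" "s\<^sup>2 = \<kappa>" using \<kappa>_pos by (auto simp: s_def)
  have "\<kappa> ^ m * E (\<lambda>t. t k ^ (2 * m)) = E (\<lambda>t. (s * t k) ^ (2 * m))"
    by (simp add: power_mult_distrib power_mult s)
  also have "\<dots> \<le> E (\<lambda>t. fact (2 * m) * (exp (s * t k) + exp (- s * t k)))"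
    using even_power_le_exp[of "s * _" m] exp_component(2)[OF assms, of s] exp_component(2)[OF assms, of "- s"] assms
    by (intro integral_mono integrable_M exp_growth_intros) auto
  also have "\<dots> = fact (2 * m) * (E (\<lambda>t. exp (s * t k)) + E (\<lambda>t. exp (- s * t k)))"
    using integrable_M[OF exp_component(2)[OF assms, of s]] integrable_M[OF exp_component(2)[OF assms, of "- s"]]
    by simp
  also have "\<dots> \<le> fact (2 * m) * (exp 1 + exp 1)"
    using exp_component(1)[OF assms, of s] exp_component(1)[OF assms, of "- s"] s \<kappa>_pos
    by (intro mult_left_mono add_mono) auto
  also have "\<dots> \<le> fact (2 * m) * 6" using exp_le by (intro mult_left_mono) auto
  finally show ?thesis using \<kappa>_pos by (simp add: field_simps)
qed

lemma component_tail:
  assumes "k \<in> I" "0 \<le> r"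
  shows "prob {t \<in> space M. r < \<bar>t k\<bar>} \<le> 2 * exp (- \<kappa> * r\<^sup>2 / 4)"
proof -
  \<comment> \<open>The Chernoff parameter minimizing \<open>c^2 / \<kappa> - c r\<close>.\<close>
  define c where "c = \<kappa> * r / 2"
  have c: "c\<^sup>2 / \<kappa> - c * r = - \<kappa> * r\<^sup>2 / 4" using \<kappa>_pos by (simp add: c_def power2_eq_square field_simps)
  have "c \<ge> 0" using \<kappa>_pos assms by (simp add: c_def)
  have set: "{t \<in> space M. r < \<bar>t k\<bar>} \<in> events"
    using assms by measurable
  have ge: "indicator {t \<in> space M. r < \<bar>t k\<bar>} t \<le> exp (- c * r) * (exp (c * t k) + exp (- c * t k))" for t
  proof (cases "r < \<bar>t k\<bar>")
    case True
    then have "c * r \<le> c * \<bar>t k\<bar>" using \<open>c \<ge> 0\<close> by (intro mult_left_mono) auto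
    then have "1 \<le> exp (- c * r + c * t k) \<or> 1 \<le> exp (- c * r + - c * t k)"
      by (auto simp: abs_if split: if_splits)
    then have "1 \<le> exp (- c * r + c * t k) + exp (- c * r + - c * t k)"
      by (smt (verit) exp_gt_zero)
    then show ?thesis by (simp add: distrib_left exp_add indicator_def exp_diff exp_minus divide_inverse ac_simps)
  next
    case False then show ?thesis by (auto simp: indicator_def)
  qed
  have "prob {t \<in> space M. r < \<bar>t k\<bar>} = E (indicator {t \<in> space M. r < \<bar>t k\<bar>})"
    using set by simp
  also have "\<dots> \<le> E (\<lambda>t. exp (- c * r) * (exp (c * t k) + exp (- c * t k)))"
  proof (rule integral_mono)
    show "integrable M (\<lambda>t. exp (- c * r) * (exp (c * t k) + exp (- c * t k)))"
      using exp_component(2)[OF assms(1), of c] exp_component(2)[OF assms(1), of "- c"]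
      by (intro integrable_M exp_growth_intros) auto
  qed (use set ge in \<open>auto simp: less_top[symmetric]\<close>)
  also have "\<dots> = exp (- c * r) * (E (\<lambda>t. exp (c * t k)) + E (\<lambda>t. exp (- c * t k)))"
    using integrable_M[OF exp_component(2)[OF assms(1), of c]] integrable_M[OF exp_component(2)[OF assms(1), of "- c"]]
    by simp
  also have "\<dots> \<le> exp (- c * r) * (2 * exp (c\<^sup>2 / \<kappa>))"
    using exp_component(1)[OF assms(1), of c] exp_component(1)[OF assms(1), of "- c"]
    by (intro mult_left_mono) auto
  also have "\<dots> = 2 * exp (c\<^sup>2 / \<kappa> - c * r)" by (simp add: exp_diff exp_minus divide_inverse)
  finally show ?thesis unfolding c .
qed

end

section \<open>Truncation to a box and the phase of a cubic form\<close>

context quad_form begin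

lemma expectation_Cauchy_Schwarz:
  assumes "integrable M (\<lambda>t. X t * Y t)" "integrable M (\<lambda>t. (X t)\<^sup>2)" "integrable M (\<lambda>t. (Y t)\<^sup>2)"
  shows "\<bar>E (\<lambda>t. X t * Y t)\<bar> \<le> sqrt (E (\<lambda>t. (X t)\<^sup>2)) * sqrt (E (\<lambda>t. (Y t)\<^sup>2))"
proof -
  define a b c where "a = E (\<lambda>t. (X t)\<^sup>2)" and "b = E (\<lambda>t. (Y t)\<^sup>2)"
    and "c = E (\<lambda>t. X t * Y t)"
  have ab: "a \<ge> 0" "b \<ge> 0" by (simp_all add: a_def b_def)
  have quad: "0 \<le> s\<^sup>2 * a - 2 * s * c + b" for s
  proof -
    have "0 \<le> E (\<lambda>t. (s * X t - Y t)\<^sup>2)" by simp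
    also have "\<dots> = E (\<lambda>t. s\<^sup>2 * (X t)\<^sup>2 - 2 * s * (X t * Y t) + (Y t)\<^sup>2)"
      by (intro Bochner_Integration.integral_cong refl) (simp add: power2_eq_square algebra_simps)
    also have "\<dots> = s\<^sup>2 * a - 2 * s * c + b"
      using assms by (simp add: a_def b_def c_def)
    finally show ?thesis .
  qed
  have "c\<^sup>2 \<le> a * b"
  proof (cases "a = 0")
    case True
    have "c = 0"
    proof (rule ccontr)
      assume "c \<noteq> 0"
      \<comment> \<open>With \<open>a = 0\<close> the quadratic is affine in \<open>s\<close>, and
        at this \<open>s\<close> it equals -1.\<close>
      then show False using quad[of "(b + 1) / (2 * c)"] True by simp
    qed
    then show ?thesis using ab by simp
  next
    case False
    then have "0 < a" using ab by simp
    then have "0 \<le> a * ((c / a)\<^sup>2 * a - 2 * (c / a) * c + b)" using quad[of "c / a"] by simp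
    also have "\<dots> = a * b - c\<^sup>2" using \<open>0 < a\<close> by (simp add: power2_eq_square field_simps)
    finally show ?thesis by simp
  qed
  then have "sqrt (c\<^sup>2) \<le> sqrt (a * b)" by (rule real_sqrt_le_mono)
  then show ?thesis by (simp add: real_sqrt_mult a_def b_def c_def)
qed

lemma expectation_abs_le_sqrt:
  assumes "integrable M X" "integrable M (\<lambda>t. (X t)\<^sup>2)"
  shows "E (\<lambda>t. \<bar>X t\<bar>) \<le> sqrt (E (\<lambda>t. (X t)\<^sup>2))"
  using expectation_Cauchy_Schwarz[of "\<lambda>t. \<bar>X t\<bar>" "\<lambda>_. 1"] assms by (simp add: prob_space)

lemma norm_expectation_le:
  fixes X :: "('i \<Rightarrow> real) \<Rightarrow> 'b::{banach, second_countable_topology}"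
  assumes "integrable M X" "integrable M Y" "\<And>t. t \<in> space M \<Longrightarrow> norm (X t) \<le> Y t"
  shows "norm (E X) \<le> E Y"
  by (rule order_trans[OF integral_norm_bound integral_mono]) (use assms in auto)

definition clip :: "real \<Rightarrow> ('i \<Rightarrow> real) \<Rightarrow> ('i \<Rightarrow> real)" where
  "clip r t = (\<lambda>i\<in>I. max (- r) (min r (t i)))"

definition bad :: "real \<Rightarrow> ('i \<Rightarrow> real) set" where
  "bad r = {t \<in> space M. \<exists>i\<in>I. r < \<bar>t i\<bar>}"

definition tail :: "real \<Rightarrow> real" where
  "tail r = 2 * real (card I) * exp (- \<kappa> * r\<^sup>2 / 4)"

lemma bad_events[measurable]: "bad r \<in> events"
  unfolding bad_def using fin by measurable

lemma prob_bad:
  assumes "r \<ge> 0"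
  shows "prob (bad r) \<le> tail r"
proof -
  have ev: "{t \<in> space M. r < \<bar>t i\<bar>} \<in> events" if [simp]: "i \<in> I" for i
    by measurable
  have "bad r = (\<Union>i\<in>I. {t \<in> space M. r < \<bar>t i\<bar>})" by (auto simp: bad_def)
  also have "prob \<dots> \<le> (\<Sum>i\<in>I. prob {t \<in> space M. r < \<bar>t i\<bar>})"
    using fin ev by (intro finite_measure_subadditive_finite) auto
  also have "\<dots> \<le> (\<Sum>i\<in>I. 2 * exp (- \<kappa> * r\<^sup>2 / 4))"
    using assms by (intro sum_mono component_tail)
  finally show ?thesis by (simp add: tail_def)
qed

text \<open>Cauchy-Schwarz against the indicator: a polynomially large second moment is harmless
  beside the tiny probability of leaving the cube.\<close>

lemma expectation_bad_le:
  assumes r: "r \<ge> 0" and b: "exp_growth b" and K: "E (\<lambda>t. (b t)\<^sup>2) \<le> K"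
  shows "E (\<lambda>t. indicator (bad r) t * \<bar>b t\<bar>) \<le> sqrt (K * tail r)"
    and "integrable M (\<lambda>t. indicator (bad r) t * \<bar>b t\<bar>)"
proof -
  note [measurable] = exp_growth_measurable[OF b]
  have ind: "exp_growth (\<lambda>t. indicator (bad r) t :: real)"
    using bad_events[of r] by (intro exp_growth_bounded[where C=1]) (auto simp: sets_M)
  have i2: "(indicator (bad r) t)\<^sup>2 = (indicator (bad r) t :: real)" for t
    by (simp add: indicator_def)
  show int: "integrable M (\<lambda>t. indicator (bad r) t * \<bar>b t\<bar>)"
    by (intro integrable_M exp_growth_mult ind exp_growth_abs b)
  have "E (\<lambda>t. indicator (bad r) t * \<bar>b t\<bar>)
    \<le> sqrt (E (\<lambda>t. (indicator (bad r) t)\<^sup>2)) * sqrt (E (\<lambda>t. \<bar>b t\<bar>\<^sup>2))"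
    using int b by (intro order_trans[OF abs_ge_self expectation_Cauchy_Schwarz])
      (auto simp: i2 intro!: integrable_M ind exp_growth_power)
  also have "\<dots> = sqrt (prob (bad r)) * sqrt (E (\<lambda>t. (b t)\<^sup>2))"
    by (simp add: i2)
  also have "\<dots> \<le> sqrt (tail r) * sqrt K"
    using prob_bad[OF r] K by (intro mult_mono real_sqrt_le_mono) (auto simp: tail_def)
  finally show "E (\<lambda>t. indicator (bad r) t * \<bar>b t\<bar>) \<le> sqrt (K * tail r)"
    by (simp add: real_sqrt_mult mult.commute)
qed

lemma expectation_sum:
  fixes \<phi> :: "'k \<Rightarrow> ('i \<Rightarrow> real) \<Rightarrow> 'b::{banach, second_countable_topology}"
  assumes "\<And>j. j \<in> J \<Longrightarrow> exp_growth (\<phi> j)"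
  shows "E (\<lambda>t. \<Sum>j\<in>J. \<phi> j t) = (\<Sum>j\<in>J. E (\<phi> j))"
  using assms by (intro Bochner_Integration.integral_sum integrable_M)

lemma expectation_sum2:
  fixes \<phi> :: "'k \<Rightarrow> 'l \<Rightarrow> ('i \<Rightarrow> real) \<Rightarrow> 'b::{banach, second_countable_topology}"
  assumes "\<And>j i. j \<in> J \<Longrightarrow> i \<in> J' \<Longrightarrow> exp_growth (\<phi> j i)"
  shows "E (\<lambda>t. \<Sum>j\<in>J. \<Sum>i\<in>J'. \<phi> j i t) = (\<Sum>j\<in>J. \<Sum>i\<in>J'. E (\<phi> j i))"
  using assms by (simp add: expectation_sum exp_growth_sum)

lemma clip_Leb[measurable]: "clip r \<in> Leb \<rightarrow>\<^sub>M Leb"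
  unfolding clip_def by (intro measurable_restrict) (auto simp: measurable_lborel1)

lemma clip_le: "r \<ge> 0 \<Longrightarrow> i \<in> I \<Longrightarrow> \<bar>clip r t i\<bar> \<le> r"
  by (auto simp: clip_def)

lemma clip_abs_le: "r \<ge> 0 \<Longrightarrow> i \<in> I \<Longrightarrow> \<bar>clip r t i\<bar> \<le> \<bar>t i\<bar>"
  by (auto simp: clip_def)

lemma clip_eq: "(\<And>i. i \<in> I \<Longrightarrow> \<bar>t i\<bar> \<le> r) \<Longrightarrow> i \<in> I \<Longrightarrow> clip r t i = t i"
  by (fastforce simp: clip_def max_def min_def abs_le_iff)

lemma clip_contraction:
  assumes "r \<ge> 0"
  shows "L2_set (\<lambda>i. clip r x i - clip r y i) I \<le> dst x y"
proof -
  have "\<bar>clip r x i - clip r y i\<bar> \<le> \<bar>x i - y i\<bar>" if "i \<in> I" for i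
    using that assms by (auto simp: clip_def max_def min_def)
  then have "L2_set (\<lambda>i. \<bar>clip r x i - clip r y i\<bar>) I \<le> L2_set (\<lambda>i. \<bar>x i - y i\<bar>) I"
    by (intro L2_set_mono) auto
  then show ?thesis by (simp add: L2_set_def)
qed

text \<open>\<open>clip r\<close> is a contraction onto the cube, so \<open>g\<close> composed with
  it inherits globally the Lipschitz constant that \<open>g\<close> has on the cube. The two
  functions differ only on \<open>bad r\<close>, where both are dominated by \<open>b\<close>. The
  first three conclusions serve the quartic exponent, the last one the kernel
  \<open>\<Gamma>\<close>.\<close>

theorem clip_concentration:
  assumes r: "r \<ge> 0" and L: "L \<ge> 0" and g: "exp_growth g" and b: "exp_growth b"
    and le: "\<And>t. \<bar>g t\<bar> \<le> b t" "\<And>t. \<bar>g (clip r t)\<bar> \<le> b t"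
    and lip: "\<And>x y. (\<And>i. i \<in> I \<Longrightarrow> \<bar>x i\<bar> \<le> r) \<Longrightarrow> (\<And>i. i \<in> I \<Longrightarrow> \<bar>y i\<bar> \<le> r) \<Longrightarrow>
        \<bar>g x - g y\<bar> \<le> L * dst x y"
    and K: "E (\<lambda>t. (b t)\<^sup>2) \<le> K"
  shows "Lip L (\<lambda>t. g (clip r t))"
    and "\<And>t. (\<And>i. i \<in> I \<Longrightarrow> \<bar>t i\<bar> \<le> r) \<Longrightarrow> g (clip r t) = g t"
    and "\<bar>E (\<lambda>t. g (clip r t)) - E g\<bar> \<le> 2 * sqrt (K * tail r)"
    and "E (\<lambda>t. \<bar>g t - E g\<bar>) \<le> 4 * sqrt (K * tail r) + 2 * sqrt (exp (L\<^sup>2 / \<kappa>) - 1)"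
proof -
  note [measurable] = exp_growth_measurable[OF g]
  define k where "k t = g (clip r t)" for t
  show Lip: "Lip L (\<lambda>t. g (clip r t))"
    unfolding Lip_def
  proof (intro conjI allI)
    show "(\<lambda>t. g (clip r t)) \<in> borel_measurable Leb" by measurable
    fix x y
    have "\<bar>g (clip r x) - g (clip r y)\<bar> \<le> L * L2_set (\<lambda>i. clip r x i - clip r y i) I"
      using clip_le[OF r] by (intro lip) auto
    also have "\<dots> \<le> L * dst x y"
      by (intro mult_left_mono clip_contraction r L)
    finally show "\<bar>g (clip r x) - g (clip r y)\<bar> \<le> L * dst x y" .
  qed
  then have k: "Lip L k" by (simp add: k_def[abs_def])
  show eq: "g (clip r t) = g t" if t: "\<And>i. i \<in> I \<Longrightarrow> \<bar>t i\<bar> \<le> r" for t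
  proof -
    have "\<bar>g (clip r t) - g t\<bar> \<le> L * L2_set (\<lambda>i. clip r t i - t i) I"
      using clip_le[OF r] t by (intro lip) auto
    also have "L2_set (\<lambda>i. clip r t i - t i) I = 0"
      by (intro L2_set_0') (use clip_eq[of t r] t in auto)
    finally show ?thesis by simp
  qed
  have kg: "exp_growth k" by (rule exp_growth_Lip[OF k])
  have diff: "\<bar>g t - k t\<bar> \<le> 2 * (indicator (bad r) t * \<bar>b t\<bar>)" if "t \<in> space M" for t
  proof (cases "t \<in> bad r")
    case True
    then show ?thesis using le(1)[of t] le(2)[of t] by (simp add: k_def)
  next
    case False
    then have "k t = g t" using eq[of t] that unfolding k_def by (fastforce simp: bad_def)
    then show ?thesis by simp
  qed
  have gk: "exp_growth (\<lambda>t. \<bar>g t - k t\<bar>)" by (intro exp_growth_abs exp_growth_diff g kg)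
  have "E (\<lambda>t. \<bar>g t - k t\<bar>) \<le> E (\<lambda>t. 2 * (indicator (bad r) t * \<bar>b t\<bar>))"
    using diff expectation_bad_le(2)[OF r b K] integrable_M[OF gk]
    by (intro integral_mono integrable_mult_right) auto
  also have "\<dots> \<le> 2 * sqrt (K * tail r)"
    using expectation_bad_le(1)[OF r b K] by simp
  finally have gk_le: "E (\<lambda>t. \<bar>g t - k t\<bar>) \<le> 2 * sqrt (K * tail r)" .
  have "\<bar>E k - E g\<bar> = \<bar>E (\<lambda>t. g t - k t)\<bar>"
    using integrable_M[OF g] integrable_M[OF kg] by (simp add: abs_minus_commute)
  also have "\<dots> \<le> E (\<lambda>t. \<bar>g t - k t\<bar>)"
    by (rule integral_abs_bound)
  finally have mean: "\<bar>E k - E g\<bar> \<le> 2 * sqrt (K * tail r)"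
    using gk_le by linarith
  then show "\<bar>E (\<lambda>t. g (clip r t)) - E g\<bar> \<le> 2 * sqrt (K * tail r)"
    by (simp add: k_def[abs_def])
  have km: "exp_growth (\<lambda>t. k t - E k)" by (intro exp_growth_diff kg exp_growth_const)
  have "E (\<lambda>t. \<bar>k t - E k\<bar>) \<le> sqrt (E (\<lambda>t. (k t - E k)\<^sup>2))"
    by (intro expectation_abs_le_sqrt integrable_M km exp_growth_power)
  also have "\<dots> \<le> sqrt (4 * (exp (L\<^sup>2 / \<kappa>) - 1))"
    by (intro real_sqrt_le_mono Lip_variance k)
  finally have dev: "E (\<lambda>t. \<bar>k t - E k\<bar>) \<le> 2 * sqrt (exp (L\<^sup>2 / \<kappa>) - 1)"
    unfolding real_sqrt_mult by simp
  \<comment> \<open>Clipping is paid for twice, in the function and in its mean; this makes the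
    factor 4 in front of the tail term.\<close>
  have "E (\<lambda>t. \<bar>g t - E g\<bar>)
    \<le> E (\<lambda>t. \<bar>g t - k t\<bar> + \<bar>k t - E k\<bar> + \<bar>E k - E g\<bar>)"
    by (intro integral_mono integrable_M exp_growth_add gk exp_growth_abs km exp_growth_const exp_growth_diff g) auto
  also have "\<dots> = E (\<lambda>t. \<bar>g t - k t\<bar>) + E (\<lambda>t. \<bar>k t - E k\<bar>)
      + \<bar>E k - E g\<bar>"
    using integrable_M[OF gk] integrable_M[OF exp_growth_abs[OF km]] by (simp add: prob_space)
  finally show "E (\<lambda>t. \<bar>g t - E g\<bar>) \<le> 4 * sqrt (K * tail r) + 2 * sqrt (exp (L\<^sup>2 / \<kappa>) - 1)"
    using gk_le mean dev by linarith
qed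

end

section \<open>The cubic form, its Stein kernel and its characteristic function\<close>

locale cubic_form = quad_form I B \<kappa> for I :: "'i set" and B \<kappa> +
  fixes \<beta> :: "'i \<Rightarrow> 'i \<Rightarrow> real"
  assumes \<beta>_sym: "\<And>j k. \<beta> j k = \<beta> k j" and \<beta>_bound: "\<And>j k. \<bar>\<beta> j k\<bar> \<le> 1"
begin

text \<open>The sums run over ordered pairs, so \<open>1 / 12\<close> here and \<open>1 / 48\<close> in \<open>quartic\<close> correspond to
  \<open>1 / 6\<close> and \<open>1 / 24\<close> for sums over edges.\<close>

definition cub :: "('i \<Rightarrow> real) \<Rightarrow> real" where
  "cub t = 1 / 12 * (\<Sum>j\<in>I. \<Sum>k\<in>I. \<beta> j k * (t j + t k) ^ 3)"

definition grad :: "'i \<Rightarrow> ('i \<Rightarrow> real) \<Rightarrow> real" where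
  "grad j t = 1 / 2 * (\<Sum>k\<in>I. \<beta> j k * (t j + t k)\<^sup>2)"

definition hess :: "'i \<Rightarrow> 'i \<Rightarrow> ('i \<Rightarrow> real) \<Rightarrow> real" where
  "hess j i t = \<beta> j i * (t j + t i) + (if i = j then \<Sum>k\<in>I. \<beta> j k * (t j + t k) else 0)"

definition \<rho> :: "'i \<Rightarrow> real" where
  "\<rho> j = (\<Sum>k\<in>I. \<beta> j k * (S j j + 2 * S j k + S k k))"

text \<open>The Stein kernel of \<open>cub\<close>, obtained from \<open>cub = 1 / 3 * \<langle>t, grad\<rangle>\<close> by integrating by parts once in
  the factor \<open>t\<close>; the term where the derivative hits \<open>grad\<close> is linear in \<open>t\<close>, and a second
  integration by parts turns it into \<open>\<rho>\<close>.\<close>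

definition \<Gamma> :: "('i \<Rightarrow> real) \<Rightarrow> real" where
  "\<Gamma> t = 1 / 3 * (\<Sum>j\<in>I. \<Sum>i\<in>I. (grad j t + \<rho> j) * S j i * grad i t)"

lemma exp_growth_cub: "exp_growth cub"
  unfolding cub_def by (intro exp_growth_intros)

lemma exp_growth_grad: "j \<in> I \<Longrightarrow> exp_growth (grad j)"
  unfolding grad_def by (intro exp_growth_intros)

lemma exp_growth_hess: "j \<in> I \<Longrightarrow> i \<in> I \<Longrightarrow> exp_growth (hess j i)"
  unfolding hess_def by (cases "i = j") (auto intro!: exp_growth_intros)

lemma exp_growth_\<Gamma>: "exp_growth \<Gamma>"
  unfolding \<Gamma>_def by (intro exp_growth_intros exp_growth_grad)

lemma component_deriv:
  "((\<lambda>y. (t(i := y)) k) has_real_derivative (if k = i then 1 else 0)) (at y)"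
  by (cases "k = i") auto

lemma cub_deriv:
  assumes i: "i \<in> I"
  shows "((\<lambda>y. cub (t(i := y))) has_real_derivative grad i (t(i := y))) (at y)"
proof -
  define d where "d k = (if k = i then 1 else 0 :: real)" for k
  define s where "s = t(i := y)"
  have comp: "((\<lambda>y. (t(i := y)) k) has_real_derivative d k) (at y)" for k
    unfolding d_def by (rule component_deriv)
  have one: "((\<lambda>y. \<beta> j k * ((t(i := y)) j + (t(i := y)) k) ^ 3) has_real_derivative
      \<beta> j k * (3 * (s j + s k)\<^sup>2 * (d j + d k))) (at y)" for j k
    using DERIV_cmult[OF DERIV_power[OF DERIV_add[OF comp comp], of j k 3], of "\<beta> j k"]
    by (simp add: s_def algebra_simps)
  have "((\<lambda>y. cub (t(i := y))) has_real_derivative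
      1 / 12 * (\<Sum>j\<in>I. \<Sum>k\<in>I. \<beta> j k * (3 * (s j + s k)\<^sup>2 * (d j + d k)))) (at y)"
    unfolding cub_def by (intro DERIV_cmult DERIV_sum one)
  also have "1 / 12 * (\<Sum>j\<in>I. \<Sum>k\<in>I. \<beta> j k * (3 * (s j + s k)\<^sup>2 * (d j + d k))) = grad i s"
  proof -
    have "(\<Sum>j\<in>I. \<Sum>k\<in>I. \<beta> j k * (3 * (s j + s k)\<^sup>2 * (d j + d k)))
      = (\<Sum>j\<in>I. \<Sum>k\<in>I. \<beta> j k * 3 * (s j + s k)\<^sup>2 * d j) + (\<Sum>j\<in>I. \<Sum>k\<in>I. \<beta> j k * 3 * (s j + s k)\<^sup>2 * d k)"
      by (simp add: algebra_simps sum.distrib)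
    also have "(\<Sum>j\<in>I. \<Sum>k\<in>I. \<beta> j k * 3 * (s j + s k)\<^sup>2 * d k) = (\<Sum>k\<in>I. \<beta> i k * 3 * (s i + s k)\<^sup>2)"
      using i fin by (intro sum.cong refl) (simp add: d_def if_distrib \<beta>_sym[of _ i] add.commute[of _ "s i"] cong: if_cong)
    also have "(\<Sum>j\<in>I. \<Sum>k\<in>I. \<beta> j k * 3 * (s j + s k)\<^sup>2 * d j) = (\<Sum>k\<in>I. \<beta> i k * 3 * (s i + s k)\<^sup>2)"
      using i fin by (subst sum.swap, intro sum.cong refl) (simp add: d_def if_distrib cong: if_cong)
    finally show ?thesis by (simp add: grad_def sum_distrib_left mult_ac)
  qed
  finally show ?thesis unfolding s_def .
qed

lemma grad_deriv:
  assumes i: "i \<in> I"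
  shows "((\<lambda>y. grad j (t(i := y))) has_real_derivative hess j i (t(i := y))) (at y)"
proof -
  define d where "d k = (if k = i then 1 else 0 :: real)" for k
  define s where "s = t(i := y)"
  have comp: "((\<lambda>y. (t(i := y)) k) has_real_derivative d k) (at y)" for k
    unfolding d_def by (rule component_deriv)
  have one: "((\<lambda>y. \<beta> j k * ((t(i := y)) j + (t(i := y)) k)\<^sup>2) has_real_derivative
      \<beta> j k * (2 * (s j + s k) * (d j + d k))) (at y)" for k
    using DERIV_cmult[OF DERIV_power[OF DERIV_add[OF comp comp], of j k 2], of "\<beta> j k"]
    by (simp add: s_def algebra_simps)
  have "((\<lambda>y. grad j (t(i := y))) has_real_derivative
      1 / 2 * (\<Sum>k\<in>I. \<beta> j k * (2 * (s j + s k) * (d j + d k)))) (at y)"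
    unfolding grad_def by (intro DERIV_cmult DERIV_sum one)
  also have "1 / 2 * (\<Sum>k\<in>I. \<beta> j k * (2 * (s j + s k) * (d j + d k)))
      = (\<Sum>k\<in>I. \<beta> j k * (s j + s k) * d k) + (\<Sum>k\<in>I. \<beta> j k * (s j + s k)) * d j"
    unfolding sum_distrib_left sum_distrib_right sum.distrib[symmetric]
    by (intro sum.cong refl) (simp add: algebra_simps)
  also have "(\<Sum>k\<in>I. \<beta> j k * (s j + s k) * d k) = \<beta> j i * (s j + s i)"
    using i fin by (simp add: d_def if_distrib cong: if_cong)
  also have "\<beta> j i * (s j + s i) + (\<Sum>k\<in>I. \<beta> j k * (s j + s k)) * d j = hess j i s"
    by (auto simp: hess_def d_def)
  finally show ?thesis unfolding s_def .
qed

text \<open>Euler's identity for a homogeneous form of degree 3. It exposes the factor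
  \<open>t\<close> on which integration by parts acts.\<close>

lemma Euler_cub: "cub t = 1 / 3 * (\<Sum>j\<in>I. t j * grad j t)"
proof -
  have "(\<Sum>j\<in>I. \<Sum>k\<in>I. \<beta> j k * t k * (t j + t k)\<^sup>2) = (\<Sum>j\<in>I. \<Sum>k\<in>I. \<beta> j k * t j * (t j + t k)\<^sup>2)"
    by (subst sum.swap) (simp add: \<beta>_sym[of _ "_ :: 'i"] add.commute cong: sum.cong)
  moreover have "(\<Sum>j\<in>I. \<Sum>k\<in>I. \<beta> j k * (t j + t k) ^ 3)
    = (\<Sum>j\<in>I. \<Sum>k\<in>I. \<beta> j k * t j * (t j + t k)\<^sup>2) + (\<Sum>j\<in>I. \<Sum>k\<in>I. \<beta> j k * t k * (t j + t k)\<^sup>2)"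
    unfolding sum.distrib[symmetric]
    by (intro sum.cong refl) (simp add: power3_eq_cube power2_eq_square algebra_simps)
  ultimately show ?thesis
    by (simp add: cub_def grad_def sum_distrib_left mult_ac)
qed

text \<open>This is the term that arises when the derivative falls on \<open>grad\<close>. Being
  linear in \<open>t\<close>, it can be integrated by parts once more, so that only
  \<open>\<psi>'\<close> remains.\<close>

lemma hess_trace: "(\<Sum>j\<in>I. \<Sum>i\<in>I. S j i * hess j i t) = (\<Sum>j\<in>I. \<rho> j * t j)"
proof -
  have a: "(\<Sum>j\<in>I. \<Sum>i\<in>I. S j i * hess j i t)
    = (\<Sum>j\<in>I. \<Sum>k\<in>I. S j k * \<beta> j k * (t j + t k)) + (\<Sum>j\<in>I. \<Sum>k\<in>I. S j j * \<beta> j k * (t j + t k))"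
    unfolding sum.distrib[of _ _ I, symmetric, where g="\<lambda>j. \<Sum>k\<in>I. _ j k"]
  proof (rule sum.cong[OF refl])
    fix j assume j: "j \<in> I"
    have "(\<Sum>i\<in>I. S j i * hess j i t) = (\<Sum>i\<in>I. S j i * \<beta> j i * (t j + t i))
        + (\<Sum>i\<in>I. if i = j then S j j * (\<Sum>k\<in>I. \<beta> j k * (t j + t k)) else 0)"
      unfolding sum.distrib[symmetric] by (intro sum.cong refl) (simp add: hess_def algebra_simps)
    then show "(\<Sum>i\<in>I. S j i * hess j i t) = (\<Sum>k\<in>I. S j k * \<beta> j k * (t j + t k)) + (\<Sum>k\<in>I. S j j * \<beta> j k * (t j + t k))"
      using j fin by (simp add: sum_distrib_left mult.assoc)
  qed
  have sw: "(\<Sum>j\<in>I. \<Sum>k\<in>I. S j k * \<beta> j k * t k) = (\<Sum>j\<in>I. \<Sum>k\<in>I. S j k * \<beta> j k * t j)"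
    "(\<Sum>j\<in>I. \<Sum>k\<in>I. S j j * \<beta> j k * t k) = (\<Sum>j\<in>I. \<Sum>k\<in>I. S k k * \<beta> j k * t j)"
    by (subst sum.swap, simp add: \<beta>_sym[of _ "_ :: 'i"] S_sym[of _ "_ :: 'i"] cong: sum.cong)+
  show ?thesis
    unfolding a distrib_left sum.distrib sw
    by (simp add: \<rho>_def sum_distrib_left sum.distrib algebra_simps)
qed

theorem cub_ibp:
  fixes \<psi> \<psi>' :: "real \<Rightarrow> complex"
  assumes deriv: "\<And>y. (\<psi> has_vector_derivative \<psi>' y) (at y)" and cont: "\<And>y. isCont \<psi>' y"
    and g: "exp_growth (\<lambda>t. \<psi> (cub t))" and g': "exp_growth (\<lambda>t. \<psi>' (cub t))"
  shows "E (\<lambda>t. cub t *\<^sub>R \<psi> (cub t)) = E (\<lambda>t. \<Gamma> t *\<^sub>R \<psi>' (cub t))"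
proof -
  have dcub: "((\<lambda>x. \<psi> (cub (t(i := x)))) has_vector_derivative grad i t *\<^sub>R \<psi>' (cub t)) (at (t i))"
    if "i \<in> I" for i t
  proof -
    have "((\<psi> \<circ> (\<lambda>x. cub (t(i := x)))) has_vector_derivative grad i t *\<^sub>R \<psi>' (cub (t(i := t i)))) (at (t i))"
      by (rule vector_diff_chain_at)
         (use cub_deriv[OF that, of t "t i"] deriv in \<open>auto simp: has_real_derivative_iff_has_vector_derivative\<close>)
    then show ?thesis by (simp add: o_def)
  qed
  have cc: "isCont (\<lambda>x. (t(i := x)) k) y" for t :: "'i \<Rightarrow> real" and i k y
    using DERIV_isCont[OF component_deriv] .
  have ccub: "isCont (\<lambda>x. cub (t(i := x))) y" if "i \<in> I" for t i y
    using DERIV_isCont[OF cub_deriv[OF that]] .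
  have cgrad: "isCont (\<lambda>x. grad j (t(i := x))) y" if "i \<in> I" for t i j y
    using DERIV_isCont[OF grad_deriv[OF that]] .
  have chess: "isCont (\<lambda>x. hess j k (t(i := x))) y" for t i j k y
    unfolding hess_def by (cases "k = j") (auto intro!: continuous_intros cc simp del: fun_upd_apply)
  have c\<psi>': "isCont (\<lambda>x. \<psi>' (cub (t(i := x)))) y" if "i \<in> I" for t i y
    using isCont_o2[OF ccub[OF that] cont] .
  have c\<psi>: "isCont (\<lambda>x. \<psi> (cub (t(i := x)))) y" if "i \<in> I" for t i y
    using isCont_o2[OF ccub[OF that] has_vector_derivative_continuous[OF deriv]] .
  have first: "E (\<lambda>t. t k *\<^sub>R \<psi> (cub t)) = (\<Sum>i\<in>I. S k i *\<^sub>R E (\<lambda>t. grad i t *\<^sub>R \<psi>' (cub t)))"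
    if "k \<in> I" for k
    using that g g' by (intro gaussian_ibp dcub)
      (auto intro!: exp_growth_scaleR exp_growth_grad continuous_intros cgrad c\<psi>' simp del: fun_upd_apply)
  define G' where "G' k i t = hess k i t *\<^sub>R \<psi> (cub t) + (grad k t * grad i t) *\<^sub>R \<psi>' (cub t)" for k i t
  have eG': "exp_growth (G' k i)" if "k \<in> I" "i \<in> I" for k i
    unfolding G'_def using that g g'
    by (intro exp_growth_add exp_growth_scaleR exp_growth_hess exp_growth_mult exp_growth_grad)
  have second: "E (\<lambda>t. t k *\<^sub>R (grad k t *\<^sub>R \<psi> (cub t))) = (\<Sum>i\<in>I. S k i *\<^sub>R E (G' k i))"
    if k: "k \<in> I" for k
  proof (rule gaussian_ibp[OF k])
    show "exp_growth (\<lambda>t. grad k t *\<^sub>R \<psi> (cub t))"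
      by (intro exp_growth_scaleR exp_growth_grad k g)
    fix i t assume i: "i \<in> I"
    show "exp_growth (G' k i)" by (rule eG'[OF k i])
    show "((\<lambda>x. grad k (t(i := x)) *\<^sub>R \<psi> (cub (t(i := x)))) has_vector_derivative G' k i t) (at (t i))"
      using has_vector_derivative_scaleR[OF grad_deriv[OF i, of k t "t i"] dcub[OF i, of t]]
      by (simp add: G'_def add.commute)
    show "isCont (\<lambda>x. G' k i (t(i := x))) (t i)"
      unfolding G'_def by (intro continuous_intros chess cgrad c\<psi> c\<psi>' i)
  qed
  define A where "A k i t = (grad k t * grad i t) *\<^sub>R \<psi>' (cub t)" for k i t
  define H where "H k i t = hess k i t *\<^sub>R \<psi> (cub t)" for k i t
  define P where "P i t = grad i t *\<^sub>R \<psi>' (cub t)" for i t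
  have eA: "exp_growth (A k i)" and eH: "exp_growth (H k i)" and eP: "exp_growth (P i)"
    if "k \<in> I" "i \<in> I" for k i
    unfolding A_def H_def P_def using that g g'
    by (intro exp_growth_scaleR exp_growth_hess exp_growth_mult exp_growth_grad; simp)+
  have E_G': "E (G' k i) = E (H k i) + E (A k i)" if "k \<in> I" "i \<in> I" for k i
  proof -
    have "G' k i = (\<lambda>t. H k i t + A k i t)" by (simp add: G'_def H_def A_def fun_eq_iff)
    then show ?thesis using integrable_M[OF eH[OF that]] integrable_M[OF eA[OF that]] by simp
  qed
  \<comment> \<open>The computation starts from the \<open>\<Gamma>\<close> side. The
    \<open>A\<close> terms carry two gradients, the \<open>P\<close> terms carry
    \<open>\<rho>\<close>. By \<open>first\<close> the \<open>P\<close> terms become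
    \<open><\<rho>, t> \<psi>\<close>, which \<open>hess_trace\<close> rewrites as the
    \<open>H\<close> terms; \<open>A\<close> and \<open>H\<close> together are
    \<open>second\<close>, and \<open>Euler_cub\<close> reassembles \<open>cub\<close>.\<close>
  have "E (\<lambda>t. \<Gamma> t *\<^sub>R \<psi>' (cub t))
      = E (\<lambda>t. (1 / 3) *\<^sub>R (\<Sum>k\<in>I. \<Sum>i\<in>I. S k i *\<^sub>R A k i t + (\<rho> k * S k i) *\<^sub>R P i t))"
  proof (intro Bochner_Integration.integral_cong refl)
    fix t
    have "(\<Sum>k\<in>I. \<Sum>i\<in>I. S k i *\<^sub>R A k i t + (\<rho> k * S k i) *\<^sub>R P i t)
      = (\<Sum>k\<in>I. \<Sum>i\<in>I. ((grad k t + \<rho> k) * S k i * grad i t) *\<^sub>R \<psi>' (cub t))"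
      by (intro sum.cong refl) (simp add: A_def P_def algebra_simps)
    then show "\<Gamma> t *\<^sub>R \<psi>' (cub t)
        = (1 / 3) *\<^sub>R (\<Sum>k\<in>I. \<Sum>i\<in>I. S k i *\<^sub>R A k i t + (\<rho> k * S k i) *\<^sub>R P i t)"
      unfolding \<Gamma>_def by (simp only: scaleR_sum_left[symmetric] scaleR_scaleR)
  qed
  also have "\<dots> = (1 / 3) *\<^sub>R (\<Sum>k\<in>I. \<Sum>i\<in>I. E (\<lambda>t. S k i *\<^sub>R A k i t + (\<rho> k * S k i) *\<^sub>R P i t))"
    unfolding integral_scaleR_right
    by (subst expectation_sum2) (auto intro!: exp_growth_add exp_growth_scaleR exp_growth_const eA eP)
  also have "\<dots> = (1 / 3) *\<^sub>R (\<Sum>k\<in>I. \<Sum>i\<in>I. S k i *\<^sub>R E (A k i) + (\<rho> k * S k i) *\<^sub>R E (P i))"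
    using integrable_M[OF eA] integrable_M[OF eP] by simp
  also have "(\<Sum>k\<in>I. \<Sum>i\<in>I. S k i *\<^sub>R E (A k i) + (\<rho> k * S k i) *\<^sub>R E (P i))
      = (\<Sum>k\<in>I. \<Sum>i\<in>I. S k i *\<^sub>R E (A k i)) + (\<Sum>k\<in>I. \<rho> k *\<^sub>R E (\<lambda>t. t k *\<^sub>R \<psi> (cub t)))"
    by (simp add: sum.distrib first P_def[abs_def] scaleR_sum_right)
  also have "(\<Sum>k\<in>I. \<rho> k *\<^sub>R E (\<lambda>t. t k *\<^sub>R \<psi> (cub t)))
      = E (\<lambda>t. \<Sum>k\<in>I. \<rho> k *\<^sub>R (t k *\<^sub>R \<psi> (cub t)))"
    by (subst expectation_sum) (auto intro!: exp_growth_scaleR exp_growth_const exp_growth_component g simp del: scaleR_scaleR)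
  also have "(\<lambda>t. \<Sum>k\<in>I. \<rho> k *\<^sub>R (t k *\<^sub>R \<psi> (cub t))) = (\<lambda>t. \<Sum>k\<in>I. \<Sum>i\<in>I. S k i *\<^sub>R H k i t)"
    using hess_trace by (simp add: H_def fun_eq_iff flip: scaleR_sum_left)
  also have "E \<dots> = (\<Sum>k\<in>I. \<Sum>i\<in>I. S k i *\<^sub>R E (H k i))"
    by (subst expectation_sum2) (auto intro!: exp_growth_scaleR exp_growth_const eH)
  also have "(\<Sum>k\<in>I. \<Sum>i\<in>I. S k i *\<^sub>R E (A k i)) + (\<Sum>k\<in>I. \<Sum>i\<in>I. S k i *\<^sub>R E (H k i))
      = (\<Sum>k\<in>I. E (\<lambda>t. t k *\<^sub>R (grad k t *\<^sub>R \<psi> (cub t))))"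
    by (simp add: second E_G' scaleR_add_right sum.distrib del: scaleR_scaleR)
  also have "\<dots> = E (\<lambda>t. \<Sum>k\<in>I. t k *\<^sub>R (grad k t *\<^sub>R \<psi> (cub t)))"
    by (subst expectation_sum) (auto intro!: exp_growth_scaleR exp_growth_component exp_growth_grad g simp del: scaleR_scaleR)
  also have "(1 / 3) *\<^sub>R \<dots> = E (\<lambda>t. cub t *\<^sub>R \<psi> (cub t))"
    unfolding integral_scaleR_right[symmetric]
    by (subst (2) Euler_cub) (simp add: scaleR_sum_left scaleR_sum_right sum_divide_distrib)
  finally show ?thesis ..
qed

text \<open>The case of the identity function in \<open>cub_ibp\<close>.\<close>

lemma expectation_\<Gamma>: "E (\<lambda>t. (cub t)\<^sup>2) = E \<Gamma>"
proof -
  have "E (\<lambda>t. cub t *\<^sub>R complex_of_real (cub t)) = E (\<lambda>t. \<Gamma> t *\<^sub>R 1)"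
    by (rule cub_ibp) (auto intro!: exp_growth_of_real exp_growth_cub exp_growth_const derivative_eq_intros)
  then have "complex_of_real (E (\<lambda>t. (cub t)\<^sup>2)) = complex_of_real (E \<Gamma>)"
    by (simp add: scaleR_conv_of_real power2_eq_square flip: of_real_mult)
  then show ?thesis by (simp only: of_real_eq_iff)
qed

lemma exp_growth_iexp: "exp_growth g \<Longrightarrow> exp_growth (\<lambda>t. iexp (s * g t))"
  by (rule exp_growth_bounded[where C=1]) (auto dest!: exp_growth_measurable)

text \<open>Permits differentiation under the expectation: a second-order remainder bound survives
  taking expectations.\<close>

lemma has_vector_derivative_quadratic:
  fixes g :: "real \<Rightarrow> 'b::real_normed_vector"
  assumes "\<And>y. norm (g y - g s - (y - s) *\<^sub>R D) \<le> C * (y - s)\<^sup>2"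
  shows "(g has_vector_derivative D) (at s)"
  unfolding has_vector_derivative_def
proof (rule has_derivativeI_sandwich[where e=1 and H="\<lambda>y. C * \<bar>y - s\<bar>"])
  show "bounded_linear (\<lambda>x. x *\<^sub>R D)" by (rule bounded_linear_scaleR_left)
  show "(\<lambda>y. C * \<bar>y - s\<bar>) \<midarrow>s\<rightarrow> 0"
    by (rule tendsto_eq_intros refl | simp)+
  fix y :: real assume "y \<noteq> s"
  then show "norm (g y - g s - (y - s) *\<^sub>R D) / norm (y - s) \<le> C * \<bar>y - s\<bar>"
    using assms[of y] by (simp add: divide_le_eq power2_eq_square mult.assoc)
qed simp

text \<open>With the integrating factor \<open>exp (m s^2 / 2)\<close>, the derivative of
  \<open>\<Phi>\<close> is that factor times \<open>s E ((m - \<Gamma>) exp (i s cub))\<close>. The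
  mean value inequality on the unit interval costs a factor \<open>exp (m / 2)\<close>, which
  cancels when the integrating factor is removed at \<open>s = 1\<close>; so the bound is free of
  \<open>m\<close> in front.\<close>

theorem cub_clt:
  defines "m \<equiv> E (\<lambda>t. (cub t)\<^sup>2)"
  shows "cmod (E (\<lambda>t. iexp (cub t)) - exp (- m / 2)) \<le> E (\<lambda>t. \<bar>\<Gamma> t - m\<bar>)"
proof -
  let ?d = "\<lambda>y s t. iexp (y * cub t) - iexp (s * cub t) - (y - s) *\<^sub>R (cub t *\<^sub>R (\<i> * iexp (s * cub t)))"
  let ?p = "\<lambda>s t. \<Gamma> t *\<^sub>R (complex_of_real (- s) * iexp (s * cub t)) + (m * s) *\<^sub>R iexp (s * cub t)"
  define g where "g s = E (\<lambda>t. iexp (s * cub t))" for s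
  define D where "D s = E (\<lambda>t. cub t *\<^sub>R (\<i> * iexp (s * cub t)))" for s
  define dev where "dev = E (\<lambda>t. \<bar>\<Gamma> t - m\<bar>)"
  \<comment> \<open>\<open>g\<close> is the characteristic function of \<open>cub\<close>;
    \<open>\<Phi>\<close> would be constant if \<open>\<Gamma>\<close> were equal to its mean
    \<open>m\<close>.\<close>
  define \<Phi> where "\<Phi> s = exp (m * s\<^sup>2 / 2) *\<^sub>R g s" for s
  have m: "m \<ge> 0" by (simp add: m_def)
  note e_iexp = exp_growth_iexp[OF exp_growth_cub]
  have e_i: "exp_growth (\<lambda>t. c * iexp (s * cub t))" for c s
    by (rule exp_growth_bounded[where C="cmod c"])
       (use exp_growth_measurable[OF exp_growth_cub] in \<open>auto simp: norm_mult\<close>)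
  have "(g has_vector_derivative D s) (at s)" for s
  proof (rule has_vector_derivative_quadratic)
    fix y
    have pw: "cmod (iexp (y * c) - iexp (s * c) - (y - s) *\<^sub>R (c *\<^sub>R (\<i> * iexp (s * c)))) \<le> c\<^sup>2 / 2 * (y - s)\<^sup>2" for c
    proof -
      have "iexp (y * c) = iexp (s * c) * iexp ((y - s) * c)"
        by (simp add: algebra_simps flip: exp_add)
      then have "iexp (y * c) - iexp (s * c) - (y - s) *\<^sub>R (c *\<^sub>R (\<i> * iexp (s * c)))
        = iexp (s * c) * (iexp ((y - s) * c) - (\<Sum>k\<le>1. (\<i> * ((y - s) * c)) ^ k / fact k))"
        by (simp add: scaleR_conv_of_real algebra_simps)
      also have "cmod \<dots> = cmod (iexp ((y - s) * c) - (\<Sum>k\<le>1. (\<i> * ((y - s) * c)) ^ k / fact k))"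
        by (simp add: norm_mult)
      also have "\<dots> \<le> \<bar>(y - s) * c\<bar> ^ Suc 1 / fact (Suc 1)"
        using iexp_approx1[of "(y - s) * c" 1] by simp
      also have "\<dots> = c\<^sup>2 / 2 * (y - s)\<^sup>2"
        by (simp add: power2_eq_square[symmetric] power_mult_distrib mult.commute)
      finally show ?thesis .
    qed
    have diff: "g y - g s - (y - s) *\<^sub>R D s
      = E (\<lambda>t. ?d y s t)"
      unfolding g_def D_def
      using integrable_M[OF e_iexp] integrable_M[OF exp_growth_scaleR[OF exp_growth_cub e_i[of \<i> s]]]
      by (simp del: scaleR_scaleR)
    have "cmod (g y - g s - (y - s) *\<^sub>R D s) \<le> E (\<lambda>t. (cub t)\<^sup>2 / 2 * (y - s)\<^sup>2)"
      unfolding diff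
    proof (rule norm_expectation_le)
      show "integrable M (\<lambda>t. (cub t)\<^sup>2 / 2 * (y - s)\<^sup>2)"
        using integrable_M[OF exp_growth_power[OF exp_growth_cub, of 2]] by simp
      show "integrable M (\<lambda>t. ?d y s t)"
        using integrable_M[OF e_iexp] integrable_M[OF exp_growth_scaleR[OF exp_growth_cub e_i[of \<i> s]]]
        by (simp del: scaleR_scaleR)
      show "cmod (?d y s t)
          \<le> (cub t)\<^sup>2 / 2 * (y - s)\<^sup>2" for t
        by (rule pw[of "cub t"])
    qed
    also have "\<dots> = m / 2 * (y - s)\<^sup>2" by (simp add: m_def)
    finally show "cmod (g y - g s - (y - s) *\<^sub>R D s) \<le> m / 2 * (y - s)\<^sup>2" .
  qed
  note dg = this
  have d\<Phi>: "(\<Phi> has_vector_derivative exp (m * s\<^sup>2 / 2) *\<^sub>R (D s + (m * s) *\<^sub>R g s)) (at s)" for s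
  proof -
    have "((\<lambda>s. exp (m * s\<^sup>2 / 2)) has_real_derivative exp (m * s\<^sup>2 / 2) * (m * s)) (at s)"
      by (auto intro!: derivative_eq_intros)
    from has_vector_derivative_scaleR[OF this dg] show ?thesis
      unfolding \<Phi>_def by (simp add: scaleR_add_right)
  qed
  \<comment> \<open>The test function is \<open>i exp (i s y)\<close>, whose derivative is
    \<open>- s exp (i s y)\<close>.\<close>
  have D: "D s = E (\<lambda>t. \<Gamma> t *\<^sub>R (complex_of_real (- s) * iexp (s * cub t)))" for s
    unfolding D_def
  proof (rule cub_ibp[where \<psi>="\<lambda>y. \<i> * iexp (s * y)" and \<psi>'="\<lambda>y. complex_of_real (- s) * iexp (s * y)"])
    show "((\<lambda>y. \<i> * iexp (s * y)) has_vector_derivative complex_of_real (- s) * iexp (s * y)) (at y)" for y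
    proof -
      have "((\<lambda>z. \<i> * exp (\<i> * (complex_of_real s * z))) has_field_derivative
          complex_of_real (- s) * iexp (s * y)) (at (complex_of_real y))"
        by (auto intro!: derivative_eq_intros simp: field_simps)
      from has_vector_derivative_real_field[OF this] show ?thesis by simp
    qed
    show "isCont (\<lambda>y. complex_of_real (- s) * iexp (s * y)) y" for y
      by (intro continuous_intros)
  qed (rule e_i)+
  have bound: "norm (D s + (m * s) *\<^sub>R g s) \<le> dev" if "0 \<le> s" "s \<le> 1" for s
  proof -
    have i1: "integrable M (\<lambda>t. \<Gamma> t *\<^sub>R (complex_of_real (- s) * iexp (s * cub t)))"
      by (intro integrable_M exp_growth_scaleR exp_growth_\<Gamma> e_i)
    have i2: "integrable M (\<lambda>t. (m * s) *\<^sub>R iexp (s * cub t))"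
      by (intro integrable_M exp_growth_scaleR exp_growth_const e_iexp)
    have sum: "D s + (m * s) *\<^sub>R g s
       = E (\<lambda>t. ?p s t)"
      unfolding D g_def using i1 i2 by (simp del: scaleR_scaleR)
    show ?thesis
      unfolding sum dev_def
    proof (rule norm_expectation_le)
      show "integrable M (\<lambda>t. \<bar>\<Gamma> t - m\<bar>)"
        by (intro integrable_M exp_growth_abs exp_growth_diff exp_growth_\<Gamma> exp_growth_const)
      fix t
      have "?p s t
        = complex_of_real (s * (m - \<Gamma> t)) * iexp (s * cub t)"
        by (simp add: scaleR_conv_of_real algebra_simps)
      also have "cmod \<dots> = s * \<bar>\<Gamma> t - m\<bar>"
        using that by (simp add: norm_mult abs_mult abs_minus_commute del: of_real_mult of_real_diff)
      also have "\<dots> \<le> \<bar>\<Gamma> t - m\<bar>" using that by (intro mult_left_le_one_le) auto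
      finally show "cmod (?p s t)
        \<le> \<bar>\<Gamma> t - m\<bar>" .
    qed (intro Bochner_Integration.integrable_add i1 i2)
  qed
  have "continuous_on {0..1} \<Phi>"
    using has_vector_derivative_continuous[OF d\<Phi>] by (intro continuous_at_imp_continuous_on) auto
  then obtain s where s: "s \<in> {0<..<1}"
    "norm (\<Phi> 1 - \<Phi> 0) \<le> norm ((1 - 0) *\<^sub>R (exp (m * s\<^sup>2 / 2) *\<^sub>R (D s + (m * s) *\<^sub>R g s)))"
    using mvt_general[of 0 1 \<Phi> "\<lambda>s x. x *\<^sub>R (exp (m * s\<^sup>2 / 2) *\<^sub>R (D s + (m * s) *\<^sub>R g s))"] d\<Phi>
    by (auto simp: has_vector_derivative_def[symmetric] simp del: scaleR_scaleR)
  have "norm (\<Phi> 1 - \<Phi> 0) \<le> exp (m * s\<^sup>2 / 2) * norm (D s + (m * s) *\<^sub>R g s)"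
    using s(2) by simp
  also have "\<dots> \<le> exp (m / 2) * dev"
  proof (intro mult_mono bound)
    have "s\<^sup>2 \<le> 1" using s by (simp add: power_le_one)
    then show "exp (m * s\<^sup>2 / 2) \<le> exp (m / 2)" using m by (simp add: mult_left_le)
  qed (use s in auto)
  finally have "norm (\<Phi> 1 - \<Phi> 0) \<le> exp (m / 2) * dev" .
  moreover have "\<Phi> 0 = 1" by (simp add: \<Phi>_def g_def prob_space)
  moreover have "\<Phi> 1 - 1 = exp (m / 2) *\<^sub>R (g 1 - exp (- m / 2))"
  proof -
    have "exp (m / 2) *\<^sub>R complex_of_real (exp (- m / 2)) = 1"
      by (simp add: scaleR_conv_of_real flip: of_real_mult exp_add)
    then show ?thesis by (simp add: \<Phi>_def scaleR_diff_right)
  qed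
  ultimately have "exp (m / 2) * norm (g 1 - exp (- m / 2)) \<le> exp (m / 2) * dev"
    by simp
  then show ?thesis by (simp add: g_def dev_def)
qed

end

section \<open>Moment and Lipschitz bounds for cubic and quartic forms\<close>

lemma abs_square_diff_le:
  fixes a b s :: real
  assumes "\<bar>a\<bar> \<le> s" "\<bar>b\<bar> \<le> s"
  shows "\<bar>a\<^sup>2 - b\<^sup>2\<bar> \<le> 2 * s * \<bar>a - b\<bar>"
proof -
  have "a\<^sup>2 - b\<^sup>2 = (a + b) * (a - b)" by (simp add: power2_eq_square algebra_simps)
  moreover have "\<bar>a + b\<bar> \<le> 2 * s" using assms by linarith
  ultimately show ?thesis by (simp add: abs_mult mult_right_mono)
qed

lemma abs_power4_diff_le:
  fixes a b s :: real
  assumes "\<bar>a\<bar> \<le> s" "\<bar>b\<bar> \<le> s"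
  shows "\<bar>a ^ 4 - b ^ 4\<bar> \<le> 4 * s ^ 3 * \<bar>a - b\<bar>"
proof -
  have "\<bar>a\<^sup>2\<bar> \<le> s\<^sup>2" "\<bar>b\<^sup>2\<bar> \<le> s\<^sup>2" using assms by (auto simp: abs_le_square_iff[symmetric])
  from abs_square_diff_le[OF this] have "\<bar>a ^ 4 - b ^ 4\<bar> \<le> 2 * s\<^sup>2 * \<bar>a\<^sup>2 - b\<^sup>2\<bar>"
    by (simp flip: power_mult)
  also have "\<dots> \<le> 2 * s\<^sup>2 * (2 * s * \<bar>a - b\<bar>)"
    by (intro mult_left_mono abs_square_diff_le assms) auto
  finally show ?thesis by (simp add: power2_eq_square power3_eq_cube mult_ac)
qed

lemma add_squared_le: "((a::real) + b)\<^sup>2 \<le> 2 * a\<^sup>2 + 2 * b\<^sup>2"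
  using zero_le_power2[of "a - b"] by (simp add: power2_eq_square algebra_simps)

lemma add_power4_le: "((a::real) + b) ^ 4 \<le> 8 * a ^ 4 + 8 * b ^ 4"
proof -
  have "(a + b) ^ 4 = ((a + b)\<^sup>2)\<^sup>2" by simp
  also have "\<dots> \<le> (2 * a\<^sup>2 + 2 * b\<^sup>2)\<^sup>2" by (intro power_mono add_squared_le) auto
  also have "\<dots> \<le> 2 * (2 * a\<^sup>2)\<^sup>2 + 2 * (2 * b\<^sup>2)\<^sup>2" by (rule add_squared_le)
  finally show ?thesis by (simp add: power_mult_distrib flip: power_mult)
qed

lemma sum_squared_le_card:
  fixes x :: "'a \<Rightarrow> real"
  shows "(\<Sum>i\<in>A. x i)\<^sup>2 \<le> real (card A) * (\<Sum>i\<in>A. (x i)\<^sup>2)"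
  using Cauchy_Schwarz_ineq_sum[of "\<lambda>_. 1" x A] by simp

context quad_form begin

abbreviation N :: real where "N \<equiv> real (card I)"

lemma S_bound:
  assumes "i \<in> I" "j \<in> I"
  shows "\<bar>S i j\<bar> \<le> 1 / \<kappa>"
proof -
  define e where "e k l = (if l = k then 1 else 0 :: real)" for k l :: 'i
  have "L2_set (e k) I = 1" if "k \<in> I" for k
  proof -
    have "(\<Sum>l\<in>I. (e k l)\<^sup>2) = (\<Sum>l\<in>I. if l = k then 1 else 0)"
      by (intro sum.cong refl) (simp add: e_def)
    then show ?thesis using that fin by (simp add: L2_set_def)
  qed
  moreover have "(\<Sum>k\<in>I. \<Sum>l\<in>I. e i k * S k l * e j l) = S i j"
  proof -
    have "(\<Sum>l\<in>I. e i k * S k l * e j l) = (\<Sum>l\<in>I. if l = j then e i k * S k l else 0)" for k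
      by (intro sum.cong refl) (simp add: e_def)
    also have "\<dots> k = (if k = i then S k j else 0)" for k using assms fin by (simp add: e_def)
    finally show ?thesis using assms fin by simp
  qed
  ultimately show ?thesis using S_bilinear_bound[of "e i" "e j"] assms by simp
qed

lemma sum_abs_le_L2: "(\<Sum>i\<in>I. \<bar>x i\<bar>) \<le> sqrt N * L2_set x I"
  using L2_set_mult_ineq[of "\<lambda>_. 1" x I] by (simp add: L2_set_constant)

lemma L2_set_le_const:
  assumes "\<And>i. i \<in> I \<Longrightarrow> \<bar>x i\<bar> \<le> c"
  shows "L2_set x I \<le> sqrt N * c"
proof -
  have "L2_set x I = L2_set (\<lambda>i. \<bar>x i\<bar>) I" by (simp add: L2_set_def)
  also have "\<dots> \<le> L2_set (\<lambda>i. \<bar>c\<bar>) I"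
    using assms by (intro L2_set_mono) (auto intro: order_trans[OF _ abs_ge_self])
  also have "\<dots> = sqrt N * \<bar>c\<bar>" by (simp add: L2_set_constant)
  also have "\<dots> = sqrt N * c"
  proof (cases "I = {}")
    case False
    then obtain i where "i \<in> I" by blast
    then have "0 \<le> c" using assms[of i] by linarith
    then show ?thesis by simp
  qed simp
  finally show ?thesis .
qed

lemma expectation_sum_powers:
  "E (\<lambda>t. \<Sum>i\<in>I. t i ^ (2 * m)) \<le> N * (6 * fact (2 * m) / \<kappa> ^ m)"
proof -
  have "E (\<lambda>t. \<Sum>i\<in>I. t i ^ (2 * m)) = (\<Sum>i\<in>I. E (\<lambda>t. t i ^ (2 * m)))"
    by (intro expectation_sum exp_growth_power exp_growth_component)
  also have "\<dots> \<le> (\<Sum>i\<in>I. 6 * fact (2 * m) / \<kappa> ^ m)"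
    by (intro sum_mono component_moment)
  finally show ?thesis by simp
qed

abbreviation s4 :: "('i \<Rightarrow> real) \<Rightarrow> real" where "s4 t \<equiv> \<Sum>i\<in>I. t i ^ 4"

text \<open>Here \<open>144 = 6 * 4!\<close>, and \<open>241920 = 6 * 8!\<close> in the bounds that
  follow, from \<open>component_moment\<close>.\<close>

lemma expectation_sum_4: "E (\<lambda>t. \<Sum>i\<in>I. t i ^ 4) \<le> 144 * N / \<kappa>\<^sup>2"
  using expectation_sum_powers[of 2] by (simp add: fact_numeral mult.commute)

lemma expectation_sum_8: "E (\<lambda>t. \<Sum>i\<in>I. t i ^ 8) \<le> 241920 * N / \<kappa> ^ 4"
  using expectation_sum_powers[of 4] by (simp add: fact_numeral mult.commute)

lemma expectation_sum_4_squared: "E (\<lambda>t. (s4 t)\<^sup>2) \<le> 241920 * N\<^sup>2 / \<kappa> ^ 4"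
proof -
  have "E (\<lambda>t. (s4 t)\<^sup>2) \<le> E (\<lambda>t. N * (\<Sum>i\<in>I. t i ^ 8))"
  proof (intro integral_mono integrable_M)
    show "(s4 t)\<^sup>2 \<le> N * (\<Sum>i\<in>I. t i ^ 8)" for t
      using sum_squared_le_card[of "\<lambda>i. t i ^ 4" I] by (simp flip: power_mult)
  qed (intro exp_growth_intros; assumption)+
  also have "\<dots> = N * E (\<lambda>t. \<Sum>i\<in>I. t i ^ 8)" by simp
  also have "\<dots> \<le> N * (241920 * N / \<kappa> ^ 4)"
    by (intro mult_left_mono expectation_sum_8) auto
  finally show ?thesis by (simp add: power2_eq_square mult.left_commute)
qed

definition quartic :: "('i \<Rightarrow> 'i \<Rightarrow> real) \<Rightarrow> ('i \<Rightarrow> real) \<Rightarrow> real" where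
  "quartic \<gamma> t = 1 / 48 * (\<Sum>j\<in>I. \<Sum>k\<in>I. \<gamma> j k * (t j + t k) ^ 4)"

lemma exp_growth_quartic: "exp_growth (quartic \<gamma>)"
  unfolding quartic_def by (intro exp_growth_intros)

lemma double_sum_add: "(\<Sum>j\<in>I. \<Sum>k\<in>I. x j + x k) = 2 * N * (\<Sum>j\<in>I. x j)" for x :: "'i \<Rightarrow> real"
  by (simp add: sum.distrib mult.commute[of _ N] flip: sum_distrib_left)

lemma quartic_le:
  assumes "\<And>j k. \<bar>\<gamma> j k\<bar> \<le> 1"
  shows "\<bar>quartic \<gamma> t\<bar> \<le> N / 3 * s4 t"
proof -
  have "\<bar>\<Sum>j\<in>I. \<Sum>k\<in>I. \<gamma> j k * (t j + t k) ^ 4\<bar> \<le> (\<Sum>j\<in>I. \<Sum>k\<in>I. 8 * t j ^ 4 + 8 * t k ^ 4)"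
  proof (rule order_trans[OF sum_abs], rule sum_mono, rule order_trans[OF sum_abs], rule sum_mono)
    fix j k
    have "\<bar>\<gamma> j k * (t j + t k) ^ 4\<bar> \<le> 1 * (t j + t k) ^ 4"
      unfolding abs_mult using assms[of j k] by (intro mult_mono) auto
    then show "\<bar>\<gamma> j k * (t j + t k) ^ 4\<bar> \<le> 8 * t j ^ 4 + 8 * t k ^ 4"
      using add_power4_le[of "t j" "t k"] by linarith
  qed
  also have "\<dots> = 16 * N * s4 t"
    unfolding double_sum_add[of "\<lambda>i. 8 * t i ^ 4"] by (simp flip: sum_distrib_left)
  finally show ?thesis by (simp add: quartic_def abs_mult)
qed

text \<open>On the cube each sum of two coordinates is at most \<open>2 r\<close>, so its fourth
  power varies at rate \<open>4 * (2 r)^3\<close>; passing from the l1 to the Euclidean distance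
  costs \<open>sqrt N\<close>. For \<open>r = ln n / sqrt n\<close> and \<open>N = n\<close> all
  powers of \<open>n\<close> cancel, leaving a multiple of \<open>(ln n)^3\<close>.\<close>

lemma quartic_Lipschitz:
  assumes \<gamma>: "\<And>j k. \<bar>\<gamma> j k\<bar> \<le> 1" and r: "0 \<le> r"
    and x: "\<And>i. i \<in> I \<Longrightarrow> \<bar>x i\<bar> \<le> r" and y: "\<And>i. i \<in> I \<Longrightarrow> \<bar>y i\<bar> \<le> r"
  shows "\<bar>quartic \<gamma> x - quartic \<gamma> y\<bar> \<le> (4 / 3 * r ^ 3 * N * sqrt N) * dst x y"
proof -
  let ?u = "\<lambda>j k. \<gamma> j k * ((x j + x k) ^ 4 - (y j + y k) ^ 4)"
  define d where "d i = \<bar>x i - y i\<bar>" for i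
  have "\<bar>(\<Sum>j\<in>I. \<Sum>k\<in>I. ?u j k)\<bar>
      \<le> (\<Sum>j\<in>I. \<Sum>k\<in>I. 32 * r ^ 3 * d j + 32 * r ^ 3 * d k)"
  proof (rule order_trans[OF sum_abs], rule sum_mono, rule order_trans[OF sum_abs], rule sum_mono)
    fix j k assume jk: "j \<in> I" "k \<in> I"
    have "\<bar>?u j k\<bar> \<le> 1 * \<bar>(x j + x k) ^ 4 - (y j + y k) ^ 4\<bar>"
      unfolding abs_mult using \<gamma>[of j k] by (intro mult_mono) auto
    also have "\<dots> \<le> 4 * (2 * r) ^ 3 * \<bar>(x j + x k) - (y j + y k)\<bar>"
      using x[OF jk(1)] x[OF jk(2)] y[OF jk(1)] y[OF jk(2)]
      by (simp only: mult_1, intro abs_power4_diff_le) linarith+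
    also have "\<dots> \<le> 4 * (2 * r) ^ 3 * (d j + d k)"
      using r by (intro mult_left_mono) (auto simp: d_def)
    finally show "\<bar>?u j k\<bar> \<le> 32 * r ^ 3 * d j + 32 * r ^ 3 * d k"
      by (simp add: power_mult_distrib distrib_left)
  qed
  also have "\<dots> = 64 * r ^ 3 * N * (\<Sum>i\<in>I. d i)"
    unfolding double_sum_add[of "\<lambda>i. 32 * r ^ 3 * d i"] by (simp flip: sum_distrib_left)
  also have "\<dots> \<le> 64 * r ^ 3 * N * (sqrt N * dst x y)"
    unfolding d_def using r by (intro mult_left_mono sum_abs_le_L2) auto
  finally have "\<bar>(\<Sum>j\<in>I. \<Sum>k\<in>I. ?u j k)\<bar>
      \<le> 64 * r ^ 3 * N * (sqrt N * dst x y)" .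
  moreover have "quartic \<gamma> x - quartic \<gamma> y
      = 1 / 48 * (\<Sum>j\<in>I. \<Sum>k\<in>I. ?u j k)"
    by (simp add: quartic_def right_diff_distrib sum_subtractf diff_divide_distrib)
  ultimately have "\<bar>quartic \<gamma> x - quartic \<gamma> y\<bar> \<le> 1 / 48 * (64 * r ^ 3 * N * (sqrt N * dst x y))"
    by (simp only: abs_mult)
  then show ?thesis by (simp add: mult_ac)
qed

lemma expectation_abs_quartic:
  assumes "\<And>j k. \<bar>\<gamma> j k\<bar> \<le> 1"
  shows "E (\<lambda>t. \<bar>quartic \<gamma> t\<bar>) \<le> 48 * (N / \<kappa>)\<^sup>2"
proof -
  have "E (\<lambda>t. \<bar>quartic \<gamma> t\<bar>) \<le> E (\<lambda>t. N / 3 * s4 t)"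
    by (intro integral_mono integrable_M exp_growth_abs exp_growth_quartic quartic_le assms exp_growth_intros)
  also have "\<dots> \<le> N / 3 * (144 * N / \<kappa>\<^sup>2)"
    unfolding integral_mult_right_zero by (intro mult_left_mono expectation_sum_4) auto
  finally show ?thesis by (simp add: power_divide power2_eq_square)
qed

lemma quartic_concentration:
  assumes \<gamma>: "\<And>j k. \<bar>\<gamma> j k\<bar> \<le> 1" and r: "0 \<le> r"
  defines "L \<equiv> 4 / 3 * r ^ 3 * N * sqrt N"
  shows "Lip L (\<lambda>t. quartic \<gamma> (clip r t))"
    and "\<And>t. (\<And>i. i \<in> I \<Longrightarrow> \<bar>t i\<bar> \<le> r) \<Longrightarrow> quartic \<gamma> (clip r t) = quartic \<gamma> t"
    and "\<bar>E (\<lambda>t. quartic \<gamma> (clip r t)) - E (quartic \<gamma>)\<bar>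
      \<le> 2 * sqrt (26880 * (N / \<kappa>) ^ 4 * tail r)"
proof -
  define b where "b t = N / 3 * s4 t" for t :: "'i \<Rightarrow> real"
  have b: "exp_growth b" unfolding b_def by (intro exp_growth_intros)
  have L: "L \<ge> 0" using r by (simp add: L_def)
  have le: "\<bar>quartic \<gamma> t\<bar> \<le> b t" for t unfolding b_def by (rule quartic_le[OF \<gamma>])
  \<comment> \<open>The dominating function is increasing in the absolute value of each coordinate,
    so it dominates the clipped quartic too.\<close>
  have "b (clip r t) \<le> b t" for t
    unfolding b_def using clip_abs_le[OF r]
    by (intro mult_left_mono sum_mono) (auto intro!: power_mono_even)
  then have le2: "\<bar>quartic \<gamma> (clip r t)\<bar> \<le> b t" for t using le[of "clip r t"] by (meson order_trans)
  have "E (\<lambda>t. (b t)\<^sup>2) = (N / 3)\<^sup>2 * E (\<lambda>t. (s4 t)\<^sup>2)"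
    unfolding b_def power_mult_distrib by simp
  also have "\<dots> \<le> (N / 3)\<^sup>2 * (241920 * N\<^sup>2 / \<kappa> ^ 4)"
    by (intro mult_left_mono expectation_sum_4_squared) auto
  also have "\<dots> = 26880 * (N / \<kappa>) ^ 4" by (simp add: power2_eq_square power4_eq_xxxx)
  finally have K: "E (\<lambda>t. (b t)\<^sup>2) \<le> 26880 * (N / \<kappa>) ^ 4" .
  have lip: "\<bar>quartic \<gamma> x - quartic \<gamma> y\<bar> \<le> L * dst x y"
    if "\<And>i. i \<in> I \<Longrightarrow> \<bar>x i\<bar> \<le> r" "\<And>i. i \<in> I \<Longrightarrow> \<bar>y i\<bar> \<le> r" for x y
    unfolding L_def by (rule quartic_Lipschitz[OF \<gamma> r that])
  note main = clip_concentration[OF r L exp_growth_quartic b le le2 lip K]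
  show "Lip L (\<lambda>t. quartic \<gamma> (clip r t))" by (rule main(1))
  show "\<And>t. (\<And>i. i \<in> I \<Longrightarrow> \<bar>t i\<bar> \<le> r) \<Longrightarrow> quartic \<gamma> (clip r t) = quartic \<gamma> t" by (rule main(2))
  show "\<bar>E (\<lambda>t. quartic \<gamma> (clip r t)) - E (quartic \<gamma>)\<bar>
      \<le> 2 * sqrt (26880 * (N / \<kappa>) ^ 4 * tail r)" by (rule main(3))
qed

end

context cubic_form begin

lemma \<rho>_bound:
  assumes "j \<in> I"
  shows "\<bar>\<rho> j\<bar> \<le> 4 * N / \<kappa>"
proof -
  have "\<bar>\<rho> j\<bar> \<le> (\<Sum>k\<in>I. 4 * (1 / \<kappa>))"
    unfolding \<rho>_def
  proof (rule order_trans[OF sum_abs], rule sum_mono)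
    fix k assume k: "k \<in> I"
    have "\<bar>S j j + 2 * S j k + S k k\<bar> \<le> 4 * (1 / \<kappa>)"
      using S_bound[OF assms assms] S_bound[OF assms k] S_bound[OF k k] by linarith
    then show "\<bar>\<beta> j k * (S j j + 2 * S j k + S k k)\<bar> \<le> 4 * (1 / \<kappa>)"
      unfolding abs_mult using \<beta>_bound[of j k] mult_mono[of "\<bar>\<beta> j k\<bar>" 1] by fastforce
  qed
  then show ?thesis by (simp add: mult.commute)
qed

lemma grad_L2_squared: "(\<Sum>j\<in>I. (grad j t)\<^sup>2) \<le> 4 * N\<^sup>2 * s4 t"
proof -
  have "(grad j t)\<^sup>2 \<le> N / 4 * (\<Sum>k\<in>I. 8 * t j ^ 4 + 8 * t k ^ 4)" for j
  proof -
    have "(grad j t)\<^sup>2 = 1 / 4 * (\<Sum>k\<in>I. \<beta> j k * (t j + t k)\<^sup>2)\<^sup>2"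
      by (simp add: grad_def power_divide)
    also have "\<dots> \<le> 1 / 4 * (N * (\<Sum>k\<in>I. (\<beta> j k * (t j + t k)\<^sup>2)\<^sup>2))"
      by (intro mult_left_mono sum_squared_le_card) auto
    also have "\<dots> \<le> 1 / 4 * (N * (\<Sum>k\<in>I. 8 * t j ^ 4 + 8 * t k ^ 4))"
    proof (intro mult_left_mono sum_mono)
      fix k
      have "(\<beta> j k * (t j + t k)\<^sup>2)\<^sup>2 \<le> 1 * (t j + t k) ^ 4"
        unfolding power_mult_distrib using \<beta>_bound[of j k]
        by (intro mult_mono) (auto simp: abs_square_le_1 simp flip: power_mult)
      then show "(\<beta> j k * (t j + t k)\<^sup>2)\<^sup>2 \<le> 8 * t j ^ 4 + 8 * t k ^ 4"
        using add_power4_le[of "t j" "t k"] by linarith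
    qed auto
    finally show ?thesis by simp
  qed
  then have "(\<Sum>j\<in>I. (grad j t)\<^sup>2) \<le> (\<Sum>j\<in>I. N / 4 * (\<Sum>k\<in>I. 8 * t j ^ 4 + 8 * t k ^ 4))"
    by (intro sum_mono)
  also have "\<dots> = N / 4 * (\<Sum>j\<in>I. \<Sum>k\<in>I. 8 * t j ^ 4 + 8 * t k ^ 4)"
    by (simp only: sum_distrib_left)
  also have "\<dots> = 4 * N\<^sup>2 * s4 t"
    unfolding double_sum_add[of "\<lambda>i. 8 * t i ^ 4"] by (simp add: power2_eq_square flip: sum_distrib_left)
  finally show ?thesis .
qed

text \<open>The operator bound on \<open>S\<close> and \<open>2 x y <= x^2 + y^2\<close> reduce
  \<open>\<Gamma>\<close> to squared norms of gradients. The right-hand side is increasing in each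
  absolute coordinate, as the clipping argument requires.\<close>

lemma \<Gamma>_le: "\<bar>\<Gamma> t\<bar> \<le> 2 * N\<^sup>2 / \<kappa> * s4 t + 6 * (N / \<kappa>) ^ 3"
proof -
  define p where "p j = grad j t + \<rho> j" for j
  define a where "a = (\<Sum>j\<in>I. (grad j t)\<^sup>2)"
  have "(\<Sum>j\<in>I. (p j)\<^sup>2) \<le> (\<Sum>j\<in>I. 2 * (grad j t)\<^sup>2 + 2 * (4 * N / \<kappa>)\<^sup>2)"
  proof (rule sum_mono)
    fix j assume "j \<in> I"
    then have "(\<rho> j)\<^sup>2 \<le> (4 * N / \<kappa>)\<^sup>2"
      using \<rho>_bound power_mono[of "\<bar>\<rho> j\<bar>" "4 * N / \<kappa>" 2] by simp
    then show "(p j)\<^sup>2 \<le> 2 * (grad j t)\<^sup>2 + 2 * (4 * N / \<kappa>)\<^sup>2"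
      using add_squared_le[of "grad j t" "\<rho> j"] by (simp add: p_def)
  qed
  also have "\<dots> = 2 * a + 32 * N ^ 3 / \<kappa>\<^sup>2"
    by (simp add: a_def sum.distrib power2_eq_square power3_eq_cube flip: sum_distrib_left)
  finally have p: "(\<Sum>j\<in>I. (p j)\<^sup>2) \<le> 2 * a + 32 * N ^ 3 / \<kappa>\<^sup>2" .
  have "L2_set p I * L2_set (\<lambda>j. grad j t) I \<le> ((L2_set p I)\<^sup>2 + (L2_set (\<lambda>j. grad j t) I)\<^sup>2) / 2"
    using sum_squares_bound[of "L2_set p I" "L2_set (\<lambda>j. grad j t) I"] by simp
  also have "\<dots> = ((\<Sum>j\<in>I. (p j)\<^sup>2) + a) / 2"
    by (simp add: L2_set_def sum_nonneg a_def)
  also have "\<dots> \<le> (3 * a + 32 * N ^ 3 / \<kappa>\<^sup>2) / 2" using p by simp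
  also have "\<dots> \<le> (3 * (4 * N\<^sup>2 * s4 t) + 32 * N ^ 3 / \<kappa>\<^sup>2) / 2"
    using grad_L2_squared[of t] by (simp add: a_def)
  finally have *: "L2_set p I * L2_set (\<lambda>j. grad j t) I
    \<le> 6 * N\<^sup>2 * s4 t + 16 * N ^ 3 / \<kappa>\<^sup>2" by simp
  have "\<bar>\<Gamma> t\<bar> \<le> 1 / 3 * (L2_set p I * L2_set (\<lambda>j. grad j t) I / \<kappa>)"
    using S_bilinear_bound[of p "\<lambda>j. grad j t"] by (simp add: \<Gamma>_def p_def abs_mult)
  also have "\<dots> \<le> 1 / 3 * ((6 * N\<^sup>2 * s4 t + 16 * N ^ 3 / \<kappa>\<^sup>2) / \<kappa>)"
    using * \<kappa>_pos by (intro mult_left_mono divide_right_mono) auto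
  also have "\<dots> = 2 * N\<^sup>2 / \<kappa> * s4 t + 16 / 3 * (N / \<kappa>) ^ 3"
    using \<kappa>_pos by (simp add: field_simps power2_eq_square power3_eq_cube)
  \<comment> \<open>\<open>16 / 3\<close> is rounded up to 6.\<close>
  also have "\<dots> \<le> 2 * N\<^sup>2 / \<kappa> * s4 t + 6 * (N / \<kappa>) ^ 3"
    using \<kappa>_pos by (intro add_left_mono mult_right_mono) auto
  finally show ?thesis .
qed

text \<open>The difference splits into two bilinear terms in \<open>S\<close>, each with one factor
  \<open>e\<close>, the increment of the gradient. The operator norm is essential: bounding the
  entries of \<open>S\<close> one by one would lose a factor \<open>N\<close>. For
  \<open>r = ln n / sqrt n\<close> and \<open>\<kappa>\<close> of order \<open>n\<close> the
  constant is polylogarithmic.\<close>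

lemma \<Gamma>_Lipschitz:
  assumes r: "0 \<le> r" and x: "\<And>i. i \<in> I \<Longrightarrow> \<bar>x i\<bar> \<le> r" and y: "\<And>i. i \<in> I \<Longrightarrow> \<bar>y i\<bar> \<le> r"
  shows "\<bar>\<Gamma> x - \<Gamma> y\<bar> \<le> (16 / 3 * N\<^sup>2 * sqrt N * r * (r\<^sup>2 + 1 / \<kappa>) / \<kappa>) * dst x y"
proof -
  let ?u = "\<lambda>j k. \<beta> j k * ((x j + x k)\<^sup>2 - (y j + y k)\<^sup>2)"
  define d where "d i = x i - y i" for i
  define D where "D = L2_set d I"
  define e where "e j = grad j x - grad j y" for j
  have e: "\<bar>e j\<bar> \<le> 2 * r * (N * \<bar>d j\<bar> + (\<Sum>k\<in>I. \<bar>d k\<bar>))" if j: "j \<in> I" for j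
  proof -
    have "\<bar>\<Sum>k\<in>I. ?u j k\<bar> \<le> (\<Sum>k\<in>I. 4 * r * (\<bar>d j\<bar> + \<bar>d k\<bar>))"
    proof (rule order_trans[OF sum_abs], rule sum_mono)
      fix k assume k: "k \<in> I"
      have "\<bar>?u j k\<bar> \<le> 1 * \<bar>(x j + x k)\<^sup>2 - (y j + y k)\<^sup>2\<bar>"
        unfolding abs_mult using \<beta>_bound[of j k] by (intro mult_mono) auto
      also have "\<dots> \<le> 2 * (2 * r) * \<bar>(x j + x k) - (y j + y k)\<bar>"
        using x[OF j] x[OF k] y[OF j] y[OF k]
        by (simp only: mult_1, intro abs_square_diff_le) linarith+
      also have "\<dots> \<le> 2 * (2 * r) * (\<bar>d j\<bar> + \<bar>d k\<bar>)"
        using r by (intro mult_left_mono) (auto simp: d_def)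
      finally show "\<bar>?u j k\<bar> \<le> 4 * r * (\<bar>d j\<bar> + \<bar>d k\<bar>)" by simp
    qed
    also have "\<dots> = 4 * r * (N * \<bar>d j\<bar> + (\<Sum>k\<in>I. \<bar>d k\<bar>))"
      by (simp add: sum.distrib flip: sum_distrib_left)
    finally have "\<bar>\<Sum>k\<in>I. ?u j k\<bar> \<le> 4 * r * (N * \<bar>d j\<bar> + (\<Sum>k\<in>I. \<bar>d k\<bar>))" .
    moreover have "e j = 1 / 2 * (\<Sum>k\<in>I. ?u j k)"
      by (simp add: e_def grad_def right_diff_distrib sum_subtractf diff_divide_distrib)
    ultimately show ?thesis by (simp add: abs_mult)
  qed
  have "L2_set e I = L2_set (\<lambda>j. \<bar>e j\<bar>) I" by (simp add: L2_set_def)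
  also have "\<dots> \<le> L2_set (\<lambda>j. (2 * r * N) * \<bar>d j\<bar> + 2 * r * (\<Sum>k\<in>I. \<bar>d k\<bar>)) I"
    using e by (intro L2_set_mono) (auto simp: algebra_simps)
  also have "\<dots> \<le> L2_set (\<lambda>j. (2 * r * N) * \<bar>d j\<bar>) I + L2_set (\<lambda>j. 2 * r * (\<Sum>k\<in>I. \<bar>d k\<bar>)) I"
    by (rule L2_set_triangle_ineq)
  also have "L2_set (\<lambda>j. (2 * r * N) * \<bar>d j\<bar>) I = 2 * r * N * D"
    using r by (simp add: D_def L2_set_def power_mult_distrib real_sqrt_mult flip: sum_distrib_left)
  also have "L2_set (\<lambda>j. 2 * r * (\<Sum>k\<in>I. \<bar>d k\<bar>)) I = sqrt N * (2 * r * (\<Sum>k\<in>I. \<bar>d k\<bar>))"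
    using r by (simp add: L2_set_constant abs_mult sum_nonneg)
  also have "\<dots> \<le> sqrt N * (2 * r * (sqrt N * D))"
    unfolding D_def using r by (intro mult_left_mono sum_abs_le_L2) auto
  also have "\<dots> = 2 * r * N * D" by simp
  finally have e2: "L2_set e I \<le> 4 * r * N * D" by (simp add: mult_ac)
  have g: "\<bar>grad j t\<bar> \<le> 2 * N * r\<^sup>2" if j: "j \<in> I" and t: "\<And>i. i \<in> I \<Longrightarrow> \<bar>t i\<bar> \<le> r" for j t
  proof -
    have "\<bar>\<Sum>k\<in>I. \<beta> j k * (t j + t k)\<^sup>2\<bar> \<le> (\<Sum>k\<in>I. 4 * r\<^sup>2)"
    proof (rule order_trans[OF sum_abs], rule sum_mono)
      fix k assume k: "k \<in> I"
      have "\<bar>t j + t k\<bar> \<le> 2 * r" using t[OF j] t[OF k] by linarith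
      then have "(t j + t k)\<^sup>2 \<le> (2 * r)\<^sup>2" using power_mono[of "\<bar>t j + t k\<bar>" "2 * r" 2] by simp
      then show "\<bar>\<beta> j k * (t j + t k)\<^sup>2\<bar> \<le> 4 * r\<^sup>2"
        unfolding abs_mult using \<beta>_bound[of j k] mult_mono[of "\<bar>\<beta> j k\<bar>" 1 "(t j + t k)\<^sup>2" "(2 * r)\<^sup>2"]
        by (simp add: power_mult_distrib)
    qed
    then show ?thesis by (simp add: grad_def abs_mult)
  qed
  have gx: "L2_set (\<lambda>j. grad j x) I \<le> sqrt N * (2 * N * r\<^sup>2)"
    by (intro L2_set_le_const g x)
  have gy: "L2_set (\<lambda>j. grad j y + \<rho> j) I \<le> sqrt N * (2 * N * r\<^sup>2 + 4 * N / \<kappa>)"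
  proof (rule L2_set_le_const)
    fix j assume "j \<in> I"
    then show "\<bar>grad j y + \<rho> j\<bar> \<le> 2 * N * r\<^sup>2 + 4 * N / \<kappa>"
      using g[of j y] y \<rho>_bound[of j] by (smt (verit))
  qed
  have D: "D \<ge> 0" by (simp add: D_def)
  have split: "\<Gamma> x - \<Gamma> y = 1 / 3 * ((\<Sum>j\<in>I. \<Sum>i\<in>I. e j * S j i * grad i x)
      + (\<Sum>j\<in>I. \<Sum>i\<in>I. (grad j y + \<rho> j) * S j i * e i))"
    unfolding \<Gamma>_def right_diff_distrib[symmetric] sum_subtractf[symmetric] sum.distrib[symmetric]
    by (intro arg_cong[where f="\<lambda>x. 1 / 3 * x"] sum.cong refl) (simp add: e_def algebra_simps)
  have third: "\<bar>1 / 3 * (u + v)\<bar> \<le> 1 / 3 * (u' + v')" if "\<bar>u\<bar> \<le> u'" "\<bar>v\<bar> \<le> v'" for u v u' v' :: real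
    using that by (simp add: abs_mult)
  have "\<bar>\<Gamma> x - \<Gamma> y\<bar> \<le> 1 / 3 * (L2_set e I * L2_set (\<lambda>j. grad j x) I / \<kappa>
      + L2_set (\<lambda>j. grad j y + \<rho> j) I * L2_set e I / \<kappa>)"
    unfolding split by (rule third; rule S_bilinear_bound)
  also have "\<dots> \<le> 1 / 3 * ((4 * r * N * D) * (sqrt N * (2 * N * r\<^sup>2)) / \<kappa>
      + (sqrt N * (2 * N * r\<^sup>2 + 4 * N / \<kappa>)) * (4 * r * N * D) / \<kappa>)"
    using \<kappa>_pos r D e2 gx gy
    by (intro mult_left_mono add_mono divide_right_mono mult_mono) auto
  also have "\<dots> = (16 / 3 * N\<^sup>2 * sqrt N * r * (r\<^sup>2 + 1 / \<kappa>) / \<kappa>) * D"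
    using \<kappa>_pos by (simp add: field_simps power2_eq_square)
  finally show ?thesis by (simp add: D_def d_def[abs_def])
qed

lemma \<Gamma>_bounds:
  defines "b \<equiv> \<lambda>t. 2 * N\<^sup>2 / \<kappa> * s4 t + 6 * (N / \<kappa>) ^ 3"
  shows "exp_growth b" "E b \<le> 294 * (N / \<kappa>) ^ 3"
    "E (\<lambda>t. (b t)\<^sup>2) \<le> 2000000 * (N / \<kappa>) ^ 6"
proof -
  define s where "s t = s4 t" for t :: "'i \<Rightarrow> real"
  define a c where "a = 2 * N\<^sup>2 / \<kappa>" and "c = 6 * (N / \<kappa>) ^ 3"
  have ac: "a \<ge> 0" "c \<ge> 0" using \<kappa>_pos by (auto simp: a_def c_def)
  have b_def': "b = (\<lambda>t. a * s t + c)" by (simp add: b_def a_def c_def s_def)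
  have s: "exp_growth s" unfolding s_def by (intro exp_growth_intros)
  show b: "exp_growth b" unfolding b_def' by (intro exp_growth_add exp_growth_cmult s exp_growth_const)
  have "E b = a * E s + c"
    unfolding b_def' using integrable_M[OF s] by (simp add: prob_space)
  also have "\<dots> \<le> a * (144 * N / \<kappa>\<^sup>2) + c"
    using expectation_sum_4 ac unfolding s_def by (intro add_right_mono mult_left_mono) auto
  \<comment> \<open>\<open>294 = 2 * 144 + 6\<close>.\<close>
  also have "\<dots> = 294 * (N / \<kappa>) ^ 3"
    using \<kappa>_pos by (simp add: a_def c_def power2_eq_square power3_eq_cube field_simps)
  finally show "E b \<le> 294 * (N / \<kappa>) ^ 3" .
  have "E (\<lambda>t. (b t)\<^sup>2) \<le> E (\<lambda>t. 2 * a\<^sup>2 * (s t)\<^sup>2 + 2 * c\<^sup>2)"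
  proof (intro integral_mono integrable_M exp_growth_power b exp_growth_add exp_growth_cmult s exp_growth_const)
    show "(b t)\<^sup>2 \<le> 2 * a\<^sup>2 * (s t)\<^sup>2 + 2 * c\<^sup>2" for t
      using add_squared_le[of "a * s t" c] by (simp add: b_def' power_mult_distrib)
  qed
  also have "\<dots> = 2 * a\<^sup>2 * E (\<lambda>t. (s t)\<^sup>2) + 2 * c\<^sup>2"
    using integrable_M[OF exp_growth_power[OF s, of 2]] by (simp add: prob_space)
  also have "\<dots> \<le> 2 * a\<^sup>2 * (241920 * N\<^sup>2 / \<kappa> ^ 4) + 2 * c\<^sup>2"
    using expectation_sum_4_squared unfolding s_def by (intro add_right_mono mult_left_mono) auto
  \<comment> \<open>\<open>1935432 = 2 * 4 * 241920 + 2 * 36\<close>, rounded up afterwards.\<close>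
  also have "\<dots> = 1935432 * (N / \<kappa>) ^ 6"
    using \<kappa>_pos by (simp add: a_def c_def power_divide power_mult_distrib field_simps flip: power_mult power_add power_Suc)
  also have "\<dots> \<le> 2000000 * (N / \<kappa>) ^ 6" by (intro mult_right_mono) auto
  finally show "E (\<lambda>t. (b t)\<^sup>2) \<le> 2000000 * (N / \<kappa>) ^ 6" .
qed

lemma expectation_cub_squared: "E (\<lambda>t. (cub t)\<^sup>2) \<le> 294 * (N / \<kappa>) ^ 3"
  unfolding expectation_\<Gamma>
  by (rule order_trans[OF integral_mono \<Gamma>_bounds(2)])
     (intro integrable_M exp_growth_\<Gamma> \<Gamma>_bounds(1) order_trans[OF abs_ge_self \<Gamma>_le])+

theorem cub_clt_quantitative:
  assumes r: "0 \<le> r"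
  defines "L \<equiv> 16 / 3 * N\<^sup>2 * sqrt N * r * (r\<^sup>2 + 1 / \<kappa>) / \<kappa>"
  shows "cmod (E (\<lambda>t. iexp (cub t)) - exp (- E (\<lambda>t. (cub t)\<^sup>2) / 2))
    \<le> 4 * sqrt (2000000 * (N / \<kappa>) ^ 6 * tail r) + 2 * sqrt (exp (L\<^sup>2 / \<kappa>) - 1)"
proof -
  define b where "b t = 2 * N\<^sup>2 / \<kappa> * s4 t + 6 * (N / \<kappa>) ^ 3" for t :: "'i \<Rightarrow> real"
  have b: "exp_growth b" and K: "E (\<lambda>t. (b t)\<^sup>2) \<le> 2000000 * (N / \<kappa>) ^ 6"
    using \<Gamma>_bounds unfolding b_def by auto
  have L: "L \<ge> 0" using r \<kappa>_pos by (simp add: L_def)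
  have le: "\<bar>\<Gamma> t\<bar> \<le> b t" for t unfolding b_def by (rule \<Gamma>_le)
  have "b (clip r t) \<le> b t" for t
    unfolding b_def using clip_abs_le[OF r] \<kappa>_pos
    by (intro add_right_mono mult_left_mono sum_mono) (auto intro!: power_mono_even)
  then have le2: "\<bar>\<Gamma> (clip r t)\<bar> \<le> b t" for t using le[of "clip r t"] by (meson order_trans)
  have lip: "\<bar>\<Gamma> x - \<Gamma> y\<bar> \<le> L * dst x y"
    if "\<And>i. i \<in> I \<Longrightarrow> \<bar>x i\<bar> \<le> r" "\<And>i. i \<in> I \<Longrightarrow> \<bar>y i\<bar> \<le> r" for x y
    unfolding L_def by (rule \<Gamma>_Lipschitz[OF r that])
  show ?thesis
    using cub_clt clip_concentration(4)[OF r L exp_growth_\<Gamma> b le le2 lip K]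
    unfolding expectation_\<Gamma> by (rule order_trans)
qed

end

section \<open>The logarithm of the Bernoulli characteristic function\<close>

text \<open>Taylor expansion at 0 of the cumulant generating function of a centred Bernoulli
  variable, evaluated at \<open>i x\<close>. The powers of \<open>i\<close> give the quadratic and
  quartic terms real values and make the cubic term imaginary.\<close>

lemma bernoulli_log_char:
  fixes \<zeta> x :: real
  assumes \<zeta>: "0 \<le> \<zeta>" "\<zeta> \<le> 1" and x: "\<bar>x\<bar> \<le> 1 / 4"
  shows "\<exists>w. cmod w \<le> 2000 * \<bar>x\<bar> ^ 5 \<and>
    exp (- \<i> * of_real (\<zeta> * x)) * (1 - of_real \<zeta> + of_real \<zeta> * exp (\<i> * of_real x))
      = exp (of_real (- (\<zeta> * (1 - \<zeta>) * x\<^sup>2 / 2)) + \<i> * of_real (\<zeta> * (1 - \<zeta>) * (2 * \<zeta> - 1) * x ^ 3 / 6)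
          + of_real (\<zeta> * (1 - \<zeta>) * (6 * \<zeta>\<^sup>2 - 6 * \<zeta> + 1) * x ^ 4 / 24) + w)"
proof -
  define c where "c = complex_of_real \<zeta>"
  define u where "u z = 1 - c + c * exp z" for z
  define p where "p z = c * exp z / u z" for z
  \<comment> \<open>Derivatives of the cumulant generating function; they are polynomials in \<open>p\<close> as \<open>p' = p (1 - p)\<close>.\<close>
  define D where "D k z = (if k = 0 then Ln (u z) - c * z else if k = 1 then p z - c
    else if k = 2 then p z * (1 - p z) else if k = 3 then p z * (1 - p z) * (1 - 2 * p z)
    else if k = 4 then p z * (1 - p z) * (1 - 6 * p z + 6 * (p z)\<^sup>2)
    else p z * (1 - p z) * (1 - 2 * p z) * (1 - 12 * p z + 12 * (p z)\<^sup>2))" for k :: nat and z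
  \<comment> \<open>The radius keeps \<open>u\<close> within \<open>1 / 2\<close> of 1. There the
    principal logarithm is holomorphic and \<open>p\<close> is bounded.\<close>
  define s where "s = cball (0 :: complex) (1 / 4)"
  have cn: "cmod c \<le> 1" using \<zeta> by (simp add: c_def)
  have eb: "cmod (exp z) \<le> 2" if "z \<in> s" for z
    using that exp_bound_half[of z] by (simp add: s_def)
  have near: "cmod (u z - 1) \<le> 1 / 2" if "z \<in> s" for z
  proof -
    have z: "cmod z \<le> 1 / 4" using that by (simp add: s_def)
    have "cmod (exp z - (\<Sum>k\<le>0. z ^ k / fact k)) \<le> exp \<bar>Re z\<bar> * cmod z ^ Suc 0 / fact 0"
      by (rule Taylor_exp)
    also have "\<dots> \<le> 2 * (1 / 4)"
    proof -
      have "\<bar>Re z\<bar> \<le> 1 / 4" using abs_Re_le_cmod[of z] z by linarith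
      then have "exp \<bar>Re z\<bar> \<le> 2" using exp_bound_half[of "\<bar>Re z\<bar>"] by simp
      then have "exp \<bar>Re z\<bar> * cmod z \<le> 2 * (1 / 4)" using z by (intro mult_mono) auto
      then show ?thesis by simp
    qed
    finally have "cmod (exp z - 1) \<le> 1 / 2" by simp
    moreover have "u z - 1 = c * (exp z - 1)" by (simp add: u_def algebra_simps)
    ultimately show ?thesis
      using mult_mono[OF cn, of "cmod (exp z - 1)" "1 / 2"] by (simp add: norm_mult)
  qed
  have Re_u: "Re (u z) > 0" if "z \<in> s" for z
    using near[OF that] abs_Re_le_cmod[of "u z - 1"] by simp
  have u_ge: "cmod (u z) \<ge> 1 / 2" if "z \<in> s" for z
    using near[OF that] norm_triangle_ineq2[of 1 "u z"] by (simp add: norm_minus_commute)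
  have u0: "u z \<noteq> 0" if "z \<in> s" for z using Re_u[OF that] by auto
  have p_le: "cmod (p z) \<le> 4" if "z \<in> s" for z
  proof -
    have "cmod (c * exp z) \<le> 1 * 2" unfolding norm_mult using cn eb[OF that] by (intro mult_mono) auto
    then have "cmod (p z) \<le> (1 * 2) / (1 / 2)"
      unfolding p_def norm_divide using u_ge[OF that] by (intro frac_le) auto
    then show ?thesis by simp
  qed
  have du: "(u has_field_derivative c * exp z) (at z within s)" for z
    unfolding u_def by (auto intro!: derivative_eq_intros)
  have dp: "(p has_field_derivative p z * (1 - p z)) (at z within s)" if "z \<in> s" for z
  proof -
    have "(p has_field_derivative (c * exp z * u z - c * exp z * (c * exp z)) / (u z * u z)) (at z within s)"
      unfolding p_def[abs_def] using du u0[OF that] by (auto intro!: derivative_eq_intros)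
    also have "(c * exp z * u z - c * exp z * (c * exp z)) / (u z * u z) = p z * (1 - p z)"
      using u0[OF that] by (simp add: p_def field_simps)
    finally show ?thesis .
  qed
  have "cmod (D 0 (\<i> * x) - (\<Sum>i\<le>4. D i 0 * (\<i> * x - 0) ^ i / fact i)) \<le> 48000 * cmod (\<i> * x - 0) ^ Suc 4 / fact 4"
  proof (rule complex_Taylor[where S=s])
    show "convex s" by (simp add: s_def)
    show "0 \<in> s" "\<i> * complex_of_real x \<in> s" using x by (auto simp: s_def norm_mult)
    fix z assume z: "z \<in> s"
    show "(D i has_field_derivative D (Suc i) z) (at z within s)" if "i \<le> 4" for i
    proof -
      have d0: "((\<lambda>z. Ln (u z) - c * z) has_field_derivative p z - c) (at z within s)"
        using du[of z] Re_u[OF z] complex_nonpos_Reals_iff[of "u z"]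
        by (auto intro!: derivative_eq_intros simp: p_def field_simps)
      have d1: "((\<lambda>z. p z - c) has_field_derivative p z * (1 - p z)) (at z within s)"
        by (auto intro!: derivative_eq_intros dp[OF z])
      have d2: "((\<lambda>z. p z * (1 - p z)) has_field_derivative p z * (1 - p z) * (1 - 2 * p z)) (at z within s)"
        by (auto intro!: derivative_eq_intros dp[OF z] simp: algebra_simps)
      have d3: "((\<lambda>z. p z * (1 - p z) * (1 - 2 * p z)) has_field_derivative
          p z * (1 - p z) * (1 - 6 * p z + 6 * (p z)\<^sup>2)) (at z within s)"
        by (rule DERIV_cong[OF DERIV_mult[OF d2 DERIV_diff[OF DERIV_const DERIV_cmult[OF dp[OF z], of 2], of 1]]])
           (simp add: algebra_simps power2_eq_square)
      have d4: "((\<lambda>z. p z * (1 - p z) * (1 - 6 * p z + 6 * (p z)\<^sup>2)) has_field_derivative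
          p z * (1 - p z) * (1 - 2 * p z) * (1 - 12 * p z + 12 * (p z)\<^sup>2)) (at z within s)"
        by (auto intro!: derivative_eq_intros dp[OF z] simp: algebra_simps power2_eq_square)
      have "i = 0 \<or> i = 1 \<or> i = 2 \<or> i = 3 \<or> i = 4" using that by arith
      then show ?thesis
        using d0 d1 d2 d3 d4 by (elim disjE) (simp_all add: D_def[abs_def])
    qed
    have "cmod (1 - p z) \<le> 5" "cmod (1 - 2 * p z) \<le> 9" "cmod (1 - 12 * p z + 12 * (p z)\<^sup>2) \<le> 241"
    proof -
      have p2: "cmod ((p z)\<^sup>2) \<le> 16"
        using power_mono[OF p_le[OF z], of 2] by (simp add: norm_power)
      show "cmod (1 - p z) \<le> 5" using norm_triangle_ineq4[of 1 "p z"] p_le[OF z] by simp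
      show "cmod (1 - 2 * p z) \<le> 9" using norm_triangle_ineq4[of 1 "2 * p z"] p_le[OF z] by (simp add: norm_mult)
      show "cmod (1 - 12 * p z + 12 * (p z)\<^sup>2) \<le> 241"
        using norm_triangle_ineq[of "1 - 12 * p z" "12 * (p z)\<^sup>2"] norm_triangle_ineq4[of 1 "12 * p z"] p_le[OF z] p2
        by (simp add: norm_mult)
    qed
    \<comment> \<open>The product \<open>4 * 5 * 9 * 241 = 43380\<close> is rounded up to
      \<open>48000 = 2000 * 4!\<close>; the Taylor remainder divides by
      \<open>fact 4\<close>.\<close>
    then have "cmod (p z) * cmod (1 - p z) * cmod (1 - 2 * p z) * cmod (1 - 12 * p z + 12 * (p z)\<^sup>2)
        \<le> 4 * 5 * 9 * 241"
      using p_le[OF z] by (intro mult_mono) auto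
    then show "cmod (D (Suc 4) z) \<le> 48000" by (simp add: D_def norm_mult)
  qed
  moreover have "48000 * cmod (\<i> * x - 0) ^ Suc 4 / fact 4 = 2000 * \<bar>x\<bar> ^ 5"
    by (simp add: norm_mult fact_numeral)
  moreover have p0: "p 0 = c" by (simp add: p_def u_def)
  have "(\<Sum>i\<le>4. D i 0 * (\<i> * x - 0) ^ i / fact i)
     = of_real (- (\<zeta> * (1 - \<zeta>) * x\<^sup>2 / 2)) + \<i> * of_real (\<zeta> * (1 - \<zeta>) * (2 * \<zeta> - 1) * x ^ 3 / 6)
          + of_real (\<zeta> * (1 - \<zeta>) * (6 * \<zeta>\<^sup>2 - 6 * \<zeta> + 1) * x ^ 4 / 24)" (is "?T = ?P")
  proof -
    \<comment> \<open>The first-order term vanishes as well since \<open>p 0 = c\<close>, the effect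
      of centring by \<open>exp (- i \<zeta> x)\<close>.\<close>
    have "D 0 0 = 0" by (simp add: D_def u_def)
    then have "?T = c * (1 - c) * (\<i> * x)\<^sup>2 / 2 + c * (1 - c) * (1 - 2 * c) * (\<i> * x) ^ 3 / 6
        + c * (1 - c) * (1 - 6 * c + 6 * c\<^sup>2) * (\<i> * x) ^ 4 / 24"
      by (simp add: eval_nat_numeral(2) numeral_eq_Suc D_def p0 fact_numeral)
    also have "\<dots> = ?P"
      by (simp add: c_def power_mult_distrib power3_eq_cube power4_eq_xxxx field_simps)
    finally show ?thesis .
  qed
  ultimately have bd: "cmod (D 0 (\<i> * x) - ?P) \<le> 2000 * \<bar>x\<bar> ^ 5" by simp
  have xs: "\<i> * complex_of_real x \<in> s" using x by (auto simp: s_def norm_mult)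
  have "exp (D 0 (\<i> * x)) = u (\<i> * x) / exp (c * (\<i> * x))"
    using u0[OF xs] by (simp add: D_def exp_diff)
  also have "\<dots> = exp (- \<i> * of_real (\<zeta> * x)) * (1 - of_real \<zeta> + of_real \<zeta> * exp (\<i> * of_real x))"
    by (simp add: u_def c_def exp_minus divide_inverse mult_ac)
  finally have "exp (- \<i> * of_real (\<zeta> * x)) * (1 - of_real \<zeta> + of_real \<zeta> * exp (\<i> * of_real x))
    = exp (?P + (D 0 (\<i> * x) - ?P))" by simp
  with bd show ?thesis by blast
qed

text \<open>Double counting of incidences: an edge with a chosen endpoint is an ordered pair of
  distinct vertices, the chosen endpoint first.\<close>

lemma sum_edges:
  fixes \<phi> :: "nat set \<Rightarrow> nat \<Rightarrow> 'a::comm_monoid_add"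
  shows "(\<Sum>e\<in>edges n. \<Sum>v\<in>e. \<phi> e v) = (\<Sum>j\<in>{1..n}. \<Sum>k\<in>{1..n} - {j}. \<phi> {j, k} j)"
proof -
  have fin: "finite (edges n)" by (intro finite_imp_finite_nsets) auto
  have fe: "finite e" if "e \<in> edges n" for e using that by (auto simp: nsets_def)
  have "(\<Sum>e\<in>edges n. \<Sum>v\<in>e. \<phi> e v) = (\<Sum>(e, v)\<in>Sigma (edges n) (\<lambda>e. e). \<phi> e v)"
    using fin fe by (intro sum.Sigma) auto
  also have "\<dots> = (\<Sum>(j, k)\<in>(SIGMA j:{1..n}. {1..n} - {j}). \<phi> {j, k} j)"
  proof (rule sum.reindex_bij_witness[where i="\<lambda>(j, k). ({j, k}, j)" and j="\<lambda>(e, v). (v, the_elem (e - {v}))"], goal_cases)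
    case (1 a)
    then obtain e v where a: "a = (e, v)" "e \<in> edges n" "v \<in> e" by auto
    then obtain x y where "e = {x, y}" "x \<noteq> y" by (auto simp: nsets_2_eq)
    then show ?case using a by (auto simp: insert_Diff_if)
  next
    case (2 a)
    then obtain e v where a: "a = (e, v)" "e \<in> edges n" "v \<in> e" by auto
    then obtain x y where "e = {x, y}" "x \<noteq> y" "x \<in> {1..n}" "y \<in> {1..n}"
      unfolding nsets_2_eq by blast
    then show ?case using a by (auto simp: insert_Diff_if)
  next
    case (3 b) then show ?case by (auto simp: insert_Diff_if)
  next
    case (4 b) then show ?case by (auto simp: nsets_2_eq)
  next
    case (5 a)
    then obtain e v where a: "a = (e, v)" "e \<in> edges n" "v \<in> e" by auto
    then obtain x y where "e = {x, y}" "x \<noteq> y" by (auto simp: nsets_2_eq)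
    then show ?case using a by (auto simp: insert_Diff_if insert_commute)
  qed
  also have "\<dots> = (\<Sum>j\<in>{1..n}. \<Sum>k\<in>{1..n} - {j}. \<phi> {j, k} j)"
    by (intro sum.Sigma[symmetric]) auto
  finally show ?thesis .
qed

lemma sum_edges_half:
  fixes \<phi> :: "nat set \<Rightarrow> real"
  shows "(\<Sum>e\<in>edges n. \<phi> e) = 1 / 2 * (\<Sum>j\<in>{1..n}. \<Sum>k\<in>{1..n} - {j}. \<phi> {j, k})"
proof -
  have "card e = 2" if "e \<in> edges n" for e using that by (auto simp: nsets_def)
  then have "(\<Sum>e\<in>edges n. \<phi> e) = (\<Sum>e\<in>edges n. \<Sum>v\<in>e. \<phi> e / 2)" by (intro sum.cong) auto
  also have "\<dots> = (\<Sum>j\<in>{1..n}. \<Sum>k\<in>{1..n} - {j}. \<phi> {j, k} / 2)" by (rule sum_edges)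
  finally show ?thesis by (simp add: sum_distrib_left)
qed

lemma sum_edges_pairs:
  fixes c :: "nat set \<Rightarrow> real" and \<phi> :: "real \<Rightarrow> real"
  shows "(\<Sum>e\<in>edges n. c e * \<phi> (\<Sum>v\<in>e. t v))
    = 1 / 2 * (\<Sum>j\<in>{1..n}. \<Sum>k\<in>{1..n}. (if j = k then 0 else c {j, k}) * \<phi> (t j + t k))"
proof -
  have "(\<Sum>k\<in>{1..n} - {j}. c {j, k} * \<phi> (\<Sum>v\<in>{j, k}. t v))
      = (\<Sum>k\<in>{1..n}. (if j = k then 0 else c {j, k}) * \<phi> (t j + t k))" for j
    by (rule sum.mono_neutral_cong_left) auto
  then show ?thesis unfolding sum_edges_half by simp
qed

section \<open>Integrals with a quartic exponent\<close>

context quad_form begin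

text \<open>Used with \<open>G\<close> the rescaled integrand, or its modulus, and
  \<open>\<theta>\<close> the cubic phase, or 1. The exponential of the quartic is controlled only
  on the cube, so it is compared with that of the clipped quartic, which concentrates. The four
  error terms are the expansion error \<open>\<eta>\<close>, the fluctuation of the clipped
  exponential, the mass outside the cube, and the shift \<open>D\<close> of the mean caused by
  clipping.\<close>

theorem quartic_transform:
  fixes G \<theta> :: "('i \<Rightarrow> real) \<Rightarrow> complex"
  assumes \<gamma>: "\<And>j k. \<bar>\<gamma> j k\<bar> \<le> 1" and r: "0 \<le> r" and \<eta>: "0 \<le> \<eta>"
    and \<theta>[measurable]: "\<theta> \<in> borel_measurable Leb" and \<theta>1: "\<And>t. cmod (\<theta> t) \<le> 1"
    and G[measurable]: "G \<in> borel_measurable Leb"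
    and inside: "\<And>t. t \<in> space M \<Longrightarrow> t \<notin> bad r \<Longrightarrow>
      cmod (G t - \<theta> t * complex_of_real (exp (quartic \<gamma> t))) \<le> 2 * \<eta> * exp (quartic \<gamma> t)"
    and outside: "\<And>t. t \<in> bad r \<Longrightarrow> G t = 0"
  defines "L \<equiv> 4 / 3 * r ^ 3 * N * sqrt N"
    and "D \<equiv> 2 * sqrt (26880 * (N / \<kappa>) ^ 4 * tail r)"
    and "a \<equiv> E (quartic \<gamma>)"
  shows "cmod (E G - complex_of_real (exp a) * E \<theta>)
    \<le> exp a * (exp D * (2 * \<eta> * exp (L\<^sup>2 / \<kappa>) + sqrt (exp (4 * L\<^sup>2 / \<kappa>) - 1) + tail r) + (exp D - 1))"
proof -
  define k where "k t = quartic \<gamma> (clip r t)" for t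
  define m where "m = E k"
  define c where "c t = k t - m" for t
  have k: "Lip L k" unfolding k_def[abs_def] L_def by (rule quartic_concentration(1)[OF \<gamma> r])
  have c: "Lip L c" unfolding c_def by (rule Lip_add_const[OF k])
  have c0: "E c = 0"
    unfolding c_def using integrable_M[OF exp_growth_Lip[OF k]] by (simp add: prob_space m_def)
  have keq: "k t = quartic \<gamma> t" if "t \<in> space M" "t \<notin> bad r" for t
    unfolding k_def using that by (intro quartic_concentration(2)[OF \<gamma> r]) (force simp: bad_def)
  have ma: "\<bar>m - a\<bar> \<le> D"
    using quartic_concentration(3)[OF \<gamma> r] unfolding m_def a_def D_def k_def[abs_def] .
  \<comment> \<open>In order: the error of \<open>G\<close> inside the cube, the fluctuation of
    \<open>exp c\<close> about 1, and the contribution of \<open>bad r\<close>, where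
    \<open>G\<close> vanishes and only \<open>\<theta> exp m\<close> remains.\<close>
  define R where "R t = 2 * \<eta> * exp m * exp (c t) + exp m * \<bar>exp (c t) - 1\<bar> + exp m * indicator (bad r) t" for t
  have ind: "exp_growth (\<lambda>t. indicator (bad r) t :: real)"
    using bad_events[of r] by (intro exp_growth_bounded[where C=1]) (auto simp: sets_M)
  have ec: "exp_growth (\<lambda>t. exp (c t))" by (rule exp_growth_exp_Lip[OF c])
  have ec1: "exp_growth (\<lambda>t. exp (c t) - 1)" by (intro exp_growth_diff ec exp_growth_const)
  have R: "exp_growth R"
    unfolding R_def by (intro exp_growth_add exp_growth_cmult ec exp_growth_abs ec1 ind)
  have pointwise: "cmod (G t - \<theta> t * complex_of_real (exp m)) \<le> R t" if t: "t \<in> space M" for t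
  proof (cases "t \<in> bad r")
    case True
    have "cmod (G t - \<theta> t * complex_of_real (exp m)) \<le> 1 * exp m"
      using True outside \<theta>1[of t] by (simp add: norm_mult)
    also have "\<dots> \<le> R t" using True \<eta> by (simp add: R_def)
    finally show ?thesis .
  next
    case False
    have e: "exp (quartic \<gamma> t) = exp m * exp (c t)"
      using keq[OF t False] by (simp add: c_def flip: exp_add)
    have "G t - \<theta> t * complex_of_real (exp m) = (G t - \<theta> t * complex_of_real (exp (quartic \<gamma> t))) + \<theta> t * complex_of_real (exp m * (exp (c t) - 1))"
      unfolding e by (simp add: algebra_simps)
    also have "cmod \<dots> \<le> 2 * \<eta> * exp (quartic \<gamma> t) + 1 * \<bar>exp m * (exp (c t) - 1)\<bar>"
    proof (rule order_trans[OF norm_triangle_ineq add_mono[OF inside[OF t False]]])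
      show "cmod (\<theta> t * complex_of_real (exp m * (exp (c t) - 1))) \<le> 1 * \<bar>exp m * (exp (c t) - 1)\<bar>"
        unfolding norm_mult norm_of_real by (intro mult_right_mono \<theta>1) auto
    qed
    also have "\<dots> = R t" using False unfolding e by (simp add: R_def abs_mult)
    finally show ?thesis .
  qed
  have int\<theta>: "integrable M \<theta>" using \<theta> \<theta>1 by (intro integrable_M exp_growth_bounded)
  \<comment> \<open>Integrability of \<open>G\<close> is not assumed; it follows from the pointwise
    bound by \<open>R\<close>.\<close>
  have intdiff: "integrable M (\<lambda>t. G t - \<theta> t * complex_of_real (exp m))"
    by (rule Bochner_Integration.integrable_bound[OF integrable_M[OF R]])
       (use pointwise in \<open>auto intro!: AE_I2 order_trans[OF _ abs_ge_self]\<close>)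
  have intG: "integrable M G"
    using Bochner_Integration.integrable_add[OF intdiff integrable_mult_left[OF int\<theta>, of "complex_of_real (exp m)"]] by simp
  have "E G - complex_of_real (exp m) * E \<theta> = E (\<lambda>t. G t - \<theta> t * complex_of_real (exp m))"
    using intG int\<theta> by (simp add: mult.commute)
  also have "cmod \<dots> \<le> E R"
    by (rule norm_expectation_le[OF intdiff integrable_M[OF R] pointwise])
  finally have first: "cmod (E G - complex_of_real (exp m) * E \<theta>) \<le> E R" .
  have "E R = exp m * (2 * \<eta> * E (\<lambda>t. exp (c t)) + E (\<lambda>t. \<bar>exp (c t) - 1\<bar>) + prob (bad r))"
    unfolding R_def using integrable_M[OF ec] integrable_M[OF exp_growth_abs[OF ec1]] integrable_M[OF ind]
    by (simp add: algebra_simps)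
  also have "\<dots> \<le> exp m * (2 * \<eta> * exp (L\<^sup>2 / \<kappa>) + sqrt (exp (4 * L\<^sup>2 / \<kappa>) - 1) + tail r)"
  proof (intro mult_left_mono add_mono prob_bad r)
    show "E (\<lambda>t. exp (c t)) \<le> exp (L\<^sup>2 / \<kappa>)" by (rule exp_Lip_centered[OF c c0])
    have "E (\<lambda>t. \<bar>exp (c t) - 1\<bar>) \<le> sqrt (E (\<lambda>t. (exp (c t) - 1)\<^sup>2))"
      by (intro expectation_abs_le_sqrt integrable_M ec1 exp_growth_power)
    also have "\<dots> \<le> sqrt (exp (4 * L\<^sup>2 / \<kappa>) - 1)"
      using Lip_exp_deviation[OF k] unfolding c_def m_def by (rule real_sqrt_le_mono)
    finally show "E (\<lambda>t. \<bar>exp (c t) - 1\<bar>) \<le> sqrt (exp (4 * L\<^sup>2 / \<kappa>) - 1)" .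
  qed (use \<eta> in auto)
  finally have second: "E R \<le> exp m * (2 * \<eta> * exp (L\<^sup>2 / \<kappa>) + sqrt (exp (4 * L\<^sup>2 / \<kappa>) - 1) + tail r)" (is "_ \<le> exp m * ?X") .
  have X: "0 \<le> ?X" using \<eta> \<kappa>_pos by (intro add_nonneg_nonneg) (auto simp: tail_def)
  have em: "exp m \<le> exp a * exp D" using ma by (simp flip: exp_add)
  have "\<bar>exp m - exp a\<bar> \<le> exp a * (exp D - 1)"
  proof -
    have "exp m - exp a = exp a * (exp (m - a) - 1)" by (simp add: right_diff_distrib flip: exp_add)
    moreover have "\<bar>exp (m - a) - 1\<bar> \<le> exp D - 1"
    proof -
      have "exp (m - a) \<le> exp D" using ma by simp
      moreover have "1 - D \<le> exp (m - a)" using exp_ge_add_one_self[of "m - a"] ma by linarith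
      moreover have "1 + D \<le> exp D" by (rule exp_ge_add_one_self)
      ultimately show ?thesis by linarith
    qed
    ultimately show ?thesis by (simp add: abs_mult)
  qed
  moreover have "cmod (E \<theta>) \<le> 1"
    using norm_expectation_le[OF int\<theta>, of "\<lambda>_. 1"] \<theta>1 by (simp add: prob_space)
  ultimately have third: "cmod (complex_of_real (exp m - exp a) * E \<theta>) \<le> exp a * (exp D - 1)"
    unfolding norm_mult
    using mult_mono[of "\<bar>exp m - exp a\<bar>" "exp a * (exp D - 1)" "cmod (E \<theta>)" 1]
    by (simp only: norm_of_real) simp
  have "E G - complex_of_real (exp a) * E \<theta>
      = (E G - complex_of_real (exp m) * E \<theta>) + complex_of_real (exp m - exp a) * E \<theta>"
    by (simp add: algebra_simps)
  then have "cmod (E G - complex_of_real (exp a) * E \<theta>) \<le> exp m * ?X + exp a * (exp D - 1)"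
    using norm_triangle_ineq[of "E G - complex_of_real (exp m) * E \<theta>" "complex_of_real (exp m - exp a) * E \<theta>"]
      first second third by (simp only:)
  also have "\<dots> \<le> (exp a * exp D) * ?X + exp a * (exp D - 1)"
    using em X by (intro add_right_mono mult_right_mono)
  finally show ?thesis by (simp add: distrib_left mult.assoc)
qed

end

text \<open>The bounds of the preceding sections for \<open>r = ln n / sqrt n\<close>, \<open>\<kappa> = n / A\<close>.\<close>

definition box_tail :: "real \<Rightarrow> nat \<Rightarrow> real" where
  "box_tail A n = 2 * real n * exp (- (ln (real n))\<^sup>2 / (4 * A))"

text \<open>An upper bound for \<open>L\<^sup>2 / \<kappa>\<close> with \<open>L\<close> the
  Lipschitz constant of \<open>quartic_concentration\<close>.\<close>

definition quartic_dev :: "real \<Rightarrow> nat \<Rightarrow> real" where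
  "quartic_dev A n = 16 / 9 * ln (real n) ^ 6 * A / real n"

text \<open>The analogous bound for the Lipschitz constant of \<open>\<Gamma>\<close> in
  \<open>cub_clt_quantitative\<close>.\<close>

definition cubic_dev :: "real \<Rightarrow> nat \<Rightarrow> real" where
  "cubic_dev A n = (16 / 3 * A * ln (real n) * ((ln (real n))\<^sup>2 + A))\<^sup>2 * A / real n"

definition quartic_shift :: "real \<Rightarrow> nat \<Rightarrow> real" where
  "quartic_shift A n = 2 * sqrt (26880 * A ^ 4 * box_tail A n)"

text \<open>The value of \<open>32000 n^2 r^5\<close> at \<open>r = ln n / sqrt n\<close>: the
  fifth-order remainders summed over all edges.\<close>

definition log_remainder :: "nat \<Rightarrow> real" where
  "log_remainder n = 32000 * ln (real n) ^ 5 / sqrt (real n)"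

text \<open>The error of \<open>quartic_transform\<close>; \<open>exp (48 * A\<^sup>2)\<close>
  bounds \<open>exp (\<nu> n z)\<close>. \<open>err2\<close> is the additional error of the cubic
  phase.\<close>

definition err1 :: "real \<Rightarrow> nat \<Rightarrow> real" where
  "err1 A n = exp (48 * A\<^sup>2) * (exp (quartic_shift A n) * (2 * log_remainder n * exp (quartic_dev A n)
    + sqrt (exp (4 * quartic_dev A n) - 1) + box_tail A n) + (exp (quartic_shift A n) - 1))"

definition err2 :: "real \<Rightarrow> nat \<Rightarrow> real" where
  "err2 A n = exp (48 * A\<^sup>2) * (4 * sqrt (2000000 * A ^ 6 * box_tail A n) + 2 * sqrt (exp (cubic_dev A n) - 1))"

text \<open>The slowest terms decay like a power of \<open>ln n\<close> over \<open>sqrt n\<close>,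
  and those with \<open>box_tail\<close> faster than any power of \<open>n\<close>. The exponent
  \<open>1 / 8\<close> is a convenient choice below \<open>1 / 2\<close>.\<close>

lemma asymptotic_error_small:
  fixes A :: real
  assumes "A > 0"
  shows "\<forall>\<^sub>F n in sequentially. err1 A n + err2 A n \<le> real n powr (- 1 / 8)"
proof -
  let ?s = "\<lambda>n::nat. real n powr (1 / 8)"
  let ?D = "quartic_shift A" and ?P = "quartic_dev A" and ?T = "box_tail A" and ?G = "cubic_dev A"
  note defs = quartic_shift_def quartic_dev_def box_tail_def cubic_dev_def log_remainder_def
  have D0: "?D \<longlonglongrightarrow> 0" and P0: "?P \<longlonglongrightarrow> 0"
    unfolding defs using assms by real_asymp+
  \<comment> \<open>Each vanishing ingredient is multiplied by \<open>n powr (1 / 8)\<close>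
    separately; the limit of the whole expression then follows by limit rules.\<close>
  have l: "(\<lambda>n. log_remainder n * ?s n) \<longlonglongrightarrow> 0" "(\<lambda>n. sqrt (exp (4 * ?P n) - 1) * ?s n) \<longlonglongrightarrow> 0" "(\<lambda>n. ?T n * ?s n) \<longlonglongrightarrow> 0"
    "(\<lambda>n. (exp (?D n) - 1) * ?s n) \<longlonglongrightarrow> 0" "(\<lambda>n. sqrt (2000000 * A ^ 6 * ?T n) * ?s n) \<longlonglongrightarrow> 0"
    "(\<lambda>n. sqrt (exp (?G n) - 1) * ?s n) \<longlonglongrightarrow> 0"
    unfolding defs using assms by real_asymp+
  have "(\<lambda>n. exp (48 * A\<^sup>2) * (exp (?D n) * (2 * (log_remainder n * ?s n) * exp (?P n) + sqrt (exp (4 * ?P n) - 1) * ?s n + ?T n * ?s n)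
      + (exp (?D n) - 1) * ?s n + (4 * (sqrt (2000000 * A ^ 6 * ?T n) * ?s n) + 2 * (sqrt (exp (?G n) - 1) * ?s n))))
    \<longlonglongrightarrow> exp (48 * A\<^sup>2) * (exp 0 * (2 * 0 * exp 0 + 0 + 0) + 0 + (4 * 0 + 2 * 0))"
    by (intro tendsto_intros l D0 P0)
  then have "\<forall>\<^sub>F n in sequentially. exp (48 * A\<^sup>2) * (exp (?D n) * (2 * (log_remainder n * ?s n) * exp (?P n) + sqrt (exp (4 * ?P n) - 1) * ?s n + ?T n * ?s n)
      + (exp (?D n) - 1) * ?s n + (4 * (sqrt (2000000 * A ^ 6 * ?T n) * ?s n) + 2 * (sqrt (exp (?G n) - 1) * ?s n))) < 1"
    by (rule order_tendstoD) simp
  with eventually_gt_at_top[of 0] show ?thesis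
  proof eventually_elim
    case (elim n)
    have s: "?s n > 0" "real n powr (- 1 / 8) = 1 / ?s n"
      using elim(1) powr_minus_divide[of "real n" "1 / 8"] by simp_all
    have factor: "a * (b * (2 * (e * s) * p + u * s + t * s) + d * s + (4 * (v * s) + 2 * (w * s)))
        = a * (b * (2 * e * p + u + t) + d + (4 * v + 2 * w)) * s" for a b e s p u t d v w :: real
      by (simp add: algebra_simps)
    show ?case
      unfolding s(2) pos_le_divide_eq[OF s(1)] err1_def err2_def distrib_left[symmetric] factor[symmetric]
      using elim(2) by (rule less_imp_le)
  qed
qed

section \<open>Weights on the edges of the complete graph\<close>

locale bounded_weights =
  fixes n :: nat and z :: "nat set \<Rightarrow> real" and \<delta> :: real
  assumes n: "n > 2" and \<delta>: "0 < \<delta>" "\<delta> \<le> 1 / 2"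
    and z: "\<And>j k. j \<in> {1..n} \<Longrightarrow> k \<in> {1..n} \<Longrightarrow> j \<noteq> k \<Longrightarrow> \<delta> \<le> z {j, k} \<and> z {j, k} \<le> 1 - \<delta>"
begin

abbreviation V :: "nat set" where "V \<equiv> {1..n}"

text \<open>Extended by \<open>0\<close> so that the coefficient bounds hold for all indices.\<close>

definition wt :: "(nat set \<Rightarrow> real) \<Rightarrow> nat \<Rightarrow> nat \<Rightarrow> real" where
  "wt c j k = (if j = k \<or> j \<notin> V \<or> k \<notin> V then 0 else c {j, k})"

definition var :: "nat set \<Rightarrow> real" where "var e = z e - (z e)\<^sup>2"

text \<open>The signless Laplacian of the complete graph with edge weights
  \<open>var\<close>.\<close>

definition Hess :: "nat \<Rightarrow> nat \<Rightarrow> real" where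
  "Hess j k = wt var j k + (if j = k then \<Sum>m\<in>V. wt var j m else 0)"

text \<open>\<open>\<delta> / 2\<close> bounds the weights from below, and \<open>n - 2\<close> is
  the smallest eigenvalue of the signless Laplacian of the complete graph; it is positive as
  \<open>n > 2\<close>.\<close>

definition cst :: real where "cst = \<delta> / 2 * (real n - 2)"

definition b3 :: "nat set \<Rightarrow> real" where "b3 e = z e * (1 - z e) * (2 * z e - 1)"

definition b4 :: "nat set \<Rightarrow> real" where "b4 e = z e * (1 - z e) * (6 * (z e)\<^sup>2 - 6 * z e + 1)"

lemma wt_sym: "wt c j k = wt c k j"
  by (auto simp: wt_def insert_commute)

lemma sum_edges_wt:
  fixes \<phi> :: "real \<Rightarrow> real"
  shows "(\<Sum>e\<in>edges n. c e * \<phi> (\<Sum>v\<in>e. t v))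
    = 1 / 2 * (\<Sum>j\<in>V. \<Sum>k\<in>V. wt c j k * \<phi> (t j + t k))"
  by (rule trans[OF sum_edges_pairs[where n=n and c=c and \<phi>=\<phi> and t=t]], intro arg_cong[where f="\<lambda>x. 1 / 2 * x"] sum.cong refl)
     (auto simp: wt_def)

lemma z_edge:
  assumes "e \<in> edges n"
  shows "\<delta> \<le> z e" "z e \<le> 1 - \<delta>"
proof -
  obtain j k where "e = {j, k}" "j \<noteq> k" "j \<in> V" "k \<in> V"
    using assms unfolding nsets_2_eq by blast
  then show "\<delta> \<le> z e" "z e \<le> 1 - \<delta>" using z[of j k] by auto
qed

lemma var_bounds:
  assumes "\<delta> \<le> z e" "z e \<le> 1 - \<delta>"
  shows "\<delta> / 2 \<le> var e" "var e \<le> 1 / 4"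
proof -
  have "0 \<le> (z e - \<delta>) * (1 - \<delta> - z e)" using assms by simp
  then have "\<delta> * (1 - \<delta>) \<le> var e" by (simp add: var_def power2_eq_square algebra_simps)
  moreover have "\<delta> * (1 / 2) \<le> \<delta> * (1 - \<delta>)" using \<delta> by (intro mult_left_mono) auto
  ultimately show "\<delta> / 2 \<le> var e" by simp
  show "var e \<le> 1 / 4"
    using zero_le_power2[of "z e - 1 / 2"] by (simp add: var_def power2_eq_square algebra_simps)
qed

lemma wt_var: "j \<in> V \<Longrightarrow> k \<in> V \<Longrightarrow> j \<noteq> k \<Longrightarrow> \<delta> / 2 \<le> wt var j k \<and> wt var j k \<le> 1 / 4"
  using var_bounds[of "{j, k}"] z[of j k] by (auto simp: wt_def)

lemma Hess_form: "(\<Sum>j\<in>V. \<Sum>k\<in>V. Hess j k * t j * t k)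
    = 1 / 2 * (\<Sum>j\<in>V. \<Sum>k\<in>V. wt var j k * (t j + t k)\<^sup>2)"
proof -
  let ?I = "V"
  have "(\<Sum>j\<in>?I. \<Sum>k\<in>?I. Hess j k * t j * t k)
    = (\<Sum>j\<in>?I. (\<Sum>k\<in>?I. wt var j k * t j * t k) + (\<Sum>k\<in>?I. if k = j then (\<Sum>m\<in>?I. wt var j m) * t j * t j else 0))"
    unfolding sum.distrib[symmetric]
    by (intro sum.cong refl) (auto simp: Hess_def algebra_simps)
  also have "\<dots> = (\<Sum>j\<in>?I. \<Sum>k\<in>?I. wt var j k * t j * t k) + (\<Sum>j\<in>?I. \<Sum>k\<in>?I. wt var j k * (t j)\<^sup>2)"
    by (simp add: sum.distrib sum_distrib_right power2_eq_square mult.assoc)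
  finally have lhs: "(\<Sum>j\<in>?I. \<Sum>k\<in>?I. Hess j k * t j * t k)
    = (\<Sum>j\<in>?I. \<Sum>k\<in>?I. wt var j k * t j * t k) + (\<Sum>j\<in>?I. \<Sum>k\<in>?I. wt var j k * (t j)\<^sup>2)" .
  have "(\<Sum>j\<in>?I. \<Sum>k\<in>?I. wt var j k * (t k)\<^sup>2) = (\<Sum>j\<in>?I. \<Sum>k\<in>?I. wt var j k * (t j)\<^sup>2)"
    by (subst sum.swap) (intro sum.cong refl, simp add: wt_sym)
  moreover have "(\<Sum>j\<in>?I. \<Sum>k\<in>?I. wt var j k * (t j + t k)\<^sup>2)
    = (\<Sum>j\<in>?I. \<Sum>k\<in>?I. wt var j k * (t j)\<^sup>2) + (\<Sum>j\<in>?I. \<Sum>k\<in>?I. wt var j k * (t k)\<^sup>2)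
      + 2 * (\<Sum>j\<in>?I. \<Sum>k\<in>?I. wt var j k * t j * t k)"
    unfolding sum_distrib_left sum.distrib[symmetric]
    by (intro sum.cong refl) (simp add: power2_eq_square algebra_simps)
  ultimately show ?thesis unfolding lhs by simp
qed

text \<open>The unweighted case. Dropping the square of the sum gives coercivity; bounding it by
  Cauchy-Schwarz gives the upper bound on \<open>Q\<close> behind \<open>Xi_ge\<close>.\<close>

lemma sum_pairs_squared: "(\<Sum>j\<in>V. \<Sum>k\<in>V. if j = k then 0 else (t j + t k)\<^sup>2)
    = 2 * (real n - 2) * (\<Sum>j\<in>V. (t j)\<^sup>2) + 2 * (\<Sum>j\<in>V. t j)\<^sup>2" for t :: "nat \<Rightarrow> real"
proof -
  let ?I = "V"
  have "(\<Sum>j\<in>?I. \<Sum>k\<in>?I. if j = k then 0 else (t j + t k)\<^sup>2)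
    = (\<Sum>j\<in>?I. \<Sum>k\<in>?I. (t j)\<^sup>2 + ((t k)\<^sup>2 + 2 * (t j * t k)) - (if k = j then 4 * (t j)\<^sup>2 else 0))"
    by (intro sum.cong refl) (auto simp: power2_eq_square algebra_simps)
  also have "\<dots> = 2 * real n * (\<Sum>j\<in>?I. (t j)\<^sup>2) + 2 * (\<Sum>j\<in>?I. \<Sum>k\<in>?I. t j * t k) - 4 * (\<Sum>j\<in>?I. (t j)\<^sup>2)"
    by (simp add: sum.distrib sum_subtractf flip: sum_distrib_left)
  also have "(\<Sum>j\<in>?I. \<Sum>k\<in>?I. t j * t k) = (\<Sum>j\<in>?I. t j)\<^sup>2"
    by (simp add: power2_eq_square sum_product)
  finally show ?thesis by (simp add: algebra_simps)
qed

lemma Hess_coercive: "cst * (\<Sum>j\<in>V. (t j)\<^sup>2) \<le> (\<Sum>j\<in>V. \<Sum>k\<in>V. Hess j k * t j * t k)"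
proof -
  have "cst * (\<Sum>j\<in>V. (t j)\<^sup>2)
      \<le> 1 / 2 * (\<delta> / 2 * (2 * (real n - 2) * (\<Sum>j\<in>V. (t j)\<^sup>2) + 2 * (\<Sum>j\<in>V. t j)\<^sup>2))"
    using \<delta> by (simp add: cst_def algebra_simps)
  also have "\<dots> = 1 / 2 * (\<Sum>j\<in>V. \<Sum>k\<in>V. \<delta> / 2 * (if j = k then 0 else (t j + t k)\<^sup>2))"
    by (subst sum_pairs_squared[symmetric]) (simp only: sum_distrib_left)
  also have "\<dots> \<le> 1 / 2 * (\<Sum>j\<in>V. \<Sum>k\<in>V. wt var j k * (t j + t k)\<^sup>2)"
  proof (intro mult_left_mono sum_mono)
    fix j k assume jk: "j \<in> V" "k \<in> V"
    show "\<delta> / 2 * (if j = k then 0 else (t j + t k)\<^sup>2) \<le> wt var j k * (t j + t k)\<^sup>2"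
    proof (cases "j = k")
      case False
      then show ?thesis using wt_var[OF jk] mult_right_mono[of "\<delta> / 2" "wt var j k" "(t j + t k)\<^sup>2"] by simp
    qed (simp add: wt_def)
  qed simp
  finally show ?thesis unfolding Hess_form .
qed

lemma coefficient_bounds:
  assumes "0 \<le> (x::real)" "x \<le> 1"
  shows "\<bar>x * (1 - x) * (2 * x - 1)\<bar> \<le> 1" "\<bar>x * (1 - x) * (6 * x\<^sup>2 - 6 * x + 1)\<bar> \<le> 1"
proof -
  have "0 \<le> x * (1 - x)" using assms by simp
  moreover have "x * (1 - x) \<le> 1 / 4"
    using zero_le_power2[of "x - 1 / 2"] by (simp add: power2_eq_square algebra_simps)
  moreover have "6 * x\<^sup>2 - 6 * x + 1 = 1 - 6 * (x * (1 - x))" by (simp add: power2_eq_square algebra_simps)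
  ultimately have "\<bar>x * (1 - x)\<bar> \<le> 1" "\<bar>2 * x - 1\<bar> \<le> 1" "\<bar>6 * x\<^sup>2 - 6 * x + 1\<bar> \<le> 1"
    using assms by (auto simp: abs_le_iff)
  then show "\<bar>x * (1 - x) * (2 * x - 1)\<bar> \<le> 1" "\<bar>x * (1 - x) * (6 * x\<^sup>2 - 6 * x + 1)\<bar> \<le> 1"
    unfolding abs_mult[of "x * (1 - x)"] by (auto intro: mult_le_one)
qed

lemma wt_bound:
  assumes "\<And>x. 0 \<le> x \<Longrightarrow> x \<le> 1 \<Longrightarrow> \<bar>\<phi> x\<bar> \<le> 1"
  shows "\<bar>wt (\<lambda>e. \<phi> (z e)) j k\<bar> \<le> 1"
proof (cases "j = k \<or> j \<notin> V \<or> k \<notin> V")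
  case False
  then have "0 \<le> z {j, k} \<and> z {j, k} \<le> 1" using z[of j k] \<delta> by auto
  then show ?thesis using False assms[of "z {j, k}"] by (simp add: wt_def)
qed (auto simp: wt_def)

lemma wt_b3: "\<bar>wt b3 j k\<bar> \<le> 1" and wt_b4: "\<bar>wt b4 j k\<bar> \<le> 1"
  unfolding b3_def[abs_def] b4_def[abs_def]
  by (rule wt_bound[where \<phi>="\<lambda>x. x * (1 - x) * (2 * x - 1)"], rule coefficient_bounds, assumption+)
     (rule wt_bound[where \<phi>="\<lambda>x. x * (1 - x) * (6 * x\<^sup>2 - 6 * x + 1)"], rule coefficient_bounds, assumption+)

lemma cst_pos: "cst > 0" using n \<delta> by (simp add: cst_def)

sublocale cubic_form "V" Hess cst "wt b3"
proof
  show "Hess i j = Hess j i" for i j by (auto simp: Hess_def wt_sym)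
qed (use cst_pos Hess_coercive wt_sym wt_b3 in auto)

lemma q_eq: "q n z = Q"
proof
  fix t
  have "q n z t = 1 / 2 * (\<Sum>e\<in>edges n. var e * (\<Sum>v\<in>e. t v)\<^sup>2)" unfolding q_def var_def ..
  then show "q n z t = Q t" unfolding sum_edges_wt[where \<phi>="\<lambda>x. x\<^sup>2"] Q_def Hess_form .
qed

lemma f_eq: "f n z = cub"
proof
  fix t
  have "f n z t = 1 / 6 * (\<Sum>e\<in>edges n. b3 e * (\<Sum>v\<in>e. t v) ^ 3)" unfolding f_def b3_def ..
  then show "f n z t = cub t" unfolding sum_edges_wt[where \<phi>="\<lambda>x. x ^ 3"] cub_def by simp
qed

lemma h_eq: "h n z = quartic (wt b4)"
proof
  fix t
  have "h n z t = 1 / 24 * (\<Sum>e\<in>edges n. b4 e * (\<Sum>v\<in>e. t v) ^ 4)" unfolding h_def b4_def ..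
  then show "h n z t = quartic (wt b4) t"
    unfolding sum_edges_wt[where \<phi>="\<lambda>x. x ^ 4"] quartic_def by simp
qed

lemma Xi_eq: "Xi n z = Z"
  unfolding Xi_def Z_def q_eq ..

lemma gaussian_eq: "gaussian n z = M"
  unfolding gaussian_def M_def q_eq Xi_eq ..

text \<open>Since \<open>var <= 1 / 4\<close> on edges, \<open>Q\<close> is at most
  \<open>n / 4\<close> times the squared norm, and the product Gaussian with that coefficient
  integrates to the stated value.\<close>

lemma Xi_ge: "Xi n z \<ge> (4 * pi / real n) powr (real n / 2)"
proof -
  have n0: "real n > 0" using n by simp
  have "Q t \<le> real n / 4 * (\<Sum>i\<in>V. (t i)\<^sup>2)" for t
  proof -
    have "(\<Sum>j\<in>V. \<Sum>k\<in>V. wt var j k * (t j + t k)\<^sup>2)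
      \<le> (\<Sum>j\<in>V. \<Sum>k\<in>V. 1 / 4 * (if j = k then 0 else (t j + t k)\<^sup>2))"
    proof (intro sum_mono)
      fix j k assume jk: "j \<in> V" "k \<in> V"
      show "wt var j k * (t j + t k)\<^sup>2 \<le> 1 / 4 * (if j = k then 0 else (t j + t k)\<^sup>2)"
      proof (cases "j = k")
        case False
        then show ?thesis using wt_var[OF jk] mult_right_mono[of "wt var j k" "1 / 4" "(t j + t k)\<^sup>2"] by simp
      qed (simp add: wt_def)
    qed
    also have "\<dots> = 1 / 4 * (2 * (real n - 2) * (\<Sum>j\<in>V. (t j)\<^sup>2) + 2 * (\<Sum>j\<in>V. t j)\<^sup>2)"
      by (subst sum_pairs_squared[symmetric]) (simp only: sum_distrib_left)
    also have "\<dots> \<le> 1 / 4 * (2 * (real n - 2) * (\<Sum>j\<in>V. (t j)\<^sup>2) + 2 * (real n * (\<Sum>j\<in>V. (t j)\<^sup>2)))"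
      using sum_squared_le_card[of t "V"] by simp
    also have "\<dots> \<le> real n * (\<Sum>j\<in>V. (t j)\<^sup>2)"
      by (simp add: algebra_simps sum_nonneg)
    finally show ?thesis unfolding Q_def Hess_form by simp
  qed
  from Z_ge[OF _ this] have "sqrt (pi / (real n / 4)) ^ n \<le> Z" using n0 by simp
  also have "sqrt (pi / (real n / 4)) ^ n = (4 * pi / real n) powr (real n / 2)"
    using n0 by (simp add: powr_half_sqrt[symmetric] powr_realpow[symmetric] powr_powr mult.commute)
  finally show ?thesis by (simp add: Xi_eq)
qed

text \<open>Since \<open>n > 2\<close> gives \<open>n - 2 >= n / 3\<close>, the constant
  \<open>cst\<close> is at least \<open>\<delta> n / 6\<close>; hence \<open>N / cst <= A\<close>
  uniformly in \<open>n\<close>.\<close>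

abbreviation A :: real where "A \<equiv> 6 / \<delta>"

lemma A_pos: "A > 0" using \<delta> by simp

lemma cst_ge: "real n / A \<le> cst"
  using n \<delta> by (simp add: cst_def field_simps)

lemma N_cst: "N / cst \<le> A"
  using cst_ge cst_pos A_pos by (simp add: field_simps)

lemma \<mu>_le: "\<mu> n z \<le> 294 * A ^ 3"
proof -
  have "\<mu> n z \<le> 294 * (N / cst) ^ 3"
    unfolding \<mu>_def gaussian_eq f_eq by (rule expectation_cub_squared)
  also have "\<dots> \<le> 294 * A ^ 3" using N_cst cst_pos by (intro mult_left_mono power_mono) auto
  finally show ?thesis .
qed

lemma abs_h_le: "(LINT t|gaussian n z. \<bar>h n z t\<bar>) \<le> 48 * A\<^sup>2"
proof -
  have "(LINT t|gaussian n z. \<bar>h n z t\<bar>) \<le> 48 * (N / cst)\<^sup>2"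
    unfolding gaussian_eq h_eq by (rule expectation_abs_quartic[OF wt_b4])
  also have "\<dots> \<le> 48 * A\<^sup>2" using N_cst cst_pos by (intro mult_left_mono power_mono) auto
  finally show ?thesis .
qed

lemma \<nu>_le: "\<bar>\<nu> n z\<bar> \<le> 48 * A\<^sup>2"
  using integral_abs_bound[of "gaussian n z" "h n z"] abs_h_le unfolding \<nu>_def by linarith

lemma integrable_f_h:
  "integrable (gaussian n z) (\<lambda>t. (f n z t)\<^sup>2)" "integrable (gaussian n z) (h n z)"
  unfolding gaussian_eq f_eq h_eq
  by (intro integrable_M exp_growth_power exp_growth_cub exp_growth_quartic)+

end

section \<open>The integrand on the box and the assembly of the estimates\<close>

locale degree_weights = bounded_weights +
  fixes d :: "nat \<Rightarrow> nat"
  assumes deg: "\<And>k. k \<in> V \<Longrightarrow> (\<Sum>j\<in>V - {k}. z {j, k}) = real (d k)"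
begin

text \<open>The prefactor of \<open>F\<close> is distributed over the edges, which centres every
  Bernoulli factor; then \<open>bernoulli_log_char\<close> is applied edge by edge and the exponents
  are added.\<close>

lemma F_expansion:
  assumes r: "0 \<le> r" "2 * r \<le> 1 / 4" and t: "\<And>i. i \<in> V \<Longrightarrow> \<bar>t i\<bar> \<le> r"
  shows "\<exists>w. cmod w \<le> 32000 * (real n)\<^sup>2 * r ^ 5 \<and>
    F n d z t = exp (of_real (- q n z t) + \<i> * of_real (f n z t) + of_real (h n z t) + w)"
proof -
  define X where "X e = (\<Sum>v\<in>e. t v)" for e
  let ?c = "\<lambda>e. exp (- \<i> * of_real (z e * X e)) * (1 - complex_of_real (z e) + of_real (z e) * exp (\<i> * of_real (X e)))"
  define P where "P e = complex_of_real (- (z e * (1 - z e) * (X e)\<^sup>2 / 2)) + \<i> * complex_of_real (b3 e * X e ^ 3 / 6)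
      + complex_of_real (b4 e * X e ^ 4 / 24)" for e
  have fin: "finite (edges n)" by (intro finite_imp_finite_nsets) auto
  have X: "\<bar>X e\<bar> \<le> 2 * r" if e: "e \<in> edges n" for e
  proof -
    obtain j k where "e = {j, k}" "j \<noteq> k" "j \<in> V" "k \<in> V"
      using e unfolding nsets_2_eq by blast
    then show ?thesis using t[of j] t[of k] by (simp add: X_def)
  qed
  have "\<forall>e\<in>edges n. \<exists>w. cmod w \<le> 2000 * \<bar>X e\<bar> ^ 5 \<and>
      ?c e = exp (P e + w)"
  proof
    fix e assume e: "e \<in> edges n"
    have "0 \<le> z e" "z e \<le> 1" "\<bar>X e\<bar> \<le> 1 / 4"
      using z_edge[OF e] \<delta> X[OF e] r by auto
    from bernoulli_log_char[OF this]
    show "\<exists>w. cmod w \<le> 2000 * \<bar>X e\<bar> ^ 5 \<and>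
      ?c e = exp (P e + w)"
      unfolding P_def b3_def b4_def .
  qed
  then obtain w where w: "\<And>e. e \<in> edges n \<Longrightarrow> cmod (w e) \<le> 2000 * \<bar>X e\<bar> ^ 5"
    "\<And>e. e \<in> edges n \<Longrightarrow>
      ?c e = exp (P e + w e)"
    by metis
  \<comment> \<open>Here the degree equations enter: each \<open>d m\<close> is replaced by the sum
    of the weights at \<open>m\<close>, and incidences are counted by edges instead of
    vertices.\<close>
  have "(\<Sum>m\<in>V. real (d m) * t m) = (\<Sum>m\<in>V. \<Sum>k\<in>V - {m}. z {m, k} * t m)"
    by (intro sum.cong refl) (simp add: deg[symmetric] sum_distrib_right insert_commute)
  also have "\<dots> = (\<Sum>e\<in>edges n. \<Sum>v\<in>e. z e * t v)" by (rule sum_edges[symmetric])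
  also have "\<dots> = (\<Sum>e\<in>edges n. z e * X e)" by (simp add: X_def sum_distrib_left)
  finally have lin: "(\<Sum>m\<in>V. real (d m) * t m) = (\<Sum>e\<in>edges n. z e * X e)" .
  have "exp (- \<i> * of_real (\<Sum>m\<in>V. real (d m) * t m)) = (\<Prod>e\<in>edges n. exp (- \<i> * of_real (z e * X e)))"
    unfolding lin exp_sum[OF fin, symmetric] of_real_sum sum_distrib_left ..
  then have "F n d z t = (\<Prod>e\<in>edges n. exp (P e + w e))"
    unfolding F_def X_def[symmetric] by (simp only: prod.distrib[symmetric] w(2) cong: prod.cong)
  also have "\<dots> = exp ((\<Sum>e\<in>edges n. P e) + (\<Sum>e\<in>edges n. w e))"
    unfolding sum.distrib[symmetric] exp_sum[OF fin] ..
  also have "(\<Sum>e\<in>edges n. P e) = of_real (- q n z t) + \<i> * of_real (f n z t) + of_real (h n z t)"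
  proof -
    have "q n z t = (\<Sum>e\<in>edges n. z e * (1 - z e) * (X e)\<^sup>2 / 2)"
      unfolding q_def X_def[symmetric] sum_distrib_left
      by (intro sum.cong refl) (simp add: power2_eq_square algebra_simps)
    moreover have "f n z t = (\<Sum>e\<in>edges n. b3 e * X e ^ 3 / 6)"
      by (simp add: f_def X_def b3_def sum_divide_distrib)
    moreover have "h n z t = (\<Sum>e\<in>edges n. b4 e * X e ^ 4 / 24)"
      by (simp add: h_def X_def b4_def sum_divide_distrib)
    ultimately show ?thesis
      by (simp only: P_def sum.distrib of_real_sum sum_negf sum_distrib_left of_real_minus)
  qed
  finally have F: "F n d z t = exp (of_real (- q n z t) + \<i> * of_real (f n z t) + of_real (h n z t) + (\<Sum>e\<in>edges n. w e))" .
  have card: "real (card (edges n)) \<le> (real n)\<^sup>2 / 2"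
    using sum_edges_half[of "\<lambda>_. 1" n] n by (simp add: power2_eq_square algebra_simps of_nat_diff)
  \<comment> \<open>At most \<open>n^2 / 2\<close> edges contribute
    \<open>2000 * (2 r)^5 = 64000 r^5\<close> each, which gives the constant 32000.\<close>
  have "cmod (\<Sum>e\<in>edges n. w e) \<le> (\<Sum>e\<in>edges n. 2000 * (2 * r) ^ 5)"
  proof (rule sum_norm_le)
    fix e assume e: "e \<in> edges n"
    have "2000 * \<bar>X e\<bar> ^ 5 \<le> 2000 * (2 * r) ^ 5" using X[OF e] by (intro mult_left_mono power_mono) auto
    then show "cmod (w e) \<le> 2000 * (2 * r) ^ 5" using w(1)[OF e] by linarith
  qed
  also have "\<dots> = real (card (edges n)) * (64000 * r ^ 5)" by (simp add: power_mult_distrib)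
  also have "\<dots> \<le> (real n)\<^sup>2 / 2 * (64000 * r ^ 5)" using card r by (intro mult_right_mono) auto
  finally have "cmod (\<Sum>e\<in>edges n. w e) \<le> 32000 * (real n)\<^sup>2 * r ^ 5" by (simp add: mult_ac)
  with F show ?thesis by blast
qed

lemma F_measurable[measurable]: "F n d z \<in> borel_measurable Leb"
proof -
  have [measurable]: "(\<lambda>t. \<Sum>v\<in>e. t v) \<in> borel_measurable Leb" if "e \<in> edges n" for e
    using that by (intro borel_measurable_sum component_measurable) (auto simp: nsets_def)
  have "(\<lambda>t. \<Sum>m\<in>V. real (d m) * t m) \<in> borel_measurable Leb"
    by (intro borel_measurable_sum borel_measurable_times component_measurable) auto
  note [measurable] = this
  show ?thesis unfolding F_def[abs_def]
    by (intro borel_measurable_times borel_measurable_prod) measurable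
qed

lemma U_measurable[measurable]: "U n \<in> sets Leb"
  unfolding U_def by (intro sets_PiM_I_finite) auto

text \<open>\<open>quartic_transform\<close> is used twice, with phase \<open>exp (i cub)\<close>
  for \<open>F\<close> and with phase 1 for its modulus; only the former also needs
  \<open>cub_clt_quantitative\<close>. Nonnegativity of \<open>err2\<close> is recorded so that one
  threshold on \<open>err1 + err2\<close> settles both estimates.\<close>

lemma asymptotics:
  defines "r \<equiv> ln (real n) / sqrt (real n)"
  assumes small: "2 * r \<le> 1 / 4" "log_remainder n \<le> 1 / 2"
  shows "\<bar>(LINT t:U n|lebesgue_space n. cmod (F n d z t)) - exp (\<nu> n z) * Xi n z\<bar> \<le> err1 A n * Xi n z"
    and "cmod ((LINT t:U n|lebesgue_space n. F n d z t)
               - of_real (exp (- \<mu> n z / 2 + \<nu> n z) * Xi n z)) \<le> (err1 A n + err2 A n) * Xi n z"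
    and "0 \<le> err2 A n"
proof -
  let ?h = "\<lambda>t. complex_of_real (exp (quartic (wt b4) t))"
  let ?g = "\<lambda>t. iexp (cub t) * ?h t"
  let ?D = "2 * sqrt (26880 * (N / cst) ^ 4 * tail r)"
  let ?n = "complex_of_real (exp (\<nu> n z))"
  let ?\<eta> = "log_remainder n" and ?T = "box_tail A n" and ?P = "quartic_dev A n"
  let ?G = "cubic_dev A n" and ?D' = "quartic_shift A n"
  define l where "l = ln (real n)"
  have l: "l > 0" using n by (simp add: l_def)
  have n0: "real n > 0" using n by simp
  have r: "r \<ge> 0" using l by (simp add: r_def l_def)
  have \<eta>: "?\<eta> \<ge> 0" using l by (simp add: log_remainder_def l_def)
  have sq: "sqrt (real n) * sqrt (real n) = real n" using n0 by simp
  have rs: "r * sqrt (real n) = l" using n0 by (simp add: r_def l_def)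
  have r2: "r\<^sup>2 = l\<^sup>2 / real n" by (simp add: r_def l_def power_divide)
  have icst: "1 / cst \<le> A / real n" using cst_ge cst_pos A_pos n0 by (simp add: field_simps)
  have \<eta>_eq: "32000 * (real n)\<^sup>2 * r ^ 5 = ?\<eta>"
  proof -
    have "(real n)\<^sup>2 = sqrt (real n) ^ 4" by (simp add: power4_eq_xxxx power2_eq_square)
    then have "(real n)\<^sup>2 * r ^ 5 = (r * sqrt (real n)) ^ 4 * r"
      by (simp add: power_mult_distrib eval_nat_numeral mult_ac)
    also have "\<dots> = l ^ 5 / sqrt (real n)" unfolding rs by (simp add: r_def l_def eval_nat_numeral)
    finally show ?thesis by (simp add: log_remainder_def l_def)
  qed
  have tail_le: "tail r \<le> ?T"
  proof -
    have "(real n / A) * r\<^sup>2 \<le> cst * r\<^sup>2" using cst_ge by (intro mult_right_mono) auto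
    then have "- cst * r\<^sup>2 / 4 \<le> - (l\<^sup>2) / (4 * A)"
      using n0 A_pos by (simp add: r2 field_simps)
    then have "exp (- cst * r\<^sup>2 / 4) \<le> exp (- l\<^sup>2 / (4 * A))" by (rule iffD2[OF exp_le_cancel_iff])
    then show ?thesis unfolding tail_def box_tail_def l_def[symmetric] by (simp only: card_atLeastAtMost) (intro mult_mono, auto)
  qed
  have T0: "0 \<le> ?T" by (simp add: box_tail_def)
  define L where "L = 4 / 3 * r ^ 3 * N * sqrt N"
  have L: "L = 4 / 3 * l ^ 3"
  proof -
    have "L = 4 / 3 * (r * sqrt (real n)) ^ 3"
      by (simp add: L_def power3_eq_cube mult_ac)
    then show ?thesis by (simp add: rs)
  qed
  have LP: "L\<^sup>2 / cst \<le> ?P"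
  proof -
    have "L\<^sup>2 / cst = 16 / 9 * l ^ 6 * (1 / cst)"
      by (simp add: L power_mult_distrib power_divide flip: power_mult)
    also have "\<dots> \<le> 16 / 9 * l ^ 6 * (A / real n)" using l by (intro mult_left_mono icst) auto
    finally show ?thesis by (simp add: quartic_dev_def l_def)
  qed
  \<comment> \<open>The Lipschitz constant of \<open>\<Gamma>\<close> on the cube. As
    \<open>r * sqrt n = ln n\<close> and \<open>1 / cst <= A / n\<close>, the powers of
    \<open>n\<close> cancel in its bound.\<close>
  define L' where "L' = 16 / 3 * N\<^sup>2 * sqrt N * r * (r\<^sup>2 + 1 / cst) / cst"
  have L'G: "L'\<^sup>2 / cst \<le> ?G"
  proof -
    have "L' = 16 / 3 * (real n)\<^sup>2 * (r * sqrt (real n)) * (r\<^sup>2 + 1 / cst) * (1 / cst)"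
      by (simp add: L'_def mult_ac)
    also have "\<dots> \<le> 16 / 3 * (real n)\<^sup>2 * (r * sqrt (real n)) * (r\<^sup>2 + A / real n) * (A / real n)"
      using icst r n0 cst_pos A_pos by (intro mult_mono add_left_mono mult_nonneg_nonneg add_nonneg_nonneg) auto
    also have "\<dots> = 16 / 3 * A * l * (l\<^sup>2 + A)"
    proof -
      have "16 / 3 * x\<^sup>2 * l * (l\<^sup>2 / x + a / x) * (a / x) = 16 / 3 * a * l * (l\<^sup>2 + a)" if "x > 0" for a x :: real
        using that by (simp add: field_simps power2_eq_square)
      from this[OF n0] show ?thesis unfolding rs r2 .
    qed
    finally have "L' \<le> 16 / 3 * A * l * (l\<^sup>2 + A)" .
    moreover have "0 \<le> L'" using r cst_pos by (simp add: L'_def)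
    ultimately have "L'\<^sup>2 * (1 / cst) \<le> (16 / 3 * A * l * (l\<^sup>2 + A))\<^sup>2 * (A / real n)"
      using icst cst_pos by (intro mult_mono power_mono) auto
    then show ?thesis by (simp add: cubic_dev_def l_def)
  qed
  have Nc: "0 \<le> N / cst" using cst_pos by simp
  have tail0: "0 \<le> tail r" unfolding tail_def by simp
  have DD: "?D \<le> ?D'"
    unfolding quartic_shift_def using N_cst Nc tail_le A_pos T0
    by (intro mult_left_mono real_sqrt_le_mono mult_mono power_mono) (use tail0 in auto)
  have D0: "0 \<le> ?D"
    using Nc tail0 by simp
  have \<nu>: "\<nu> n z = E (quartic (wt b4))" by (simp add: \<nu>_def gaussian_eq h_eq)
  have \<mu>: "\<mu> n z = E (\<lambda>t. (cub t)\<^sup>2)" by (simp add: \<mu>_def gaussian_eq f_eq)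
  have e\<nu>: "exp (\<nu> n z) \<le> exp (48 * A\<^sup>2)" using \<nu>_le by (simp add: abs_le_iff)
  \<comment> \<open>\<open>F\<close> on the box with the Gaussian weight divided out, so that the
    integral of \<open>F\<close> over \<open>U n\<close> is \<open>Z * E K\<close>.\<close>
  define K where "K t = indicator (U n) t *\<^sub>R (exp (Q t) *\<^sub>R F n d z t)" for t
  have K[measurable]: "K \<in> borel_measurable Leb" unfolding K_def by measurable
  have good: "t \<in> U n \<longleftrightarrow> t \<notin> bad r" if "t \<in> space M" for t
  proof -
    have "t \<in> extensional V" using that unfolding space_M space_PiM by (simp add: PiE_def)
    then have "t \<in> U n \<longleftrightarrow> (\<forall>i\<in>V. - r \<le> t i \<and> t i \<le> r)"
      unfolding U_def r_def PiE_iff atLeastAtMost_iff[of "t _"] by blast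
    also have "\<dots> \<longleftrightarrow> (\<forall>i\<in>V. \<bar>t i\<bar> \<le> r)" unfolding abs_le_iff by (intro ball_cong refl) linarith
    also have "\<dots> \<longleftrightarrow> t \<notin> bad r" unfolding bad_def using that not_less by blast
    finally show ?thesis .
  qed
  have inside: "cmod (K t - ?g t) \<le> 2 * ?\<eta> * exp (quartic (wt b4) t)"
    if t: "t \<in> space M" "t \<notin> bad r" for t
  proof -
    have "\<bar>t i\<bar> \<le> r" if "i \<in> V" for i
      using t that not_less[of r "\<bar>t i\<bar>"] unfolding bad_def by blast
    then have "\<exists>w. cmod w \<le> 32000 * (real n)\<^sup>2 * r ^ 5 \<and>
        F n d z t = exp (of_real (- q n z t) + \<i> * of_real (f n z t) + of_real (h n z t) + w)"
      by (rule F_expansion[OF r small(1)])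
    then obtain w where w: "cmod w \<le> ?\<eta>"
      "F n d z t = exp (of_real (- Q t) + \<i> * of_real (cub t) + of_real (quartic (wt b4) t) + w)"
      unfolding \<eta>_eq q_eq f_eq h_eq by blast
    have "K t = ?g t * exp w"
    proof -
      have "K t = complex_of_real (exp (Q t)) * F n d z t"
        using t good[OF t(1)] by (simp add: K_def scaleR_conv_of_real)
      also have "\<dots> = exp (of_real (Q t) + (of_real (- Q t) + \<i> * of_real (cub t) + of_real (quartic (wt b4) t) + w))"
        unfolding w(2) exp_add exp_of_real ..
      also have "of_real (Q t) + (of_real (- Q t) + \<i> * of_real (cub t) + of_real (quartic (wt b4) t) + w)
          = \<i> * of_real (cub t) + of_real (quartic (wt b4) t) + w" by simp
      finally show ?thesis unfolding exp_add exp_of_real .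
    qed
    then have "K t - ?g t
      = ?g t * (exp w - 1)"
      by (simp add: algebra_simps)
    then have "cmod (K t - ?g t)
      = exp (quartic (wt b4) t) * cmod (exp w - 1)"
      by (simp add: norm_mult)
    \<comment> \<open>As the remainder is at most \<open>1 / 2\<close>, the factor
      \<open>exp \<bar>Re w\<bar>\<close> is at most 2; this is the 2 in the hypothesis of
      \<open>quartic_transform\<close>.\<close>
    also have "cmod (exp w - 1) \<le> 2 * ?\<eta>"
    proof -
      have "cmod (exp w - 1) \<le> exp \<bar>Re w\<bar> * cmod w" using Taylor_exp[of w 0] by simp
      also have "\<dots> \<le> 2 * ?\<eta>"
      proof (intro mult_mono w(1))
        have "\<bar>Re w\<bar> \<le> 1 / 2" using abs_Re_le_cmod[of w] w(1) small(2) by linarith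
        then show "exp \<bar>Re w\<bar> \<le> 2" using exp_bound_half[of "\<bar>Re w\<bar>"] by simp
      qed auto
      finally show ?thesis .
    qed
    finally show ?thesis by (simp add: mult_ac)
  qed
  have outside: "K t = 0" if "t \<in> bad r" for t
  proof -
    have "t \<in> space M" using that unfolding bad_def by blast
    then have "t \<notin> U n" using good that by blast
    then show ?thesis unfolding K_def by simp
  qed
  have "exp (\<nu> n z) * (exp (?D) * (2 * ?\<eta> * exp (L\<^sup>2 / cst)
      + sqrt (exp (4 * L\<^sup>2 / cst) - 1) + tail r) + (exp (?D) - 1)) \<le> err1 A n"
    unfolding err1_def
  proof (intro mult_mono e\<nu> add_mono diff_mono real_sqrt_le_mono tail_le order_refl)
    show "exp (4 * L\<^sup>2 / cst) \<le> exp (4 * ?P)" using LP by simp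
  qed (use \<eta> LP DD D0 T0 cst_pos tail0 in \<open>auto intro!: add_nonneg_nonneg mult_nonneg_nonneg\<close>)
  note err1 = order_trans[OF _ this]
  have meas_cub: "(\<lambda>t. iexp (cub t)) \<in> borel_measurable Leb"
    using exp_growth_measurable[OF exp_growth_iexp[OF exp_growth_cub, of 1]] by simp
  have KE: "cmod (E K - ?n * E (\<lambda>t. iexp (cub t))) \<le> err1 A n"
    unfolding \<nu>
    by (rule err1[unfolded \<nu> L_def], rule quartic_transform[OF wt_b4 r \<eta> meas_cub _ K inside outside]) auto
  \<comment> \<open>For the modulus the phase is 1; the hypothesis on the cube follows from
    \<open>inside\<close> by the reverse triangle inequality.\<close>
  have KE': "cmod (E (\<lambda>t. complex_of_real (cmod (K t))) - ?n * E (\<lambda>t. 1)) \<le> err1 A n"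
    unfolding \<nu>
  proof (rule err1[unfolded \<nu> L_def], rule quartic_transform[OF wt_b4 r \<eta>])
    show "(\<lambda>t. complex_of_real (cmod (K t))) \<in> borel_measurable Leb" by measurable
    fix t assume t: "t \<in> space M" "t \<notin> bad r"
    have "cmod (complex_of_real (cmod (K t)) - 1 * ?h t)
        = \<bar>cmod (K t) - cmod (?g t)\<bar>"
      by (simp add: norm_mult flip: of_real_diff)
    also have "\<dots> \<le> 2 * ?\<eta> * exp (quartic (wt b4) t)"
      by (rule order_trans[OF norm_triangle_ineq3 inside[OF t]])
    finally show "cmod (complex_of_real (cmod (K t)) - 1 * ?h t)
      \<le> 2 * ?\<eta> * exp (quartic (wt b4) t)" .
  qed (use outside in auto)
  have cancel: "exp (- x) * (i * exp x) = i" for x i :: real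
    by (simp add: exp_minus)
  have intF: "(LINT t:U n|lebesgue_space n. F n d z t) = Z *\<^sub>R E K"
  proof -
    have "exp (- Q t) *\<^sub>R K t = indicator (U n) t *\<^sub>R F n d z t" for t
      unfolding K_def scaleR_scaleR cancel ..
    then show ?thesis
      unfolding integral_M[OF K] using Z_pos by (simp add: set_lebesgue_integral_def)
  qed
  have intcF: "(LINT t:U n|lebesgue_space n. cmod (F n d z t)) = Z * E (\<lambda>t. cmod (K t))"
  proof -
    have m: "(\<lambda>t. cmod (K t)) \<in> borel_measurable Leb" by measurable
    have "exp (- Q t) * cmod (K t) = indicator (U n) t * cmod (F n d z t)" for t
    proof -
      have "cmod (K t) = indicator (U n) t * exp (Q t) * cmod (F n d z t)" by (simp add: K_def)
      then show ?thesis using cancel[of "Q t" "indicator (U n) t"] by (simp only: mult.assoc[symmetric])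
    qed
    then show ?thesis
      unfolding integral_M[OF m] using Z_pos by (simp add: set_lebesgue_integral_def)
  qed
  have "\<bar>E (\<lambda>t. cmod (K t)) - exp (\<nu> n z)\<bar> \<le> err1 A n"
  proof -
    have "E (\<lambda>t. 1 :: complex) = 1"
      unfolding lebesgue_integral_const prob_space by simp
    then show ?thesis using KE' by (simp flip: of_real_diff)
  qed
  then have "\<bar>Z * (E (\<lambda>t. cmod (K t)) - exp (\<nu> n z))\<bar> \<le> Z * err1 A n"
    using Z_pos by (simp add: abs_mult)
  then show "\<bar>(LINT t:U n|lebesgue_space n. cmod (F n d z t)) - exp (\<nu> n z) * Xi n z\<bar> \<le> err1 A n * Xi n z"
    unfolding intcF Xi_eq by (simp add: algebra_simps)
  show "0 \<le> err2 A n"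
  proof -
    have "0 \<le> L'\<^sup>2 / cst" using cst_pos by simp
    then have "0 \<le> ?G" using L'G by linarith
    then show ?thesis unfolding err2_def using T0 A_pos by (intro mult_nonneg_nonneg add_nonneg_nonneg) auto
  qed
  have "cmod (E (\<lambda>t. iexp (cub t)) - complex_of_real (exp (- \<mu> n z / 2)))
    \<le> 4 * sqrt (2000000 * (N / cst) ^ 6 * tail r) + 2 * sqrt (exp (L'\<^sup>2 / cst) - 1)"
    unfolding \<mu> L'_def by (rule cub_clt_quantitative[OF r])
  also have "\<dots> \<le> 4 * sqrt (2000000 * A ^ 6 * ?T) + 2 * sqrt (exp ?G - 1)"
    using N_cst Nc tail_le A_pos T0 L'G
    by (intro add_mono mult_left_mono real_sqrt_le_mono mult_mono power_mono diff_mono) (use tail0 in auto)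
  finally have clt: "exp (\<nu> n z) * cmod (E (\<lambda>t. iexp (cub t)) - complex_of_real (exp (- \<mu> n z / 2))) \<le> err2 A n"
    unfolding err2_def using e\<nu> by (intro mult_mono) auto
  \<comment> \<open>First the exponential of the quartic is replaced by
    \<open>exp (\<nu> n z)\<close>, then the mean of the cubic phase by
    \<open>exp (- \<mu> n z / 2)\<close>.\<close>
  have "E K - complex_of_real (exp (- \<mu> n z / 2 + \<nu> n z))
    = (E K - ?n * E (\<lambda>t. iexp (cub t)))
      + ?n * (E (\<lambda>t. iexp (cub t)) - complex_of_real (exp (- \<mu> n z / 2)))"
  proof -
    have "exp (- \<mu> n z / 2 + \<nu> n z) = exp (\<nu> n z) * exp (- \<mu> n z / 2)"
      unfolding exp_add by (rule mult.commute)
    then show ?thesis by (simp only: of_real_mult) (simp add: right_diff_distrib)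
  qed
  also have "cmod \<dots> \<le> err1 A n + err2 A n"
    by (rule order_trans[OF norm_triangle_ineq add_mono[OF KE]]) (use clt in \<open>simp add: norm_mult\<close>)
  finally have "cmod (E K - complex_of_real (exp (- \<mu> n z / 2 + \<nu> n z))) * Z \<le> (err1 A n + err2 A n) * Z"
    using Z_pos by (intro mult_right_mono) auto
  moreover have "(LINT t:U n|lebesgue_space n. F n d z t) - of_real (exp (- \<mu> n z / 2 + \<nu> n z) * Xi n z)
    = (E K - complex_of_real (exp (- \<mu> n z / 2 + \<nu> n z))) * complex_of_real Z"
    unfolding intF Xi_eq by (simp add: scaleR_conv_of_real algebra_simps)
  ultimately show "cmod ((LINT t:U n|lebesgue_space n. F n d z t)
               - of_real (exp (- \<mu> n z / 2 + \<nu> n z) * Xi n z)) \<le> (err1 A n + err2 A n) * Xi n z"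
    using Z_pos by (simp add: norm_mult Xi_eq)
qed

end

section \<open>Choice of the constants\<close>

theorem theorem7p1:
  fixes \<delta> :: real
  assumes "0 < \<delta>" and "\<delta> \<le> 1 / 2"
  shows "\<exists>\<gamma>\<^sub>2>0. \<exists>\<gamma>\<^sub>3>0. \<exists>\<gamma>\<^sub>4>0.
    \<forall>(n::nat) (d :: nat \<Rightarrow> nat) (z :: nat set \<Rightarrow> real).
      n > 2 \<longrightarrow>
      degree_polytope n d \<noteq> {} \<longrightarrow>
      max_entropy_matrix n d z \<longrightarrow>
      (\<forall>j\<in>{1..n}. \<forall>k\<in>{1..n}. j \<noteq> k \<longrightarrow> \<delta> \<le> z {j, k} \<and> z {j, k} \<le> 1 - \<delta>) \<longrightarrow>
      Xi n z \<ge> (4 * pi / real n) powr (real n / 2) \<and>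
      (integrable (gaussian n z) (\<lambda>t. (f n z t)\<^sup>2) \<and> integrable (gaussian n z) (h n z) \<and>
       \<mu> n z \<le> \<gamma>\<^sub>2 \<and> \<bar>\<nu> n z\<bar> \<le> \<gamma>\<^sub>2 \<and> (LINT t|gaussian n z. \<bar>h n z t\<bar>) \<le> \<gamma>\<^sub>2) \<and>
      (\<forall>\<epsilon>::real. 0 < \<epsilon> \<and> \<epsilon> \<le> 1 / 2 \<and> real n \<ge> (1 / \<epsilon>) powr \<gamma>\<^sub>3 \<longrightarrow>
         \<bar>(LINT t:U n|lebesgue_space n. cmod (F n d z t)) - exp (\<nu> n z) * Xi n z\<bar>
           \<le> \<epsilon> * Xi n z) \<and>
      (\<forall>\<epsilon>::real. 0 < \<epsilon> \<and> \<epsilon> \<le> 1 / 2 \<and> real n \<ge> (1 / \<epsilon>) powr \<gamma>\<^sub>4 \<longrightarrow>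
         cmod ((LINT t:U n|lebesgue_space n. F n d z t)
               - of_real (exp (- \<mu> n z / 2 + \<nu> n z) * Xi n z))
           \<le> \<epsilon> * Xi n z)"
proof -
  define A where "A = 6 / \<delta>"
  have A: "A > 0" using assms by (simp add: A_def)
  have "\<forall>\<^sub>F n :: nat in sequentially. 2 * (ln (real n) / sqrt (real n)) \<le> 1 / 4 \<and>
      log_remainder n \<le> 1 / 2"
    unfolding log_remainder_def by (intro eventually_conj; real_asymp)
  from eventually_conj[OF this asymptotic_error_small[OF A]]
  obtain n0 :: nat where n0: "\<And>n. n \<ge> n0 \<Longrightarrow> 2 * (ln (real n) / sqrt (real n)) \<le> 1 / 4"
    "\<And>n. n \<ge> n0 \<Longrightarrow> log_remainder n \<le> 1 / 2"
    "\<And>n. n \<ge> n0 \<Longrightarrow> err1 A n + err2 A n \<le> real n powr (- 1 / 8)"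
    unfolding eventually_sequentially by blast
  \<comment> \<open>As \<open>1 / \<epsilon> >= 2\<close>, the summand \<open>n0\<close> forces
    \<open>n >= 2 ^ n0 >= n0\<close>, so finitely many exceptional dimensions are absorbed into the
    exponent. The summand 8 offsets the exponent \<open>1 / 8\<close>, giving
    \<open>1 / \<epsilon> <= n powr (1 / 8)\<close>.\<close>
  define \<gamma> where "\<gamma> = real n0 + 8"
  have threshold: "n \<ge> n0 \<and> real n powr (- 1 / 8) \<le> \<epsilon>"
    if \<epsilon>: "0 < \<epsilon>" "\<epsilon> \<le> 1 / 2" "(1 / \<epsilon>) powr \<gamma> \<le> real n" for n :: nat and \<epsilon> :: real
  proof
    have two: "2 \<le> 1 / \<epsilon>" using \<epsilon> by (simp add: field_simps)
    have "real n0 \<le> 2 ^ n0" using of_nat_less_two_power[of n0, where 'a=real] by simp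
    also have "\<dots> = 2 powr real n0" by (simp add: powr_realpow)
    also have "\<dots> \<le> 2 powr \<gamma>" by (simp add: \<gamma>_def)
    also have "\<dots> \<le> (1 / \<epsilon>) powr \<gamma>" using two by (intro powr_mono2) (auto simp: \<gamma>_def)
    also note \<epsilon>(3)
    finally show "n \<ge> n0" by simp
    have "1 / \<epsilon> = (1 / \<epsilon>) powr 1" using \<epsilon> by simp
    also have "\<dots> \<le> (1 / \<epsilon>) powr (\<gamma> * (1 / 8))" using two by (intro powr_mono) (auto simp: \<gamma>_def)
    also have "\<dots> = ((1 / \<epsilon>) powr \<gamma>) powr (1 / 8)" by (rule powr_powr[symmetric])
    also have "\<dots> \<le> real n powr (1 / 8)" using \<epsilon>(3) by (intro powr_mono2) auto
    finally have "1 / \<epsilon> \<le> real n powr (1 / 8)" .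
    moreover from this have "0 < real n powr (1 / 8)" using two by linarith
    ultimately have "1 / real n powr (1 / 8) \<le> \<epsilon>" using \<epsilon>(1) by (simp add: field_simps)
    then show "real n powr (- 1 / 8) \<le> \<epsilon>" using powr_minus_divide[of "real n" "1 / 8"] by simp
  qed
  define \<gamma>2 where "\<gamma>2 = 294 * A ^ 3 + 48 * A\<^sup>2"
  have pos: "\<gamma>2 > 0" "\<gamma> > 0" using A by (auto simp: \<gamma>2_def \<gamma>_def intro!: add_pos_pos)
  show ?thesis
  proof (rule exI[of _ \<gamma>2], rule conjI[OF pos(1)], rule exI[of _ \<gamma>], rule conjI[OF pos(2)],
      rule exI[of _ \<gamma>], rule conjI[OF pos(2)], intro allI impI, goal_cases)
    case (1 n d z)
    note n = 1(1) and max = 1(3) and z = 1(4)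
    have deg: "z \<in> degree_polytope n d"
      using max by (simp add: max_entropy_matrix_def is_arg_max_def)
    interpret degree_weights n z \<delta> d
    proof
      show "(\<Sum>j\<in>{1..n} - {k}. z {j, k}) = real (d k)" if "k \<in> {1..n}" for k
        using deg that unfolding degree_polytope_def by blast
    qed (use assms n z in auto)
    have Xi0: "Xi n z > 0" unfolding Xi_eq by (rule Z_pos)
    have "0 \<le> 294 * A ^ 3" "0 \<le> 48 * A\<^sup>2" using A by auto
    then have moments: "\<mu> n z \<le> \<gamma>2" "\<bar>\<nu> n z\<bar> \<le> \<gamma>2" "(LINT t|gaussian n z. \<bar>h n z t\<bar>) \<le> \<gamma>2"
      using \<mu>_le \<nu>_le abs_h_le unfolding \<gamma>2_def A_def by linarith+
    have main: "\<bar>(LINT t:U n|lebesgue_space n. cmod (F n d z t)) - exp (\<nu> n z) * Xi n z\<bar> \<le> \<epsilon> * Xi n z"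
        "cmod ((LINT t:U n|lebesgue_space n. F n d z t) - of_real (exp (- \<mu> n z / 2 + \<nu> n z) * Xi n z)) \<le> \<epsilon> * Xi n z"
      if \<epsilon>: "0 < \<epsilon>" "\<epsilon> \<le> 1 / 2" "(1 / \<epsilon>) powr \<gamma> \<le> real n" for \<epsilon>
    proof -
      have nn: "n \<ge> n0" and small: "real n powr (- 1 / 8) \<le> \<epsilon>" using threshold[OF \<epsilon>] by auto
      note asym = asymptotics[OF n0(1,2)[OF nn], folded A_def]
      have e12: "err1 A n + err2 A n \<le> \<epsilon>" using n0(3)[OF nn] small by linarith
      then have e1: "err1 A n \<le> \<epsilon>" using asym(3) by linarith
      show "\<bar>(LINT t:U n|lebesgue_space n. cmod (F n d z t)) - exp (\<nu> n z) * Xi n z\<bar> \<le> \<epsilon> * Xi n z"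
        by (rule order_trans[OF asym(1) mult_right_mono[OF e1 less_imp_le[OF Xi0]]])
      show "cmod ((LINT t:U n|lebesgue_space n. F n d z t) - of_real (exp (- \<mu> n z / 2 + \<nu> n z) * Xi n z)) \<le> \<epsilon> * Xi n z"
        by (rule order_trans[OF asym(2) mult_right_mono[OF e12 less_imp_le[OF Xi0]]])
    qed
    show ?case
      using Xi_ge integrable_f_h moments main by blast
  qed
qed

end
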